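(* The projectivization map $\Pi$ (which sends an arc-length parametrized curve $u$ in the light cone, with invariants $(k_0,k_1,k_2)=(1,k_1,k_2)$, to the curve $m=\Pi(u)$ in the Möbius sphere, with invariants $(\kappa_1,\kappa_2)$) induces a Poisson map between the spaces of differential invariants $\mathcal K_L^1$ and $\mathcal K_M$ endowed with their respective geometric Poisson brackets. Furthermore, $\mathcal K_L$ with its geometric Poisson bracket foliates into Poisson submanifolds corresponding to constant values of $k_0$, and the Poisson submanifold $\mathcal K_L^1=\{k_0=1\}$ is Poisson equivalent to $\mathcal K_M$.
   Context: Cone and sphere. Set $$J=\begin{pmatrix}0&0&0&-1\\ 0&1&0&0\\ 0&0&1&0\\ -1&0&0&0\end{pmatrix},$$ $\langle u,v\rangle_J=u^TJv$, $\|u\|_J^2=\langle u,u\rangle_J$ on $\mathbb{R}^4$ with coordinates $(u_0,\dots,u_3)$ and standard basis $e_1,\dots,e_4$. $G=O(3,1)=\{\Theta\in GL(4,\mathbb{R}):\Theta^TJ\Theta=J\}$ acts linearly on the light cone $C_L=\{\langle u,u\rangle_J=0\}$, and acts conformally on the Möbius sphere $M$ (projectivized cone, local coordinates $m\in\mathbb{R}^2$) by $\Theta\cdot m=\Pi(\Theta\Lambda(m))$, with $\Pi(u)=(u_1/u_3,u_2/u_3)^T$, $\Lambda(m)=(\frac12\|m\|^2,m_1,m_2,1)^T$. The Lie algebra $\mathfrak g=\mathfrak o(3,1)$ consists of the matrices $$\begin{pmatrix}a&z^T&0\\ w&B&z\\ 0&w^T&-a\end{pmatrix},\quad a\in\mathbb{R},\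 z,w\in\mathbb{R}^2,\ B\text{ skew-symmetric }2\times2.$$ Let $H_L\subset G$ be the isotropy subgroup of $e_4$ (linear action; Lie algebra $\mathfrak h_L=\{a=0,z=0\}$) and $H_M\subset G$ the isotropy subgroup of $m=0$ (conformal action; Lie algebra $\mathfrak h_M=\{z=0\}$). Elements of $G$ are factored locally as $$g=\begin{pmatrix}1&0&0\\ \xi&I&0\\ \frac12\|\xi\|^2&\xi^T&1\end{pmatrix}\begin{pmatrix}\alpha&0&0\\ 0&A&0\\ 0&0&\alpha^{-1}\end{pmatrix}\begin{pmatrix}1&v^T&\frac12\|v\|^2\\ 0&I&v\\ 0&0&1\end{pmatrix},\quad \alpha>0,\ A\in SO(2).$$ Moving frames and invariants. For a curve $u(x)$ in the upper cone ($u_3>0$) with $\|u'\|_J\neq0$, $\rho_L$ is the unique $g$ of this form with $gu=e_4$, $gu'=\|u'\|_Je_2$, third component of $gu''$ zero. For a curve $m(x)$ in $M$ with $m'\ne0$, $\rho_M$ is the unique $g$ of this form whose prolonged conformal action sends $m\mapsto0$, $m'\mapsto(1,0)^T$, $m''\mapsto0$ (the prolonged action is obtained by differentiating $g\cdot m(x)$ in $x$ with $g$ fixed). The left Maurer–Cartan matrices have the form $$-(\rho_L)_x\rho_L^{-1}=\begin{pmatrix}0&k_0&0&0\\ k_1&0&0&k_0\\ k_2&0&0&0\\ 0&k_1&k_2&0\end{pmatrix},\qquad -(\rho_M)_x\rho_M^{-1}=\begin{pmatrix}0&1&0&0\\ \kappa_1&0&0&1\\ \kappa_2&0&0&0\\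 0&\kappa_1&\kappa_2&0\end{pmatrix},$$ with $k_0=\|u'\|_J$; this defines the invariants $k_0,k_1,k_2$ of $u$ and $\kappa_1,\kappa_2$ of $m$. Curves are assumed to have monodromy in $G$, so invariants are periodic in $x\in S^1$. $\mathcal K_L$ denotes the manifold of all matrices of the first form ($k_0>0$, $k_1,k_2$ smooth functions on $S^1$), $\mathcal K_L^1\subset\mathcal K_L$ the subset with $k_0=1$ (curves parametrized by arc-length), and $\mathcal K_M$ the manifold of all matrices of the second form. Geometric Poisson brackets. Let $\mathcal L\mathfrak g=C^\infty(S^1,\mathfrak g)$, with $\mathcal L\mathfrak g^*$ identified with $\mathcal L\mathfrak g$ through $\int_{S^1}\mathrm{trace}(\cdot\,\cdot)\,dx$. On $\mathcal L\mathfrak g^*$ consider the Poisson bracket $$\{\mathcal H,\mathcal F\}_1(L)=\int_{S^1}\mathrm{trace}\Big(\frac{\delta\mathcal F}{\delta L}\Big(\Big(\frac{\delta\mathcal H}{\delta L}\Big)_x+\Big[L,\frac{\delta\mathcal H}{\delta L}\Big]\Big)\Big)dx.$$ For $(\mathcal K,H)=(\mathcal K_L,H_L)$ or $(\mathcal K_M,H_M)$, $\mathcal K$ is locally identified with the quotient $U/\mathcal LH$ of an open set $U\subset\mathcal L\mathfrak g^*$ under the gauge action $L\mapsto g^{-1}Lg+g^{-1}g_x$ of $\mathcal LH=C^\infty(S^1,H)$. The geometric Poisson bracket on $\mathcal K$ is the reduction: for functionals $h,f$ on $\mathcal K$, $\{h,f\}(K)=\{\mathcal H,\mathcal F\}_1(K)$,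 where $\mathcal H,\mathcal F$ are any extensions of $h,f$ constant on the $\mathcal LH$ gauge leaves (it is known that this is a well-defined Poisson bracket). The bracket on $\mathcal K_L^1$ is the one it carries as a submanifold of $\mathcal K_L$. *)

theory Defs
  imports "HOL-Analysis.Analysis" "HOL-Library.Disjoint_Sets"
begin

section \<open>Smooth maps and loops\<close>

text \<open>\<open>k\<close> times continuously differentiable on a (necessarily open) set, by recursion through the
  directional derivatives.\<close>

primrec Ck_on :: "'a::real_normed_vector set \<Rightarrow> ('a \<Rightarrow> 'b::real_normed_vector) \<Rightarrow> nat \<Rightarrow> bool" where
  "Ck_on S f 0 \<longleftrightarrow> continuous_on S f"
| "Ck_on S f (Suc k) \<longleftrightarrow>
     (\<forall>x\<in>S. f differentiable (at x)) \<and> (\<forall>v. Ck_on S (\<lambda>x. frechet_derivative f (at x) v) k)"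

definition smooth_on :: "'a::real_normed_vector set \<Rightarrow> ('a \<Rightarrow> 'b::real_normed_vector) \<Rightarrow> bool" where
  "smooth_on S f \<longleftrightarrow> open S \<and> (\<forall>k. Ck_on S f k)"

definition dx :: "(real \<Rightarrow> 'b::real_normed_vector) \<Rightarrow> real \<Rightarrow> 'b" where
  "dx f x = vector_derivative f (at x)"

text \<open>The circle is \<open>\<real> / 2\<pi>\<int>\<close>; functions on it are \<open>2\<pi>\<close>-periodic functions on the line.\<close>

definition loops_in :: "'b::real_normed_vector set \<Rightarrow> (real \<Rightarrow> 'b) set" where
  "loops_in S = {f. smooth_on UNIV f \<and> (\<forall>x. f (x + 2 * pi) = f x) \<and> range f \<subseteq> S}"

type_synonym mat4 = "real^4^4"
type_synonym loop = "real \<Rightarrow> mat4"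
type_synonym functional = "loop \<Rightarrow> real"
type_synonym bracket = "functional \<Rightarrow> functional \<Rightarrow> functional"


section \<open>The light cone, the Moebius sphere and their groups\<close>

text \<open>The coordinates \<open>u\<^sub>0, \<dots>, u\<^sub>3\<close> of a vector \<open>u\<close> are \<open>u $ 1, \<dots>, u $ 4\<close>, and the basis vector
  \<open>e\<^sub>i\<close> is \<open>axis i 1\<close>.\<close>

definition J :: mat4 where
  "J = vector [vector [0, 0, 0, -1],
               vector [0, 1, 0, 0],
               vector [0, 0, 1, 0],
               vector [-1, 0, 0, 0]]"

definition inner_J :: "real^4 \<Rightarrow> real^4 \<Rightarrow> real" where
  "inner_J u v = u \<bullet> (J *v v)"

definition norm_J :: "real^4 \<Rightarrow> real" where
  "norm_J u = sqrt (inner_J u u)"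

definition O31 :: "mat4 set" where
  "O31 = {\<Theta>. invertible \<Theta> \<and> transpose \<Theta> ** J ** \<Theta> = J}"

definition light_cone :: "(real^4) set" where
  "light_cone = {u. inner_J u u = 0}"

definition Proj :: "real^4 \<Rightarrow> real^2" where
  "Proj u = vector [u $ 2 / u $ 4, u $ 3 / u $ 4]"

definition Lift :: "real^2 \<Rightarrow> real^4" where
  "Lift m = vector [(norm m)\<^sup>2 / 2, m $ 1, m $ 2, 1]"

definition conf_act :: "mat4 \<Rightarrow> real^2 \<Rightarrow> real^2" where
  "conf_act \<Theta> m = Proj (\<Theta> *v Lift m)"

text \<open>\<open>\<Theta>\<close> does not send the point \<open>m\<close> to infinity; only then is \<open>conf_act \<Theta> m\<close> meaningful, as
  division by zero yields zero.\<close>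

definition conf_finite :: "mat4 \<Rightarrow> real^2 \<Rightarrow> bool" where
  "conf_finite \<Theta> m \<longleftrightarrow> (\<Theta> *v Lift m) $ 4 \<noteq> 0"

definition o31 :: "mat4 set" where
  "o31 = {vector [vector [a,     z $ 1, z $ 2, 0    ],
                  vector [w $ 1, 0,     b,     z $ 1],
                  vector [w $ 2, -b,    0,     z $ 2],
                  vector [0,     w $ 1, w $ 2, -a   ]] | (a::real) (z::real^2) (w::real^2) b. True}"

definition H_L :: "mat4 set" where
  "H_L = {\<Theta> \<in> O31. \<Theta> *v axis 4 1 = axis 4 1}"

definition H_M :: "mat4 set" where
  "H_M = {\<Theta> \<in> O31. conf_finite \<Theta> 0 \<and> conf_act \<Theta> 0 = 0}"

definition N_minus :: "real^2 \<Rightarrow> mat4" where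
  "N_minus \<xi> = vector [vector [1,                0,     0,     0],
                       vector [\<xi> $ 1,            1,     0,     0],
                       vector [\<xi> $ 2,            0,     1,     0],
                       vector [(norm \<xi>)\<^sup>2 / 2, \<xi> $ 1, \<xi> $ 2, 1]]"

definition block_diag :: "real \<Rightarrow> real^2^2 \<Rightarrow> mat4" where
  "block_diag \<alpha> A = vector [vector [\<alpha>, 0,         0,         0    ],
                            vector [0, A $ 1 $ 1, A $ 1 $ 2, 0    ],
                            vector [0, A $ 2 $ 1, A $ 2 $ 2, 0    ],
                            vector [0, 0,         0,         1 / \<alpha>]]"

definition N_plus :: "real^2 \<Rightarrow> mat4" where
  "N_plus v = vector [vector [1, v $ 1, v $ 2, (norm v)\<^sup>2 / 2],
                      vector [0, 1,     0,     v $ 1],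
                      vector [0, 0,     1,     v $ 2],
                      vector [0, 0,     0,     1]]"

definition G_factored :: "mat4 set" where
  "G_factored = {N_minus \<xi> ** block_diag \<alpha> A ** N_plus v | \<xi> \<alpha> A v. \<alpha> > 0 \<and> rotation_matrix A}"


section \<open>Moving frames and differential invariants\<close>

definition open_interval :: "real set \<Rightarrow> bool" where
  "open_interval I \<longleftrightarrow> open I \<and> is_interval I \<and> I \<noteq> {}"

definition cone_curve :: "real set \<Rightarrow> (real \<Rightarrow> real^4) \<Rightarrow> bool" where
  "cone_curve I u \<longleftrightarrow> smooth_on I u \<and>
     (\<forall>x\<in>I. u x \<in> light_cone \<and> u x $ 4 > 0 \<and> norm_J (dx u x) \<noteq> 0)"

definition arc_length :: "real set \<Rightarrow> (real \<Rightarrow> real^4) \<Rightarrow> bool" where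
  "arc_length I u \<longleftrightarrow> (\<forall>x\<in>I. norm_J (dx u x) = 1)"

definition sphere_curve :: "real set \<Rightarrow> (real \<Rightarrow> real^2) \<Rightarrow> bool" where
  "sphere_curve I m \<longleftrightarrow> smooth_on I m \<and> (\<forall>x\<in>I. dx m x \<noteq> 0)"

definition frame_L :: "(real \<Rightarrow> real^4) \<Rightarrow> real \<Rightarrow> mat4" where
  "frame_L u x = (THE g. g \<in> G_factored \<and>
     g *v u x = axis 4 1 \<and>
     g *v dx u x = norm_J (dx u x) *\<^sub>R axis 2 1 \<and>
     (g *v dx (dx u) x) $ 3 = 0)"

definition frame_M :: "(real \<Rightarrow> real^2) \<Rightarrow> real \<Rightarrow> mat4" where
  "frame_M m x = (THE g. g \<in> G_factored \<and> conf_finite g (m x) \<and>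
     conf_act g (m x) = 0 \<and>
     dx (\<lambda>y. conf_act g (m y)) x = axis 1 1 \<and>
     dx (dx (\<lambda>y. conf_act g (m y))) x = 0)"

definition has_Maurer_Cartan :: "real set \<Rightarrow> loop \<Rightarrow> loop \<Rightarrow> bool" where
  "has_Maurer_Cartan I \<rho> K \<longleftrightarrow>
     (\<forall>x\<in>I. \<rho> differentiable (at x) \<and> - (dx \<rho> x ** matrix_inv (\<rho> x)) = K x)"

definition K_mat :: "real \<Rightarrow> real \<Rightarrow> real \<Rightarrow> mat4" where
  "K_mat k0 k1 k2 = vector [vector [0,  k0, 0,  0 ],
                            vector [k1, 0,  0,  k0],
                            vector [k2, 0,  0,  0 ],
                            vector [0,  k1, k2, 0 ]]"

definition K_L :: "loop set" where
  "K_L = {(\<lambda>x. K_mat (k0 x) (k1 x) (k2 x)) | k0 k1 k2.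
            k0 \<in> loops_in {0<..} \<and> k1 \<in> loops_in UNIV \<and> k2 \<in> loops_in UNIV}"

definition k0_level :: "(real \<Rightarrow> real) \<Rightarrow> loop set" where
  "k0_level c = {K \<in> K_L. \<forall>x. K x $ 1 $ 2 = c x}"

definition K_L1 :: "loop set" where
  "K_L1 = k0_level (\<lambda>_. 1)"

definition K_M :: "loop set" where
  "K_M = {(\<lambda>x. K_mat 1 (\<kappa>1 x) (\<kappa>2 x)) | \<kappa>1 \<kappa>2. \<kappa>1 \<in> loops_in UNIV \<and> \<kappa>2 \<in> loops_in UNIV}"


section \<open>Functionals and variational derivatives\<close>

text \<open>A smooth one-parameter family of elements of a set \<open>S\<close> of loops, defined for parameters near
  zero.\<close>

definition variation :: "loop set \<Rightarrow> (real \<Rightarrow> loop) \<Rightarrow> bool" where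
  "variation S \<gamma> \<longleftrightarrow>
     (\<exists>\<delta>>0. smooth_on ({-\<delta><..<\<delta>} \<times> UNIV) (\<lambda>(\<epsilon>, x). \<gamma> \<epsilon> x) \<and> (\<forall>\<epsilon>\<in>{-\<delta><..<\<delta>}. \<gamma> \<epsilon> \<in> S))"

text \<open>\<open>d/d\<epsilon> h(L\<^sub>\<epsilon>) = \<integral> trace (Q dL\<^sub>\<epsilon>/d\<epsilon>) dx\<close> at \<open>\<epsilon> = 0\<close> for all variations of \<open>L\<close> inside \<open>S\<close>. If \<open>S\<close> is open in
  the loop algebra, this determines \<open>Q\<close>; for smaller \<open>S\<close>, \<open>Q\<close> is only determined modulo the
  annihilator of the tangent space of \<open>S\<close>.\<close>

definition has_variational_derivative :: "loop set \<Rightarrow> functional \<Rightarrow> loop \<Rightarrow> loop \<Rightarrow> bool" where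
  "has_variational_derivative S h L Q \<longleftrightarrow> Q \<in> loops_in o31 \<and>
     (\<forall>\<gamma>. variation S \<gamma> \<and> \<gamma> 0 = L \<longrightarrow>
        ((\<lambda>\<epsilon>. h (\<gamma> \<epsilon>)) has_real_derivative
           integral {0..2 * pi} (\<lambda>x. trace (Q x ** vector_derivative (\<lambda>\<epsilon>. \<gamma> \<epsilon> x) (at 0)))) (at 0))"

definition functionals :: "loop set \<Rightarrow> functional set" where
  "functionals S = {h. \<forall>L\<in>S. \<exists>Q. has_variational_derivative S h L Q}"

definition var_deriv :: "loop set \<Rightarrow> functional \<Rightarrow> loop \<Rightarrow> loop" where
  "var_deriv S h L = (THE Q. has_variational_derivative S h L Q)"

text \<open>Open in the loop algebra with respect to the topology of uniform convergence of all
  derivatives.\<close>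

definition loop_open :: "loop set \<Rightarrow> bool" where
  "loop_open U \<longleftrightarrow> U \<subseteq> loops_in o31 \<and>
     (\<forall>L\<in>U. \<exists>n. \<exists>\<delta>>0. \<forall>L'\<in>loops_in o31.
        (\<forall>j\<le>n. \<forall>x. norm ((dx ^^ j) L' x - (dx ^^ j) L x) < \<delta>) \<longrightarrow> L' \<in> U)"


section \<open>Poisson brackets\<close>

definition bracket_1 :: "loop set \<Rightarrow> bracket" where
  "bracket_1 U \<H> \<F> L =
     (let dH = var_deriv U \<H> L; dF = var_deriv U \<F> L in
      integral {0..2 * pi} (\<lambda>x. trace (dF x ** (dx dH x + (L x ** dH x - dH x ** L x)))))"

definition gauge :: "loop \<Rightarrow> loop \<Rightarrow> loop" where
  "gauge g L = (\<lambda>x. matrix_inv (g x) ** L x ** g x + matrix_inv (g x) ** dx g x)"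

text \<open>The leaves in \<open>U\<close> are connected: points of one leaf are joined inside \<open>U\<close> by a smooth path of
  gauge transformations starting at the identity. (The full isotropy groups also contain reflections,
  such as \<open>diag(1, 1, -1, 1)\<close>, which identify distinct points of the spaces of invariants, so that
  whole orbits of these groups would be too large.)\<close>

definition constant_on_leaves :: "mat4 set \<Rightarrow> loop set \<Rightarrow> functional \<Rightarrow> bool" where
  "constant_on_leaves H U \<F> \<longleftrightarrow>
     (\<forall>L\<in>U. \<forall>g :: real \<Rightarrow> loop. smooth_on UNIV (\<lambda>(\<epsilon>, x). g \<epsilon> x) \<and> (\<forall>\<epsilon>. g \<epsilon> \<in> loops_in H) \<and> g 0 = (\<lambda>_. mat 1) \<and>
        (\<forall>\<epsilon>\<in>{0..1}. gauge (g \<epsilon>) L \<in> U) \<longrightarrow> \<F> (gauge (g 1) L) = \<F> L)"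

definition gauge_extension :: "loop set \<Rightarrow> mat4 set \<Rightarrow> loop set \<Rightarrow> functional \<Rightarrow> functional \<Rightarrow> bool" where
  "gauge_extension KK H U f \<F> \<longleftrightarrow>
     \<F> \<in> functionals U \<and> (\<forall>K\<in>KK. \<F> K = f K) \<and> constant_on_leaves H U \<F>"

definition geometric_bracket :: "loop set \<Rightarrow> mat4 set \<Rightarrow> bracket" where
  "geometric_bracket KK H h f K =
     (THE b. \<exists>U \<H> \<F>. loop_open U \<and> KK \<subseteq> U \<and>
        gauge_extension KK H U h \<H> \<and> gauge_extension KK H U f \<F> \<and> b = bracket_1 U \<H> \<F> K)"

definition poisson_map :: "loop set \<Rightarrow> bracket \<Rightarrow> loop set \<Rightarrow> bracket \<Rightarrow> (loop \<Rightarrow> loop) \<Rightarrow> bool" where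
  "poisson_map S br\<^sub>S T br\<^sub>T \<Phi> \<longleftrightarrow>
     \<Phi> ` S \<subseteq> T \<and>
     (\<forall>\<gamma>. variation S \<gamma> \<longrightarrow> variation T (\<lambda>\<epsilon>. \<Phi> (\<gamma> \<epsilon>))) \<and>
     (\<forall>f\<in>functionals T. f \<circ> \<Phi> \<in> functionals S) \<and>
     (\<forall>h\<in>functionals T. \<forall>f\<in>functionals T. \<forall>K\<in>S. br\<^sub>S (h \<circ> \<Phi>) (f \<circ> \<Phi>) K = br\<^sub>T h f (\<Phi> K))"

definition poisson_equivalence ::
    "loop set \<Rightarrow> bracket \<Rightarrow> loop set \<Rightarrow> bracket \<Rightarrow> (loop \<Rightarrow> loop) \<Rightarrow> bool" where
  "poisson_equivalence S br\<^sub>S T br\<^sub>T \<Phi> \<longleftrightarrow>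
     bij_betw \<Phi> S T \<and> poisson_map S br\<^sub>S T br\<^sub>T \<Phi> \<and> poisson_map T br\<^sub>T S br\<^sub>S (the_inv_into S \<Phi>)"

definition restricted_bracket :: "loop set \<Rightarrow> bracket \<Rightarrow> loop set \<Rightarrow> bracket" where
  "restricted_bracket P br N h f K =
     (THE b. \<exists>h'\<in>functionals P. \<exists>f'\<in>functionals P.
        (\<forall>L\<in>N. h' L = h L \<and> f' L = f L) \<and> b = br h' f' K)"

text \<open>The bracket restricts to \<open>N\<close> in such a way that the inclusion is a Poisson map.\<close>

definition poisson_submanifold :: "loop set \<Rightarrow> bracket \<Rightarrow> loop set \<Rightarrow> bool" where
  "poisson_submanifold P br N \<longleftrightarrow>
     N \<subseteq> P \<and>
     (\<forall>h\<in>functionals N. \<exists>h'\<in>functionals P. \<forall>L\<in>N. h' L = h L) \<and>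
     poisson_map N (restricted_bracket P br N) P br (\<lambda>L. L)"

definition bracket_L :: bracket where
  "bracket_L = geometric_bracket K_L H_L"

definition bracket_L1 :: bracket where
  "bracket_L1 = restricted_bracket K_L bracket_L K_L1"

definition bracket_M :: bracket where
  "bracket_M = geometric_bracket K_M H_M"


section \<open>Maps of invariants induced by projectivization\<close>

text \<open>Curves are allowed to be defined on any open interval, since a curve with given invariants need
  not stay in the coordinate chart \<open>u\<^sub>3 > 0\<close> for all \<open>x\<close>. A curve defined on the whole line and with
  monodromy \<open>\<Theta>\<close> is projected to a curve with the same monodromy.\<close>

definition induced_by_projectivization :: "(loop \<Rightarrow> loop) \<Rightarrow> bool" where
  "induced_by_projectivization \<Phi> \<longleftrightarrow>
     (\<forall>K\<in>K_L1. \<Phi> K \<in> K_M) \<and>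
     (\<forall>I u. \<forall>K\<in>K_L1. open_interval I \<and> cone_curve I u \<and> arc_length I u \<and>
        has_Maurer_Cartan I (frame_L u) K \<longrightarrow>
          sphere_curve I (Proj \<circ> u) \<and> has_Maurer_Cartan I (frame_M (Proj \<circ> u)) (\<Phi> K)) \<and>
     (\<forall>u. \<forall>\<Theta>\<in>O31. cone_curve UNIV u \<and> (\<forall>x. u (x + 2 * pi) = \<Theta> *v u x) \<longrightarrow>
        (\<forall>x. conf_finite \<Theta> (Proj (u x)) \<and> Proj (u (x + 2 * pi)) = conf_act \<Theta> (Proj (u x))))"

end

theory Submission
  imports Defs
begin

text \<open>
  The spaces \<open>\<K>\<^sub>L\<^sup>1\<close> and \<open>\<K>\<^sub>M\<close> are the same set of loops of matrices, and the map induced by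
  projectivization is the identity. For an arc-length parametrized curve \<open>u\<close> in the cone, the normalizations
  that define the frame of \<open>u\<close> are equivalent to those that define the frame of its projection
  (lemma \<open>frame_conditions_equivalent\<close>), so both curves have the same Maurer-Cartan matrix. Conversely, by
  solving \<open>\<rho>' = - K \<rho>\<close>, every \<open>K\<close> in \<open>\<K>\<^sub>L\<^sup>1\<close> is locally the Maurer-Cartan matrix of a curve
  (\<open>curve_with_invariants\<close>), so no other map is induced.

  It remains to compare Poisson brackets. Let \<open>Q\<close> and \<open>R\<close> be the gradients at \<open>K\<close> of extensions of two
  functionals on a space of invariants. They pair with the variations of \<open>K\<close> inside that space as the
  functionals prescribe, and constancy of the extensions along the gauge leaves says that the covariant
  derivatives \<open>Q' + [K, Q]\<close> and \<open>R' + [K, R]\<close> annihilate the isotropy algebra; call such gradients adapted. The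
  bracket is the integral of \<open>trace (R (Q' + [K, Q]))\<close>. It has to be shown that extensions exist at all:
  a normal form for the gauge action retracts an open set of loops onto the space of invariants, and
  composing a functional with the retraction extends it. Both facts are proved for a general isotropy group
  in the locale \<open>isotropy_reduction\<close>.

  Write \<open>Q = (a, z, w, b)\<close> in the block form of the Lie algebra. On \<open>\<K>\<^sub>L\<close> the functional determines \<open>z\<close> (dual to
  \<open>k\<^sub>1, k\<^sub>2\<close>) and \<open>w\<^sub>1\<close> (dual to \<open>k\<^sub>0\<close>), and annihilation of \<open>\<hh>\<^sub>L\<close> determines the rest algebraically:
  \<open>k\<^sub>0 a = z\<^sub>1'\<close>, \<open>k\<^sub>0 b = - z\<^sub>2'\<close>, and \<open>k\<^sub>0 w\<^sub>2 = k\<^sub>2 z\<^sub>1 - k\<^sub>1 z\<^sub>2 - b'\<close>. On \<open>\<K>\<^sub>M\<close> the functional only determines \<open>z\<close>, and the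
  larger algebra \<open>\<hh>\<^sub>M\<close> also fixes \<open>w\<^sub>1\<close>. The heart of the matter is that the bracket does not depend on
  \<open>w\<^sub>1\<close> (\<open>pairing_z_part\<close>): changing \<open>w\<^sub>1\<close> by \<open>d\<close> changes the integrand by the total derivative of
  \<open>2 d\<close> times the component \<open>z\<^sub>1\<close> of \<open>R\<close>. Therefore the bracket on \<open>\<K>\<^sub>L\<close> ignores derivatives in the direction of \<open>k\<^sub>0\<close>, which makes the level
  sets of \<open>k\<^sub>0\<close> Poisson submanifolds, and at \<open>k\<^sub>0 = 1\<close> it is the same function of the \<open>z\<close>-parts as the
  bracket on \<open>\<K>\<^sub>M\<close>.
\<close>

section \<open>Smooth maps\<close>

lemma Ck_on_cong:
  assumes "open S" "\<And>x. x \<in> S \<Longrightarrow> f x = g x"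
  shows "Ck_on S f k \<longleftrightarrow> Ck_on S g k"
proof -
  have "Ck_on S g k" if "Ck_on S f k" "\<And>x. x \<in> S \<Longrightarrow> f x = g x" for f g :: "'a \<Rightarrow> 'b"
    using that
  proof (induction k arbitrary: f g)
    case 0
    then show ?case by (simp cong: continuous_on_cong)
  next
    case (Suc k)
    have *: "frechet_derivative g (at x) = frechet_derivative f (at x)" "g differentiable (at x)"
      if "x \<in> S" for x
    proof -
      have "(f has_derivative frechet_derivative f (at x)) (at x)"
        using Suc.prems that frechet_derivative_works by auto
      then have "(g has_derivative frechet_derivative f (at x)) (at x)"
        using has_derivative_transform_within_open[OF _ \<open>open S\<close> that] Suc.prems(2) by blast
      then show "frechet_derivative g (at x) = frechet_derivative f (at x)" "g differentiable (at x)"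
        using frechet_derivative_at[of g "frechet_derivative f (at x)" x] by (auto simp: differentiable_def)
    qed
    have "Ck_on S (\<lambda>x. frechet_derivative g (at x) v) k" for v
      by (rule Suc.IH[of "\<lambda>x. frechet_derivative f (at x) v"]) (use Suc.prems(1) * in auto)
    then show ?case
      using * by simp
  qed
  from this[of f g] this[of g f] show ?thesis using assms(2) by auto
qed

lemma Ck_on_SucI:
  assumes "open S" "\<And>x. x \<in> S \<Longrightarrow> (f has_derivative f' x) (at x)" "\<And>v. Ck_on S (\<lambda>x. f' x v) k"
  shows "Ck_on S f (Suc k)"
proof -
  have "frechet_derivative f (at x) = f' x" if "x \<in> S" for x
    using assms(2)[OF that] frechet_derivative_at by metis
  then have "Ck_on S (\<lambda>x. frechet_derivative f (at x) v) k" for v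
    using assms(3)[of v] Ck_on_cong[OF assms(1), of "\<lambda>x. frechet_derivative f (at x) v" "\<lambda>x. f' x v"]
    by auto
  then show ?thesis using assms(2) by (auto simp: differentiable_def)
qed

lemma Ck_on_SucD:
  assumes "Ck_on S f (Suc k)"
  shows "\<And>x. x \<in> S \<Longrightarrow> (f has_derivative frechet_derivative f (at x)) (at x)"
    "\<And>v. Ck_on S (\<lambda>x. frechet_derivative f (at x) v) k"
  using assms frechet_derivative_works by auto

lemma Ck_on_lower: "Ck_on S f (Suc k) \<Longrightarrow> Ck_on S f k"
proof (induction k arbitrary: f)
  case 0
  then show ?case
    by (auto intro!: continuous_at_imp_continuous_on differentiable_imp_continuous_within)
qed (auto)

lemma Ck_on_subset: "Ck_on S f k \<Longrightarrow> T \<subseteq> S \<Longrightarrow> Ck_on T f k"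
  by (induction k arbitrary: f) (auto intro: continuous_on_subset)

lemma Ck_on_const: "Ck_on S (\<lambda>x. c) k"
  by (induction k arbitrary: c) auto

lemma Ck_on_bounded_linear:
  assumes "bounded_linear L" "open S" "Ck_on S f k"
  shows "Ck_on S (\<lambda>x. L (f x)) k"
  using assms(3)
proof (induction k arbitrary: f)
  case 0
  then show ?case using bounded_linear.continuous_on[OF assms(1)] by auto
next
  case (Suc k)
  note d = Ck_on_SucD[OF Suc.prems]
  show ?case
  proof (rule Ck_on_SucI[OF assms(2)])
    show "((\<lambda>x. L (f x)) has_derivative (\<lambda>v. L (frechet_derivative f (at x) v))) (at x)" if "x \<in> S" for x
      using bounded_linear.has_derivative[OF assms(1) d(1)[OF that]] .
  qed (rule Suc.IH[OF d(2)])
qed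

lemma Ck_on_add:
  assumes "open S" "Ck_on S f k" "Ck_on S g k"
  shows "Ck_on S (\<lambda>x. f x + g x) k"
  using assms(2,3)
proof (induction k arbitrary: f g)
  case 0
  then show ?case by (auto intro: continuous_on_add)
next
  case (Suc k)
  note d = Ck_on_SucD[OF Suc.prems(1)] and e = Ck_on_SucD[OF Suc.prems(2)]
  show ?case
    by (rule Ck_on_SucI[OF assms(1) has_derivative_add[OF d(1) e(1)]]) (auto intro!: Suc.IH d e)
qed

lemma Ck_on_bilinear:
  assumes "bounded_bilinear pr" "open S" "Ck_on S f k" "Ck_on S g k"
  shows "Ck_on S (\<lambda>x. pr (f x) (g x)) k"
  using assms(3,4)
proof (induction k arbitrary: f g)
  case 0
  then show ?case using bounded_bilinear.continuous_on[OF assms(1)] by auto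
next
  case (Suc k)
  note d = Ck_on_SucD[OF Suc.prems(1)] and e = Ck_on_SucD[OF Suc.prems(2)]
  show ?case
    by (rule Ck_on_SucI[OF assms(2) bounded_bilinear.FDERIV[OF assms(1) d(1) e(1)]])
      (auto intro!: Ck_on_add Suc.IH d e assms(2) Ck_on_lower[OF Suc.prems(1)] Ck_on_lower[OF Suc.prems(2)])
qed

text \<open>Composition with an inner function that is real valued: the derivative of the outer function is then a
  multiple of its value at \<open>1\<close>, so that the chain rule stays within products.\<close>

lemma Ck_on_compose_real:
  fixes f :: "'a::real_normed_vector \<Rightarrow> real"
  assumes "open S" "Ck_on S f k" "Ck_on T g k" "f ` S \<subseteq> T"
  shows "Ck_on S (\<lambda>x. g (f x)) k"
  using assms(2,3)
proof (induction k arbitrary: g)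
  case 0
  then show ?case using assms(4) by (auto intro: continuous_on_compose2)
next
  case (Suc k)
  note d = Ck_on_SucD[OF Suc.prems(1)] and e = Ck_on_SucD[OF Suc.prems(2)]
  let ?h = "\<lambda>x v. frechet_derivative f (at x) v *\<^sub>R frechet_derivative g (at (f x)) 1"
  show ?case
  proof (rule Ck_on_SucI[OF assms(1), where f' = ?h])
    fix x assume x: "x \<in> S"
    then have fx: "f x \<in> T" using assms(4) by auto
    have "((\<lambda>x. g (f x)) has_derivative (\<lambda>v. frechet_derivative g (at (f x)) (frechet_derivative f (at x) v))) (at x)"
      using has_derivative_compose[OF d(1)[OF x] e(1)[OF fx]] .
    moreover have "frechet_derivative g (at (f x)) r = r *\<^sub>R frechet_derivative g (at (f x)) 1" for r
      using linear_scale[OF has_derivative_linear[OF e(1)[OF fx]], of r 1] by simp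
    then have "(\<lambda>v. frechet_derivative g (at (f x)) (frechet_derivative f (at x) v)) = ?h x"
      by (intro ext)
    ultimately show "((\<lambda>x. g (f x)) has_derivative ?h x) (at x)"
      by metis
  next
    fix v
    have "Ck_on S (\<lambda>x. frechet_derivative g (at (f x)) 1) k"
      using Suc.IH[of "\<lambda>y. frechet_derivative g (at y) 1"] Ck_on_lower[OF Suc.prems(1)] e(2)[of 1] by simp
    then show "Ck_on S (\<lambda>x. ?h x v) k"
      using Ck_on_bilinear[OF bounded_bilinear_scaleR assms(1), of _ k] d(2) by fast
  qed
qed

lemma Ck_on_compose_affine:
  assumes "bounded_linear l" "open S" "Ck_on T f k" "(\<lambda>x. c + l x) ` S \<subseteq> T"
  shows "Ck_on S (\<lambda>x. f (c + l x)) k"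
  using assms(3)
proof (induction k arbitrary: f)
  case 0
  have "continuous_on S (\<lambda>x. c + l x)"
    by (intro continuous_intros bounded_linear.continuous_on[OF assms(1)])
  then show ?case using 0 assms(4) by (auto intro: continuous_on_compose2)
next
  case (Suc k)
  note d = Ck_on_SucD[OF Suc.prems(1)]
  show ?case
  proof (rule Ck_on_SucI[OF assms(2)])
    fix x assume "x \<in> S"
    then have "c + l x \<in> T" using assms(4) by auto
    note d(1)[OF this]
    moreover have "((\<lambda>x. c + l x) has_derivative l) (at x)"
      using has_derivative_add[OF has_derivative_const bounded_linear_imp_has_derivative[OF assms(1)], of c "at x"]
      by simp
    ultimately show "((\<lambda>x. f (c + l x)) has_derivative (\<lambda>v. frechet_derivative f (at (c + l x)) (l v))) (at x)"
      using has_derivative_compose by blast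
  next
    fix v
    show "Ck_on S (\<lambda>x. frechet_derivative f (at (c + l x)) (l v)) k"
      using Suc.IH[of "\<lambda>y. frechet_derivative f (at y) (l v)"] d(2)[of "l v"] by simp
  qed
qed

lemma smooth_on_open: "smooth_on S f \<Longrightarrow> open S"
  by (simp add: smooth_on_def)

lemma smooth_on_cong:
  assumes "\<And>x. x \<in> S \<Longrightarrow> f x = g x"
  shows "smooth_on S f \<longleftrightarrow> smooth_on S g"
  unfolding smooth_on_def using Ck_on_cong[of S f g] assms by blast

lemma smooth_on_subset: "smooth_on S f \<Longrightarrow> open T \<Longrightarrow> T \<subseteq> S \<Longrightarrow> smooth_on T f"
  unfolding smooth_on_def using Ck_on_subset by blast

lemma smooth_on_derivative:
  assumes "smooth_on S f" "x \<in> S"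
  shows "(f has_derivative frechet_derivative f (at x)) (at x)"
  using assms Ck_on_SucD(1)[of S f 0] unfolding smooth_on_def by blast

lemma smooth_on_continuous: "smooth_on S f \<Longrightarrow> continuous_on S f"
  unfolding smooth_on_def using Ck_on.simps(1) by blast

lemma smooth_on_frechet:
  assumes "smooth_on S f"
  shows "smooth_on S (\<lambda>x. frechet_derivative f (at x) v)"
  using assms Ck_on_SucD(2) unfolding smooth_on_def by blast

lemma smooth_on_const: "open S \<Longrightarrow> smooth_on S (\<lambda>x. c)"
  by (simp add: smooth_on_def Ck_on_const)

lemma smooth_on_bounded_linear:
  "bounded_linear L \<Longrightarrow> smooth_on S f \<Longrightarrow> smooth_on S (\<lambda>x. L (f x))"
  by (simp add: smooth_on_def Ck_on_bounded_linear)

lemma smooth_on_add: "smooth_on S f \<Longrightarrow> smooth_on S g \<Longrightarrow> smooth_on S (\<lambda>x. f x + g x)"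
  by (simp add: smooth_on_def Ck_on_add)

lemma smooth_on_bilinear:
  "bounded_bilinear pr \<Longrightarrow> smooth_on S f \<Longrightarrow> smooth_on S g \<Longrightarrow> smooth_on S (\<lambda>x. pr (f x) (g x))"
  by (simp add: smooth_on_def Ck_on_bilinear)

lemma smooth_on_compose_real:
  fixes f :: "'a::real_normed_vector \<Rightarrow> real"
  shows "smooth_on T g \<Longrightarrow> smooth_on S f \<Longrightarrow> (\<And>x. x \<in> S \<Longrightarrow> f x \<in> T) \<Longrightarrow> smooth_on S (\<lambda>x. g (f x))"
  unfolding smooth_on_def by (auto intro!: Ck_on_compose_real[of S f _ T g])

lemma smooth_on_compose_affine:
  assumes "smooth_on T f" "bounded_linear l" "open S" "\<And>x. x \<in> S \<Longrightarrow> c + l x \<in> T"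
  shows "smooth_on S (\<lambda>x. f (c + l x))"
  using assms Ck_on_compose_affine[OF assms(2,3), of T f] unfolding smooth_on_def by blast

lemma smooth_on_uminus: "smooth_on S f \<Longrightarrow> smooth_on S (\<lambda>x. - f x)"
  by (rule smooth_on_bounded_linear[OF bounded_linear_minus[OF bounded_linear_ident]])

lemma smooth_on_diff: "smooth_on S f \<Longrightarrow> smooth_on S g \<Longrightarrow> smooth_on S (\<lambda>x. f x - g x)"
  using smooth_on_add[OF _ smooth_on_uminus, of S f g] by simp

lemma smooth_on_mult:
  fixes f g :: "'a::real_normed_vector \<Rightarrow> real"
  shows "smooth_on S f \<Longrightarrow> smooth_on S g \<Longrightarrow> smooth_on S (\<lambda>x. f x * g x)"
  by (rule smooth_on_bilinear[OF bounded_bilinear_mult])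

lemma smooth_on_scaleR:
  "smooth_on S f \<Longrightarrow> smooth_on S g \<Longrightarrow> smooth_on S (\<lambda>x. f x *\<^sub>R g x)"
  by (rule smooth_on_bilinear[OF bounded_bilinear_scaleR])

lemma smooth_on_power2:
  fixes f :: "'a::real_normed_vector \<Rightarrow> real"
  shows "smooth_on S f \<Longrightarrow> smooth_on S (\<lambda>x. (f x)\<^sup>2)"
  by (simp add: power2_eq_square smooth_on_mult)

lemma smooth_on_sum:
  "finite A \<Longrightarrow> open S \<Longrightarrow> (\<And>i. i \<in> A \<Longrightarrow> smooth_on S (f i)) \<Longrightarrow> smooth_on S (\<lambda>x. \<Sum>i\<in>A. f i x)"
  by (induction rule: finite_induct) (auto intro: smooth_on_const smooth_on_add)

text \<open>A vector is the sum of its components along the axes, and each summand is a linear image of a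
  component.\<close>

lemma smooth_on_vec_iff:
  fixes f :: "'a::real_normed_vector \<Rightarrow> 'b::real_normed_vector^'n"
  assumes "open S"
  shows "smooth_on S f \<longleftrightarrow> (\<forall>i. smooth_on S (\<lambda>x. f x $ i))"
proof
  show "smooth_on S f \<Longrightarrow> \<forall>i. smooth_on S (\<lambda>x. f x $ i)"
    by (auto intro: smooth_on_bounded_linear bounded_linear_vec_nth)
next
  assume *: "\<forall>i. smooth_on S (\<lambda>x. f x $ i)"
  have lin: "bounded_linear (\<lambda>v::'b. axis i v :: 'b^'n)" for i
  proof
    show "\<exists>K. \<forall>x::'b. norm (axis i x :: 'b^'n) \<le> norm x * K"
      by (rule exI[of _ 1]) (simp add: norm_vec_def axis_def if_distrib[of norm] L2_set_def if_distrib[of "\<lambda>t. t\<^sup>2"] sum.delta cong: if_cong)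
  qed (auto simp: axis_def vec_eq_iff)
  have "f = (\<lambda>x. \<Sum>i\<in>UNIV. axis i (f x $ i))"
    by (auto simp: fun_eq_iff vec_eq_iff axis_def sum.delta if_distrib cong: if_cong)
  moreover have "smooth_on S (\<lambda>x. \<Sum>i\<in>UNIV. axis i (f x $ i))"
    by (rule smooth_on_sum) (use * assms in \<open>auto intro: smooth_on_bounded_linear[OF lin]\<close>)
  ultimately show "smooth_on S f" by metis
qed

lemma Ck_on_real_SucI:
  fixes f :: "real \<Rightarrow> real"
  assumes "open S" "\<And>x. x \<in> S \<Longrightarrow> (f has_real_derivative f' x) (at x)" "Ck_on S f' k"
  shows "Ck_on S f (Suc k)"
proof (rule Ck_on_SucI[OF assms(1)])
  show "(f has_derivative (\<lambda>v. f' x * v)) (at x)" if "x \<in> S" for x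
    using assms(2)[OF that] by (simp add: has_field_derivative_def)
  show "Ck_on S (\<lambda>x. f' x * v) k" for v
    using Ck_on_bounded_linear[OF bounded_linear_mult_left assms(1,3)] .
qed

lemma smooth_on_inverse_pos: "smooth_on {0::real<..} inverse"
proof -
  have "Ck_on {0::real<..} inverse k" for k
  proof (induction k)
    case 0
    show ?case by (auto intro!: continuous_intros)
  next
    case (Suc k)
    show ?case
      by (rule Ck_on_real_SucI[where f' = "\<lambda>x. - (inverse x * inverse x)"])
        (auto intro!: derivative_eq_intros Ck_on_bounded_linear[OF bounded_linear_minus[OF bounded_linear_ident]]
          Ck_on_bilinear[OF bounded_bilinear_mult] Suc)
  qed
  then show ?thesis by (simp add: smooth_on_def)
qed

lemma smooth_on_divide:
  fixes f g :: "'a::real_normed_vector \<Rightarrow> real"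
  assumes "smooth_on S f" "smooth_on S g" "\<And>x. x \<in> S \<Longrightarrow> g x > 0"
  shows "smooth_on S (\<lambda>x. f x / g x)"
  unfolding divide_inverse
  by (intro smooth_on_mult smooth_on_compose_real[OF smooth_on_inverse_pos] assms) (use assms in auto)

lemma smooth_on_sqrt:
  fixes f :: "'a::real_normed_vector \<Rightarrow> real"
  assumes "smooth_on S f" "\<And>x. x \<in> S \<Longrightarrow> f x > 0"
  shows "smooth_on S (\<lambda>x. sqrt (f x))"
proof -
  have "Ck_on {0::real<..} sqrt k" for k
  proof (induction k)
    case 0
    show ?case by (auto intro!: continuous_intros)
  next
    case (Suc k)
    have "Ck_on {0<..} (\<lambda>x. inverse (sqrt x)) k"
      by (rule Ck_on_compose_real[OF _ Suc, of "{0<..}"])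
        (use smooth_on_inverse_pos in \<open>auto simp: smooth_on_def\<close>)
    then show ?case
      by (intro Ck_on_real_SucI[where f' = "\<lambda>x. inverse (sqrt x) / 2"])
        (auto intro!: derivative_eq_intros Ck_on_bounded_linear[OF bounded_linear_divide])
  qed
  then have "smooth_on {0::real<..} sqrt" by (simp add: smooth_on_def)
  then show ?thesis by (rule smooth_on_compose_real[OF _ assms(1)]) (use assms(2) in auto)
qed

lemma smooth_on_cos_sin:
  fixes f :: "'a::real_normed_vector \<Rightarrow> real"
  assumes "smooth_on S f"
  shows "smooth_on S (\<lambda>x. cos (f x))" "smooth_on S (\<lambda>x. sin (f x))"
proof -
  have "Ck_on (UNIV::real set) cos k \<and> Ck_on (UNIV::real set) sin k" for k
  proof (induction k)
    case 0
    show ?case by (auto intro!: continuous_intros)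
  next
    case (Suc k)
    have "Ck_on (UNIV::real set) (\<lambda>x. - sin x) k"
      using Suc by (auto intro: Ck_on_bounded_linear[OF bounded_linear_minus[OF bounded_linear_ident]])
    with Suc show ?case
      by (auto simp del: Ck_on.simps intro!: Ck_on_real_SucI[where f = cos] Ck_on_real_SucI[where f = sin] derivative_eq_intros)
  qed
  then have "smooth_on (UNIV::real set) cos" "smooth_on (UNIV::real set) sin" by (auto simp: smooth_on_def)
  from this[THEN smooth_on_compose_real, OF assms]
  show "smooth_on S (\<lambda>x. cos (f x))" "smooth_on S (\<lambda>x. sin (f x))" by auto
qed

lemma smooth_on_exp:
  fixes f :: "'a::real_normed_vector \<Rightarrow> real"
  assumes "smooth_on S f"
  shows "smooth_on S (\<lambda>x. exp (f x))"
proof -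
  have "Ck_on (UNIV::real set) exp k" for k
  proof (induction k)
    case 0
    show ?case by (auto intro!: continuous_intros)
  next
    case (Suc k)
    then show ?case
      by (auto simp del: Ck_on.simps intro!: Ck_on_real_SucI derivative_eq_intros)
  qed
  then have "smooth_on (UNIV::real set) exp" by (auto simp: smooth_on_def)
  from smooth_on_compose_real[OF this assms] show ?thesis by auto
qed

section \<open>Derivatives of curves\<close>

lemma smooth_on_has_vector_derivative:
  assumes "smooth_on S f" "x \<in> S"
  shows "(f has_vector_derivative dx f x) (at x)"
  using smooth_on_derivative[OF assms] unfolding dx_def
  by (meson differentiable_def vector_derivative_works)

lemma dx_eqI: "(f has_vector_derivative f') (at x) \<Longrightarrow> dx f x = f'"
  unfolding dx_def by (rule vector_derivative_at)

lemma dx_eq_frechet: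
  assumes "(f has_derivative f') (at x)"
  shows "dx f x = f' 1"
proof -
  have "(f has_vector_derivative f' 1) (at x)"
  proof -
    have "f' = (\<lambda>v. v *\<^sub>R f' 1)"
    proof
      show "f' v = v *\<^sub>R f' 1" for v
        using linear_scale[OF has_derivative_linear[OF assms], of v 1] by (simp only: real_scaleR_def mult_1_right)
    qed
    then show ?thesis unfolding has_vector_derivative_def using assms by metis
  qed
  then show ?thesis by (rule dx_eqI)
qed

lemma smooth_on_dx:
  assumes "smooth_on S f"
  shows "smooth_on S (dx f)"
proof -
  have "dx f x = frechet_derivative f (at x) 1" if "x \<in> S" for x
    using dx_eq_frechet[OF smooth_on_derivative[OF assms that]] .
  then have "smooth_on S (dx f) \<longleftrightarrow> smooth_on S (\<lambda>x. frechet_derivative f (at x) 1)"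
    by (rule smooth_on_cong)
  then show ?thesis
    using smooth_on_frechet[OF assms, of 1] by simp
qed

lemma dx_cong:
  assumes "open S" "x \<in> S" "\<And>y. y \<in> S \<Longrightarrow> f y = g y"
  shows "dx f x = dx g x"
proof -
  have "\<forall>\<^sub>F y in nhds x. y \<in> UNIV \<longrightarrow> f y = g y"
    using eventually_nhds assms by blast
  then show ?thesis
    unfolding dx_def by (rule vector_derivative_cong_eq) auto
qed

text \<open>A solution of a differential equation is as smooth as the equation allows: each order of
  smoothness of \<open>f\<close> is inherited by \<open>f'\<close>, which raises the order of \<open>f\<close> by one.\<close>

lemma smooth_on_bootstrap:
  fixes f :: "real \<Rightarrow> 'b::real_normed_vector"
  assumes "open S" "\<And>x. x \<in> S \<Longrightarrow> (f has_vector_derivative f' x) (at x)"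
    "\<And>k. Ck_on S f k \<Longrightarrow> Ck_on S f' k"
  shows "smooth_on S f"
proof -
  have "Ck_on S f k" for k
  proof (induction k)
    case 0
    show ?case using assms(2)
      by (auto intro!: continuous_at_imp_continuous_on has_vector_derivative_continuous)
  next
    case (Suc k)
    show ?case
    proof (rule Ck_on_SucI[OF assms(1)])
      show "(f has_derivative (\<lambda>v. v *\<^sub>R f' x)) (at x)" if "x \<in> S" for x
        using assms(2)[OF that] by (simp add: has_vector_derivative_def)
      show "Ck_on S (\<lambda>x. v *\<^sub>R f' x) k" for v
        by (rule Ck_on_bounded_linear[OF bounded_linear_scaleR_right assms(1) assms(3)[OF Suc]])
    qed
  qed
  then show ?thesis using assms(1) by (simp add: smooth_on_def)
qed

section \<open>Families of curves\<close>

text \<open>The families are curried, because the operators of the circle variable, such as \<open>dx\<close> and \<open>gauge\<close>, act on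
  the single curves \<open>F \<epsilon>\<close>.\<close>

definition smooth_family :: "real set \<Rightarrow> (real \<Rightarrow> real \<Rightarrow> 'b::real_normed_vector) \<Rightarrow> bool" where
  "smooth_family V F \<longleftrightarrow> smooth_on (V \<times> UNIV) (\<lambda>p. F (fst p) (snd p))"

lemma smooth_family_case_prod: "smooth_family V F \<longleftrightarrow> smooth_on (V \<times> UNIV) (\<lambda>(\<epsilon>, x). F \<epsilon> x)"
  by (simp add: smooth_family_def case_prod_unfold)

lemma smooth_family_open: "smooth_family V F \<Longrightarrow> open V"
proof -
  assume "smooth_family V F"
  then have "open ((\<lambda>\<epsilon>. (\<epsilon>, 0::real)) -` (V \<times> UNIV))"
    unfolding smooth_family_def by (intro open_vimage smooth_on_open) (auto intro!: continuous_intros)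
  then show "open V" by (simp add: vimage_def)
qed

lemma smooth_family_cong:
  assumes "\<And>\<epsilon> x. \<epsilon> \<in> V \<Longrightarrow> F \<epsilon> x = G \<epsilon> x"
  shows "smooth_family V F \<longleftrightarrow> smooth_family V G"
  unfolding smooth_family_def by (rule smooth_on_cong) (use assms in auto)

lemma smooth_family_subset: "smooth_family V F \<Longrightarrow> open W \<Longrightarrow> W \<subseteq> V \<Longrightarrow> smooth_family W F"
  unfolding smooth_family_def by (erule smooth_on_subset) (auto intro: open_Times)

lemma smooth_family_loop:
  assumes "open V" "smooth_on UNIV f"
  shows "smooth_family V (\<lambda>\<epsilon> x. f x)"
  unfolding smooth_family_def
  using smooth_on_compose_affine[OF assms(2) bounded_linear_snd, of "V \<times> UNIV" 0] assms(1)
  by (simp add: open_Times mem_Times_iff)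

lemma smooth_family_param:
  assumes "open V" "smooth_on V f"
  shows "smooth_family V (\<lambda>\<epsilon> x. f \<epsilon>)"
  unfolding smooth_family_def
  using smooth_on_compose_affine[OF assms(2) bounded_linear_fst, of "V \<times> UNIV" 0] assms(1)
  by (simp add: open_Times mem_Times_iff)

lemma smooth_on_ident: "open S \<Longrightarrow> smooth_on S (\<lambda>x. x)"
proof -
  assume "open S"
  have "Ck_on S (\<lambda>x. x) k" for k
  proof (cases k)
    case (Suc n)
    show ?thesis unfolding Suc
      by (rule Ck_on_SucI[OF \<open>open S\<close> has_derivative_ident]) (rule Ck_on_const)
  qed auto
  then show ?thesis using \<open>open S\<close> by (simp add: smooth_on_def)
qed

lemma smooth_family_reparam:
  assumes "smooth_family V F" "open W" "\<And>\<epsilon>. \<epsilon> \<in> W \<Longrightarrow> c + s * \<epsilon> \<in> V"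
  shows "smooth_family W (\<lambda>\<epsilon> x. F (c + s * \<epsilon>) x)"
proof -
  have "bounded_linear (\<lambda>p::real \<times> real. (s * fst p, snd p))"
    by (intro bounded_linear_Pair bounded_linear_const_mult bounded_linear_fst bounded_linear_snd)
  from smooth_on_compose_affine[OF assms(1)[unfolded smooth_family_def] this, of "W \<times> UNIV" "(c, 0)"]
  show ?thesis unfolding smooth_family_def using assms by (simp add: open_Times mem_Times_iff)
qed

lemma smooth_family_curve:
  assumes "smooth_family V F" "\<epsilon> \<in> V"
  shows "smooth_on UNIV (F \<epsilon>)"
proof -
  have "bounded_linear (\<lambda>x::real. (0::real, x))"
    by (intro bounded_linear_Pair bounded_linear_zero bounded_linear_ident)
  from smooth_on_compose_affine[OF assms(1)[unfolded smooth_family_def] this, of UNIV "(\<epsilon>, 0)"]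
  show ?thesis using assms by auto
qed

lemma smooth_family_transversal:
  assumes "smooth_family V F"
  shows "smooth_on V (\<lambda>\<epsilon>. F \<epsilon> x)"
proof -
  have "bounded_linear (\<lambda>\<epsilon>::real. (\<epsilon>, 0::real))"
    by (intro bounded_linear_Pair bounded_linear_zero bounded_linear_ident)
  from smooth_on_compose_affine[OF assms(1)[unfolded smooth_family_def] this, of V "(0, x)"]
  show ?thesis using smooth_family_open[OF assms] by auto
qed

lemma smooth_family_dx_frechet:
  assumes "smooth_family V F" "\<epsilon> \<in> V"
  shows "dx (F \<epsilon>) x = frechet_derivative (\<lambda>p. F (fst p) (snd p)) (at (\<epsilon>, x)) (0, 1)"
    "dx (\<lambda>e. F e x) \<epsilon> = frechet_derivative (\<lambda>p. F (fst p) (snd p)) (at (\<epsilon>, x)) (1, 0)"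
proof -
  let ?f = "\<lambda>p. F (fst p) (snd p)"
  have D: "(?f has_derivative frechet_derivative ?f (at (\<epsilon>, x))) (at (\<epsilon>, x))"
    using smooth_on_derivative[OF assms(1)[unfolded smooth_family_def], of "(\<epsilon>, x)"] assms(2) by auto
  have "((\<lambda>y. (\<epsilon>, y)) has_derivative (\<lambda>v. (0, v))) (at x)"
    by (auto intro!: derivative_eq_intros)
  from has_derivative_compose[OF this D]
  have "(F \<epsilon> has_derivative (\<lambda>v. frechet_derivative ?f (at (\<epsilon>, x)) (0, v))) (at x)"
    by simp
  from dx_eq_frechet[OF this]
  show "dx (F \<epsilon>) x = frechet_derivative ?f (at (\<epsilon>, x)) (0, 1)" .
  have "((\<lambda>e. (e, x)) has_derivative (\<lambda>v. (v, 0))) (at \<epsilon>)"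
    by (auto intro!: derivative_eq_intros)
  from has_derivative_compose[OF this D]
  have "((\<lambda>e. F e x) has_derivative (\<lambda>v. frechet_derivative ?f (at (\<epsilon>, x)) (v, 0))) (at \<epsilon>)"
    by simp
  from dx_eq_frechet[OF this]
  show "dx (\<lambda>e. F e x) \<epsilon> = frechet_derivative ?f (at (\<epsilon>, x)) (1, 0)" .
qed

lemma smooth_family_dx:
  assumes "smooth_family V F"
  shows "smooth_family V (\<lambda>\<epsilon>. dx (F \<epsilon>))"
  using smooth_on_frechet[OF assms[unfolded smooth_family_def], of "(0, 1)"]
  unfolding smooth_family_def
  by (rule iffD2[OF smooth_on_cong, rotated]) (use smooth_family_dx_frechet[OF assms] in auto)

lemma smooth_family_variation:
  assumes "smooth_family V F"
  shows "smooth_family V (\<lambda>\<epsilon> x. dx (\<lambda>e. F e x) \<epsilon>)"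
  using smooth_on_frechet[OF assms[unfolded smooth_family_def], of "(1, 0)"]
  unfolding smooth_family_def
  by (rule iffD2[OF smooth_on_cong, rotated]) (use smooth_family_dx_frechet[OF assms] in auto)

lemma smooth_family_has_dx:
  assumes "smooth_family V F" "\<epsilon> \<in> V"
  shows "(F \<epsilon> has_vector_derivative dx (F \<epsilon>) x) (at x)"
    "((\<lambda>e. F e x) has_vector_derivative dx (\<lambda>e. F e x) \<epsilon>) (at \<epsilon>)"
  using smooth_on_has_vector_derivative[OF smooth_family_curve[OF assms]]
    smooth_on_has_vector_derivative[OF smooth_family_transversal[OF assms(1)] assms(2)] by auto

lemma smooth_family_continuous:
  "smooth_family V F \<Longrightarrow> continuous_on (V \<times> UNIV) (\<lambda>(\<epsilon>, x). F \<epsilon> x)"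
  unfolding smooth_family_case_prod by (rule smooth_on_continuous)

lemma smooth_continuous_on: "smooth_on UNIV f \<Longrightarrow> continuous_on S f"
  using smooth_on_continuous continuous_on_subset by blast

text \<open>Write \<open>F \<epsilon> y - F \<epsilon> a\<close> as the integral of the derivative along the circle over \<open>[a, y]\<close>, and
  differentiate under the integral sign.\<close>

lemma variation_dx_commute:
  fixes F :: "real \<Rightarrow> real \<Rightarrow> 'b::banach"
  assumes F: "smooth_family V F" and \<epsilon>: "\<epsilon> \<in> V"
  shows "dx (\<lambda>e. dx (F e) x) \<epsilon> = dx (\<lambda>y. dx (\<lambda>e. F e y) \<epsilon>) x"
proof -
  obtain r where r: "r > 0" "ball \<epsilon> r \<subseteq> V"
    using smooth_family_open[OF F] \<epsilon> openE by blast
  define W where "W = ball \<epsilon> r"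
  have W: "\<epsilon> \<in> W" "W \<subseteq> V" "convex W" "open W" using r by (auto simp: W_def)
  define a b where "a = x - 1" and "b = x + 1"
  let ?Fx = "\<lambda>e. dx (F e)"
  let ?Fex = "\<lambda>e s. dx (\<lambda>e. dx (F e) s) e"
  have sFx: "smooth_family V ?Fx" by (rule smooth_family_dx[OF F])
  have sFex: "smooth_family V ?Fex" by (rule smooth_family_variation[OF sFx])
  have int: "integral {a..y} (?Fx e) = F e y - F e a" if "e \<in> V" "y \<in> {a..b}" for e y
    using that smooth_family_has_dx(1)[OF F that(1)]
    by (intro integral_unique fundamental_theorem_of_calculus) (auto intro: has_vector_derivative_at_within)
  have leib: "((\<lambda>e. integral {a..y} (?Fx e)) has_vector_derivative integral {a..y} (?Fex \<epsilon>)) (at \<epsilon>)" for y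
  proof -
    have "((\<lambda>e. integral (cbox a y) (?Fx e)) has_vector_derivative integral (cbox a y) (?Fex \<epsilon>)) (at \<epsilon> within W)"
    proof (rule leibniz_rule_vector_derivative)
      show "((\<lambda>e. ?Fx e t) has_vector_derivative ?Fex e t) (at e within W)" if "e \<in> W" for e t
        using smooth_family_has_dx(2)[OF sFx, of e t] that W by (auto intro: has_vector_derivative_at_within)
      show "?Fx e integrable_on cbox a y" if "e \<in> W" for e
        using smooth_continuous_on[OF smooth_family_curve[OF sFx, of e]] that W by (intro integrable_continuous) auto
      show "continuous_on (W \<times> cbox a y) (\<lambda>(x, t). ?Fex x t)"
        using continuous_on_subset[OF smooth_family_continuous[OF sFex]] W(2) by (meson Sigma_mono subset_UNIV)
    qed (use W in auto)
    then show ?thesis unfolding at_within_open[OF W(1) W(4)] cbox_interval .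
  qed
  have eq: "dx (\<lambda>e. F e y) \<epsilon> = dx (\<lambda>e. F e a) \<epsilon> + integral {a..y} (?Fex \<epsilon>)" if "y \<in> {a..b}" for y
  proof -
    have "((\<lambda>e. F e a + integral {a..y} (?Fx e)) has_vector_derivative
        dx (\<lambda>e. F e a) \<epsilon> + integral {a..y} (?Fex \<epsilon>)) (at \<epsilon>)"
      by (intro has_vector_derivative_add leib smooth_family_has_dx(2)[OF F \<epsilon>])
    then have "((\<lambda>e. F e y) has_vector_derivative dx (\<lambda>e. F e a) \<epsilon> + integral {a..y} (?Fex \<epsilon>)) (at \<epsilon>)"
      by (rule has_vector_derivative_transform_within_open[OF _ W(4) W(1)]) (use int that W in auto)
    then show ?thesis by (rule dx_eqI)
  qed
  have "((\<lambda>y. integral {a..y} (?Fex \<epsilon>)) has_vector_derivative ?Fex \<epsilon> x) (at x within {a..b})"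
    by (rule integral_has_vector_derivative)
      (use smooth_continuous_on[OF smooth_family_curve[OF sFex \<epsilon>]] in \<open>auto simp: a_def b_def\<close>)
  then have "((\<lambda>y. integral {a..y} (?Fex \<epsilon>)) has_vector_derivative ?Fex \<epsilon> x) (at x)"
    using at_within_interior[of x "{a..b}"] by (auto simp: a_def b_def)
  then have "((\<lambda>y. dx (\<lambda>e. F e a) \<epsilon> + integral {a..y} (?Fex \<epsilon>)) has_vector_derivative ?Fex \<epsilon> x) (at x)"
    using has_vector_derivative_add[OF has_vector_derivative_const] by fastforce
  then have "((\<lambda>y. dx (\<lambda>e. F e y) \<epsilon>) has_vector_derivative ?Fex \<epsilon> x) (at x)"
  proof (rule has_vector_derivative_transform_within_open[where S = "{a<..<b}"])
    show "dx (\<lambda>e. F e a) \<epsilon> + integral {a..y} (?Fex \<epsilon>) = dx (\<lambda>e. F e y) \<epsilon>" if "y \<in> {a<..<b}" for y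
      by (rule eq[symmetric]) (use that in auto)
  qed (auto simp: a_def b_def)
  from dx_eqI[OF this] show ?thesis by simp
qed

lemma smooth_family_add:
  "smooth_family V F \<Longrightarrow> smooth_family V G \<Longrightarrow> smooth_family V (\<lambda>\<epsilon> x. F \<epsilon> x + G \<epsilon> x)"
  unfolding smooth_family_def by (rule smooth_on_add)

lemma smooth_family_uminus:
  "smooth_family V F \<Longrightarrow> smooth_family V (\<lambda>\<epsilon> x. - F \<epsilon> x)"
  unfolding smooth_family_def by (rule smooth_on_uminus)

lemma smooth_family_mult:
  fixes F G :: "real \<Rightarrow> real \<Rightarrow> real"
  shows "smooth_family V F \<Longrightarrow> smooth_family V G \<Longrightarrow> smooth_family V (\<lambda>\<epsilon> x. F \<epsilon> x * G \<epsilon> x)"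
  unfolding smooth_family_def by (rule smooth_on_mult)

lemma smooth_family_power2:
  fixes F G :: "real \<Rightarrow> real \<Rightarrow> real"
  shows "smooth_family V F \<Longrightarrow> smooth_family V (\<lambda>\<epsilon> x. (F \<epsilon> x)\<^sup>2)"
  unfolding smooth_family_def by (rule smooth_on_power2)

lemma smooth_family_divide:
  fixes F G :: "real \<Rightarrow> real \<Rightarrow> real"
  assumes "smooth_family V F" "smooth_family V G" "\<And>\<epsilon> x. \<epsilon> \<in> V \<Longrightarrow> G \<epsilon> x > 0"
  shows "smooth_family V (\<lambda>\<epsilon> x. F \<epsilon> x / G \<epsilon> x)"
  using assms unfolding smooth_family_def by (auto intro: smooth_on_divide)

lemma smooth_family_sqrt:
  fixes F :: "real \<Rightarrow> real \<Rightarrow> real"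
  assumes "smooth_family V F" "\<And>\<epsilon> x. \<epsilon> \<in> V \<Longrightarrow> F \<epsilon> x > 0"
  shows "smooth_family V (\<lambda>\<epsilon> x. sqrt (F \<epsilon> x))"
  using assms unfolding smooth_family_def by (auto intro: smooth_on_sqrt)

lemma smooth_family_const: "open V \<Longrightarrow> smooth_family V (\<lambda>\<epsilon> x. c)"
  unfolding smooth_family_def by (auto intro: smooth_on_const open_Times)

lemma smooth_family_bounded_linear:
  "bounded_linear l \<Longrightarrow> smooth_family V F \<Longrightarrow> smooth_family V (\<lambda>\<epsilon> x. l (F \<epsilon> x))"
  unfolding smooth_family_def by (rule smooth_on_bounded_linear)

lemma smooth_family_bilinear:
  "bounded_bilinear pr \<Longrightarrow> smooth_family V F \<Longrightarrow> smooth_family V G \<Longrightarrow> smooth_family V (\<lambda>\<epsilon> x. pr (F \<epsilon> x) (G \<epsilon> x))"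
  unfolding smooth_family_def by (rule smooth_on_bilinear)

lemma smooth_family_mat4_iff:
  fixes F :: "real \<Rightarrow> real \<Rightarrow> mat4"
  assumes "open V"
  shows "smooth_family V F \<longleftrightarrow> (\<forall>i j. smooth_family V (\<lambda>\<epsilon> x. F \<epsilon> x $ i $ j))"
  using assms unfolding smooth_family_def by (simp add: smooth_on_vec_iff open_Times)

section \<open>The Lorentz group and its Lie algebra\<close>

lemma vector_4 [simp]:
  "(vector [a, b, c, d] :: 'a::zero^4) $ 1 = a" "(vector [a, b, c, d] :: 'a::zero^4) $ 2 = b"
  "(vector [a, b, c, d] :: 'a::zero^4) $ 3 = c" "(vector [a, b, c, d] :: 'a::zero^4) $ 4 = d"
  unfolding vector_def by simp_all

lemma mat4_eq_iff: "A = B \<longleftrightarrow> (\<forall>i j. A $ i $ j = (B :: mat4) $ i $ j)"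
  by (simp add: vec_eq_iff)

lemma matrix_mult_4: "(A ** B) $ i $ j = A$i$1 * B$1$j + A$i$2 * B$2$j + A$i$3 * B$3$j + A$i$4 * (B :: mat4)$4$j"
  by (simp add: matrix_matrix_mult_def sum_4)

lemma matrix_vector_mult_4: "(A *v v) $ i = A$i$1 * v$1 + A$i$2 * v$2 + A$i$3 * v$3 + (A :: mat4)$i$4 * v$4"
  by (simp add: matrix_vector_mult_def sum_4)

lemma trace_4: "trace (A :: mat4) = A$1$1 + A$2$2 + A$3$3 + A$4$4"
  by (simp add: trace_def sum_4)

lemma matrix_minus_mult:
  fixes A B C :: "real^'n^'n"
  shows "A ** (B - C) = A ** B - A ** C" "(A - B) ** C = A ** C - B ** C"
    "A ** (- B) = - (A ** B)" "(- A) ** B = - (A ** B)"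
  by (simp_all add: vec_eq_iff matrix_matrix_mult_def sum_subtractf algebra_simps sum_negf)

lemma matrix_add_rdistrib:
  fixes A B C :: "real^'n^'n"
  shows "(A + B) ** C = A ** C + B ** C"
  by (simp add: vec_eq_iff matrix_matrix_mult_def sum.distrib algebra_simps)

lemmas mat_algebra = matrix_add_ldistrib matrix_add_rdistrib matrix_minus_mult matrix_mul_assoc[symmetric]

lemma bounded_bilinear_matrix_mult: "bounded_bilinear ((**) :: real^'n^'n \<Rightarrow> real^'n^'n \<Rightarrow> real^'n^'n)"
  unfolding bilinear_conv_bounded_bilinear[symmetric] bilinear_def
  by (auto intro!: linearI simp: mat_algebra matrix_scalar_ac scalar_matrix_assoc)

lemma bounded_linear_trace: "bounded_linear (trace :: real^'n^'n \<Rightarrow> real)"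
  unfolding linear_conv_bounded_linear[symmetric]
  by (auto intro!: linearI simp: trace_def sum.distrib sum_distrib_left)

lemma bounded_linear_transpose: "bounded_linear (transpose :: real^'n^'n \<Rightarrow> real^'n^'n)"
  unfolding linear_conv_bounded_linear[symmetric]
  by (auto intro!: linearI simp: transpose_def vec_eq_iff)

lemma bounded_linear_entry: "bounded_linear (\<lambda>A::mat4. A $ i $ j)"
  using bounded_linear_compose[OF bounded_linear_vec_nth bounded_linear_vec_nth] .

lemmas matrix_has_vector_derivative = bounded_bilinear.has_vector_derivative[OF bounded_bilinear_matrix_mult]

lemma smooth_on_matrix_mult:
  fixes f g :: "_ \<Rightarrow> mat4"
  shows "smooth_on S f \<Longrightarrow> smooth_on S g \<Longrightarrow> smooth_on S (\<lambda>x. f x ** g x)"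
  by (rule smooth_on_bilinear[OF bounded_bilinear_matrix_mult])

lemma smooth_family_matrix_mult:
  fixes F G :: "_ \<Rightarrow> _ \<Rightarrow> mat4"
  shows "smooth_family V F \<Longrightarrow> smooth_family V G \<Longrightarrow> smooth_family V (\<lambda>\<epsilon> x. F \<epsilon> x ** G \<epsilon> x)"
  by (rule smooth_family_bilinear[OF bounded_bilinear_matrix_mult])

lemma matrix_scaleR_mult:
  fixes A B :: "real^'n^'n"
  shows "(c *\<^sub>R A) ** B = c *\<^sub>R (A ** B)" "A ** (c *\<^sub>R B) = c *\<^sub>R (A ** B)"
  by (simp_all add: scalar_matrix_assoc matrix_scalar_ac)

lemma J_mult_J: "J ** J = mat 1"
  by (simp add: mat4_eq_iff forall_4 matrix_mult_4 J_def mat_def)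

lemma transpose_J: "transpose J = J"
  by (simp add: mat4_eq_iff forall_4 J_def transpose_def)

lemma O31_iff: "\<Theta> \<in> O31 \<longleftrightarrow> transpose \<Theta> ** J ** \<Theta> = J"
proof -
  have "invertible \<Theta>" if "transpose \<Theta> ** J ** \<Theta> = J"
  proof -
    have "(J ** transpose \<Theta> ** J) ** \<Theta> = mat 1"
      using that by (metis J_mult_J matrix_mul_assoc)
    then show ?thesis using invertible_left_inverse by blast
  qed
  then show ?thesis by (auto simp: O31_def)
qed

lemma matrix_inv_unique:
  assumes "A ** B = mat 1"
  shows "matrix_inv A = (B :: real^'n^'n)"
proof -
  have BA: "B ** A = mat 1" using assms matrix_left_right_inverse by blast
  have "A ** matrix_inv A = mat 1 \<and> matrix_inv A ** A = mat 1"
    unfolding matrix_inv_def by (rule someI[of _ B]) (use assms BA in auto)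
  then show ?thesis using BA by (metis matrix_mul_assoc matrix_mul_lid matrix_mul_rid)
qed

text \<open>The inverse of a Lorentz matrix is linear in the matrix; this is why inverses of smooth families are
  smooth.\<close>

lemma matrix_inv_O31:
  assumes "\<Theta> \<in> O31"
  shows "matrix_inv \<Theta> = J ** transpose \<Theta> ** J" "matrix_inv \<Theta> ** \<Theta> = mat 1" "\<Theta> ** matrix_inv \<Theta> = mat 1"
proof -
  have *: "(J ** transpose \<Theta> ** J) ** \<Theta> = mat 1"
    using assms unfolding O31_iff by (metis J_mult_J matrix_mul_assoc)
  then have **: "\<Theta> ** (J ** transpose \<Theta> ** J) = mat 1" using matrix_left_right_inverse by blast
  show 1: "matrix_inv \<Theta> = J ** transpose \<Theta> ** J" by (rule matrix_inv_unique[OF **])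
  show "matrix_inv \<Theta> ** \<Theta> = mat 1" "\<Theta> ** matrix_inv \<Theta> = mat 1" using * ** 1 by auto
qed

lemma O31_cancel:
  assumes "\<Theta> \<in> O31"
  shows "matrix_inv \<Theta> ** (\<Theta> ** X) = (X :: mat4)" "\<Theta> ** (matrix_inv \<Theta> ** X) = (X :: mat4)"
  using matrix_inv_O31[OF assms] by (simp_all add: matrix_mul_assoc)

lemma O31_mult: "A \<in> O31 \<Longrightarrow> B \<in> O31 \<Longrightarrow> A ** B \<in> O31"
  unfolding O31_iff matrix_transpose_mul by (metis matrix_mul_assoc)

lemma O31_matrix_inv:
  assumes "\<Theta> \<in> O31"
  shows "matrix_inv \<Theta> \<in> O31"
proof -
  have "transpose (matrix_inv \<Theta>) = J ** \<Theta> ** J"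
    by (simp add: matrix_inv_O31(1)[OF assms] matrix_transpose_mul transpose_J matrix_mul_assoc)
  then have "transpose (matrix_inv \<Theta>) ** J ** matrix_inv \<Theta> = J ** (\<Theta> ** ((J ** J) ** matrix_inv \<Theta>))"
    by (simp only: matrix_mul_assoc)
  also have "\<dots> = J" by (simp add: J_mult_J matrix_inv_O31(3)[OF assms])
  finally show ?thesis unfolding O31_iff .
qed

lemma matrix_inv_inv_O31: "\<Theta> \<in> O31 \<Longrightarrow> matrix_inv (matrix_inv \<Theta>) = \<Theta>"
  by (rule matrix_inv_unique) (rule matrix_inv_O31)

lemma matrix_inv_mult_O31:
  assumes "A \<in> O31" "B \<in> O31"
  shows "matrix_inv (A ** B) = matrix_inv B ** matrix_inv A"
proof (rule matrix_inv_unique)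
  have "A ** B ** (matrix_inv B ** matrix_inv A) = A ** (B ** (matrix_inv B ** matrix_inv A))"
    by (simp only: matrix_mul_assoc)
  then show "A ** B ** (matrix_inv B ** matrix_inv A) = mat 1"
    using O31_cancel[OF assms(2)] matrix_inv_O31(3)[OF assms(1)] by simp
qed

text \<open>The element of the Lie algebra with blocks \<open>a\<close>, \<open>z = (z1, z2)\<close>, \<open>w = (w1, w2)\<close>, and \<open>b\<close> the upper right entry of
  the skew block.\<close>

definition o31_mat :: "real \<Rightarrow> real \<Rightarrow> real \<Rightarrow> real \<Rightarrow> real \<Rightarrow> real \<Rightarrow> mat4" where
  "o31_mat a z1 z2 w1 w2 b = vector [vector [a,  z1, z2, 0], vector [w1, 0,  b,  z1],
                                 vector [w2, -b, 0,  z2], vector [0,  w1, w2, -a]]"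

lemma o31_mat_nth [simp]:
  "o31_mat a z1 z2 w1 w2 b $ 1 $ 1 = a" "o31_mat a z1 z2 w1 w2 b $ 1 $ 2 = z1" "o31_mat a z1 z2 w1 w2 b $ 1 $ 3 = z2"
  "o31_mat a z1 z2 w1 w2 b $ 1 $ 4 = 0" "o31_mat a z1 z2 w1 w2 b $ 2 $ 1 = w1" "o31_mat a z1 z2 w1 w2 b $ 2 $ 2 = 0"
  "o31_mat a z1 z2 w1 w2 b $ 2 $ 3 = b" "o31_mat a z1 z2 w1 w2 b $ 2 $ 4 = z1" "o31_mat a z1 z2 w1 w2 b $ 3 $ 1 = w2"
  "o31_mat a z1 z2 w1 w2 b $ 3 $ 2 = -b" "o31_mat a z1 z2 w1 w2 b $ 3 $ 3 = 0" "o31_mat a z1 z2 w1 w2 b $ 3 $ 4 = z2"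
  "o31_mat a z1 z2 w1 w2 b $ 4 $ 1 = 0" "o31_mat a z1 z2 w1 w2 b $ 4 $ 2 = w1" "o31_mat a z1 z2 w1 w2 b $ 4 $ 3 = w2"
  "o31_mat a z1 z2 w1 w2 b $ 4 $ 4 = -a"
  by (simp_all add: o31_mat_def)

lemma o31_eq: "o31 = {o31_mat a z1 z2 w1 w2 b | a z1 z2 w1 w2 b. True}"
proof -
  have "o31_mat a z1 z2 w1 w2 b \<in> o31" for a z1 z2 w1 w2 b
    unfolding o31_def
    by (rule CollectI, rule exI[of _ a], rule exI[of _ "vector [z1, z2]"], rule exI[of _ "vector [w1, w2]"], rule exI[of _ b])
      (simp add: o31_mat_def)
  moreover have "X \<in> {o31_mat a z1 z2 w1 w2 b | a z1 z2 w1 w2 b. True}" if "X \<in> o31" for X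
  proof -
    from that obtain a b and z w :: "real^2" where "X = o31_mat a (z$1) (z$2) (w$1) (w$2) b"
      unfolding o31_def o31_mat_def by blast
    then show ?thesis by blast
  qed
  ultimately show ?thesis by blast
qed

lemma o31_mat_in_o31: "o31_mat a z1 z2 w1 w2 b \<in> o31"
  unfolding o31_eq by blast

lemma o31_entries:
  assumes "X \<in> o31"
  shows "X = o31_mat (X$1$1) (X$1$2) (X$1$3) (X$2$1) (X$3$1) (X$2$3)"
  using assms by (auto simp: o31_eq)

text \<open>The description by the infinitesimal form of \<open>\<Theta>\<^sup>T J \<Theta> = J\<close> makes the closure properties of the Lie algebra a
  matter of matrix identities.\<close>

lemma o31_iff: "X \<in> o31 \<longleftrightarrow> transpose X ** J + J ** X = 0"
proof
  assume "X \<in> o31"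
  then obtain a z1 z2 w1 w2 b where "X = o31_mat a z1 z2 w1 w2 b" by (auto simp: o31_eq)
  then show "transpose X ** J + J ** X = 0"
    by (simp add: mat4_eq_iff forall_4 matrix_mult_4 J_def transpose_def)
next
  assume "transpose X ** J + J ** X = 0"
  then have "X = o31_mat (X$1$1) (X$1$2) (X$1$3) (X$2$1) (X$3$1) (X$2$3)"
    by (simp add: mat4_eq_iff forall_4 matrix_mult_4 J_def transpose_def)
  then show "X \<in> o31" by (metis o31_mat_in_o31)
qed

lemma o31_add: "X \<in> o31 \<Longrightarrow> Y \<in> o31 \<Longrightarrow> X + Y \<in> o31"
  and o31_diff: "X \<in> o31 \<Longrightarrow> Y \<in> o31 \<Longrightarrow> X - Y \<in> o31"
  and o31_scaleR: "X \<in> o31 \<Longrightarrow> c *\<^sub>R X \<in> o31"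
  unfolding o31_eq by (auto simp: mat4_eq_iff forall_4 intro!: exI)

lemma o31_transpose:
  assumes "X \<in> o31"
  shows "transpose X \<in> o31"
proof -
  have "transpose (o31_mat a z1 z2 w1 w2 b) = o31_mat a w1 w2 z1 z2 (-b)" for a z1 z2 w1 w2 b
    by (simp add: mat4_eq_iff forall_4 transpose_def)
  then show ?thesis using o31_entries[OF assms] o31_mat_in_o31 by metis
qed

lemma J_cancel: "J ** (J ** X) = (X :: mat4)"
  by (simp add: matrix_mul_assoc J_mult_J)

lemma o31_transpose_J:
  assumes "X \<in> o31"
  shows "transpose X ** J = - (J ** X)" "transpose X ** (J ** Y) = - (J ** (X ** (Y :: mat4)))"
proof -
  show *: "transpose X ** J = - (J ** X)"
    using assms unfolding o31_iff by (simp add: eq_neg_iff_add_eq_0)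
  show "transpose X ** (J ** Y) = - (J ** (X ** Y))"
    unfolding matrix_mul_assoc * by (simp add: matrix_minus_mult)
qed

lemma o31_commutator:
  assumes "X \<in> o31" "Y \<in> o31"
  shows "X ** Y - Y ** X \<in> o31"
proof -
  have "transpose (X ** Y - Y ** X) = transpose Y ** transpose X - transpose X ** transpose Y"
    unfolding matrix_transpose_mul[symmetric] by (simp add: transpose_def vec_eq_iff)
  then show ?thesis unfolding o31_iff
    by (simp add: mat_algebra o31_transpose_J[OF assms(1)] o31_transpose_J[OF assms(2)])
qed

lemma o31_conj:
  assumes \<Theta>: "\<Theta> \<in> O31" and X: "X \<in> o31"
  shows "matrix_inv \<Theta> ** X ** \<Theta> \<in> o31"
proof -
  have inv: "matrix_inv \<Theta> = J ** transpose \<Theta> ** J" by (rule matrix_inv_O31[OF \<Theta>])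
  show ?thesis unfolding o31_iff inv
    by (simp add: matrix_transpose_mul transpose_J matrix_mul_assoc[symmetric] J_cancel J_mult_J)
      (simp add: matrix_mul_assoc[symmetric] o31_transpose_J[OF X] matrix_minus_mult)
qed

lemma trace_o31_mat:
  "trace (o31_mat a z1 z2 w1 w2 b ** o31_mat a' z1' z2' w1' w2' b') =
    2 * (a * a' + z1 * w1' + z2 * w2' + w1 * z1' + w2 * z2' - b * b')"
  by (simp add: trace_4 matrix_mult_4)

lemma trace_o31:
  assumes "X \<in> o31" "Y \<in> o31"
  shows "trace (X ** Y) = 2 * (X$1$1 * Y$1$1 + X$1$2 * Y$2$1 + X$1$3 * Y$3$1 + X$2$1 * Y$1$2 + X$3$1 * Y$1$3 - X$2$3 * Y$2$3)"
  using assms by (auto simp: o31_eq trace_o31_mat)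

lemma trace_transpose_pos:
  "trace (X ** transpose X) \<ge> 0" "trace (X ** transpose X) = 0 \<longleftrightarrow> X = (0::real^'n^'n)"
proof -
  have *: "trace (X ** transpose X) = (\<Sum>i\<in>UNIV. \<Sum>j\<in>UNIV. (X$i$j)\<^sup>2)"
    by (simp add: trace_def matrix_matrix_mult_def transpose_def power2_eq_square)
  show "trace (X ** transpose X) \<ge> 0" unfolding * by (intro sum_nonneg) auto
  show "trace (X ** transpose X) = 0 \<longleftrightarrow> X = (0::real^'n^'n)"
    unfolding * by (subst sum_nonneg_eq_0_iff | simp add: sum_nonneg vec_eq_iff)+
qed

section \<open>Loops\<close>

lemma loops_inI:
  "smooth_on UNIV f \<Longrightarrow> (\<And>x. f (x + 2 * pi) = f x) \<Longrightarrow> (\<And>x. f x \<in> S) \<Longrightarrow> f \<in> loops_in S"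
  by (auto simp: loops_in_def)

lemma loops_inD:
  assumes "f \<in> loops_in S"
  shows "smooth_on UNIV f" "f (x + 2 * pi) = f x" "f x \<in> S"
  using assms by (auto simp: loops_in_def)

lemma loops_in_mono: "S \<subseteq> T \<Longrightarrow> loops_in S \<subseteq> loops_in T"
  by (auto simp: loops_in_def)

lemma loops_in_UNIV: "f \<in> loops_in S \<Longrightarrow> f \<in> loops_in UNIV"
  using loops_in_mono[of S UNIV] by auto

lemma loops_in_UNIV_range: "f \<in> loops_in UNIV \<Longrightarrow> (\<And>x. f x \<in> S) \<Longrightarrow> f \<in> loops_in S"
  by (auto simp: loops_in_def)

lemma loop_has_dx: "f \<in> loops_in S \<Longrightarrow> (f has_vector_derivative dx f x) (at x)"
  using smooth_on_has_vector_derivative loops_inD(1) by blast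

lemma dx_shift: "dx (\<lambda>x. f (x + c)) x = dx f (x + c)"
proof -
  have "((\<lambda>x. f (x + c)) has_vector_derivative D) (at x) \<longleftrightarrow> (f has_vector_derivative D) (at (x + c))" for D
    unfolding has_vector_derivative_def has_derivative_at
    using DERIV_shift by (simp add: algebra_simps)
  then show ?thesis unfolding dx_def vector_derivative_def by simp
qed

lemma loop_dx:
  assumes "f \<in> loops_in S"
  shows "dx f \<in> loops_in UNIV"
proof (rule loops_inI)
  have "(\<lambda>x. f (x + 2 * pi)) = f" using loops_inD(2)[OF assms] by auto
  then show "dx f (x + 2 * pi) = dx f x" for x
    using dx_shift[of f "2 * pi" x] by simp
qed (auto intro: smooth_on_dx loops_inD(1)[OF assms])

lemma loop_const: "c \<in> S \<Longrightarrow> (\<lambda>x. c) \<in> loops_in S"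
  by (auto intro: loops_inI smooth_on_const)

lemma loop_add: "f \<in> loops_in UNIV \<Longrightarrow> g \<in> loops_in UNIV \<Longrightarrow> (\<lambda>x. f x + g x) \<in> loops_in UNIV"
  by (auto simp: loops_in_def smooth_on_add)

lemma loop_diff: "f \<in> loops_in UNIV \<Longrightarrow> g \<in> loops_in UNIV \<Longrightarrow> (\<lambda>x. f x - g x) \<in> loops_in UNIV"
  by (auto simp: loops_in_def smooth_on_diff)

lemma loop_uminus: "f \<in> loops_in UNIV \<Longrightarrow> (\<lambda>x. - f x) \<in> loops_in UNIV"
  by (auto simp: loops_in_def smooth_on_uminus)

lemma loop_mult:
  fixes f g :: "real \<Rightarrow> real"
  shows "f \<in> loops_in UNIV \<Longrightarrow> g \<in> loops_in UNIV \<Longrightarrow> (\<lambda>x. f x * g x) \<in> loops_in UNIV"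
  by (auto simp: loops_in_def smooth_on_mult)

lemma loop_divide:
  fixes f g :: "real \<Rightarrow> real"
  shows "f \<in> loops_in UNIV \<Longrightarrow> g \<in> loops_in {0<..} \<Longrightarrow> (\<lambda>x. f x / g x) \<in> loops_in UNIV"
  by (auto simp: loops_in_def intro!: smooth_on_divide)

lemma loop_bounded_linear: "bounded_linear l \<Longrightarrow> f \<in> loops_in UNIV \<Longrightarrow> (\<lambda>x. l (f x)) \<in> loops_in UNIV"
  by (auto simp: loops_in_def smooth_on_bounded_linear)

lemma loop_scaleR:
  "f \<in> loops_in UNIV \<Longrightarrow> g \<in> loops_in UNIV \<Longrightarrow> (\<lambda>x. f x *\<^sub>R g x) \<in> loops_in UNIV"
  by (auto simp: loops_in_def smooth_on_scaleR)

lemma loop_matrix_mult: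
  fixes f g :: loop
  shows "f \<in> loops_in UNIV \<Longrightarrow> g \<in> loops_in UNIV \<Longrightarrow> (\<lambda>x. f x ** g x) \<in> loops_in UNIV"
  by (auto simp: loops_in_def smooth_on_matrix_mult)

lemma loop_entry: "(f :: loop) \<in> loops_in S \<Longrightarrow> (\<lambda>x. f x $ i $ j) \<in> loops_in UNIV"
  by (rule loop_bounded_linear[OF bounded_linear_entry loops_in_UNIV])

lemma loop_mat4_iff: "(f :: loop) \<in> loops_in UNIV \<longleftrightarrow> (\<forall>i j. (\<lambda>x. f x $ i $ j) \<in> loops_in UNIV)"
  by (auto simp: loops_in_def smooth_on_vec_iff vec_eq_iff)

lemmas loop_intros = loop_add loop_diff loop_uminus loop_mult loop_divide loop_scaleR loop_matrix_mult loop_const[OF UNIV_I]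

lemma loop_o31_mat:
  assumes "a \<in> loops_in UNIV" "z1 \<in> loops_in UNIV" "z2 \<in> loops_in UNIV"
    "w1 \<in> loops_in UNIV" "w2 \<in> loops_in UNIV" "b \<in> loops_in UNIV"
  shows "(\<lambda>x. o31_mat (a x) (z1 x) (z2 x) (w1 x) (w2 x) (b x)) \<in> loops_in o31"
proof (rule loops_in_UNIV_range)
  show "(\<lambda>x. o31_mat (a x) (z1 x) (z2 x) (w1 x) (w2 x) (b x)) \<in> loops_in UNIV"
    unfolding loop_mat4_iff by (simp add: forall_4 assms loop_intros)
qed (rule o31_mat_in_o31)

lemma dx_bounded_linear:
  assumes "bounded_linear l" "(f has_vector_derivative f') (at x)"
  shows "dx (\<lambda>x. l (f x)) x = l f'"
  by (rule dx_eqI) (rule bounded_linear.has_vector_derivative[OF assms])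

lemma dx_entry:
  assumes "(f has_vector_derivative dx f x) (at x)"
  shows "dx f x $ i $ j = dx (\<lambda>x. (f :: loop) x $ i $ j) x"
  using dx_bounded_linear[OF bounded_linear_entry assms] by simp

text \<open>The Lie algebra is the kernel of a bounded linear map, which commutes with differentiation.\<close>

lemma dx_in_o31:
  assumes "open S" "x \<in> S" "\<And>y. y \<in> S \<Longrightarrow> L y \<in> o31" "(L has_vector_derivative L') (at x)"
  shows "L' \<in> o31"
proof -
  let ?l = "\<lambda>X::mat4. transpose X ** J + J ** X"
  have l: "bounded_linear ?l"
    by (intro bounded_linear_add bounded_linear_compose[OF bounded_bilinear.bounded_linear_left[OF bounded_bilinear_matrix_mult] bounded_linear_transpose]
        bounded_bilinear.bounded_linear_right[OF bounded_bilinear_matrix_mult])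
  have "?l L' = dx (\<lambda>y. ?l (L y)) x"
    using dx_bounded_linear[OF l assms(4)] by simp
  also have "\<dots> = dx (\<lambda>y. 0) x"
    by (rule dx_cong[OF assms(1,2)]) (use assms(3) o31_iff in auto)
  also have "\<dots> = 0" by (rule dx_eqI) (rule has_vector_derivative_const)
  finally show ?thesis unfolding o31_iff .
qed

lemma loop_dx_o31: "L \<in> loops_in o31 \<Longrightarrow> dx L \<in> loops_in o31"
  by (rule loops_in_UNIV_range[OF loop_dx]) (auto intro: dx_in_o31[OF open_UNIV UNIV_I] loops_inD(3) loop_has_dx)

lemma loop_commutator:
  "K \<in> loops_in o31 \<Longrightarrow> Q \<in> loops_in o31 \<Longrightarrow> (\<lambda>x. K x ** Q x - Q x ** K x) \<in> loops_in o31"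
  by (rule loops_in_UNIV_range) (auto intro!: loop_intros o31_commutator intro: loops_in_UNIV loops_inD(3))

section \<open>Gauge transformations\<close>

lemma smooth_on_matrix_inv:
  assumes "smooth_on S g" "\<And>x. x \<in> S \<Longrightarrow> g x \<in> O31"
  shows "smooth_on S (\<lambda>x. matrix_inv (g x))"
proof -
  have "smooth_on S (\<lambda>x. J ** transpose (g x) ** J)"
    by (intro smooth_on_matrix_mult smooth_on_const smooth_on_bounded_linear[OF bounded_linear_transpose]
        assms smooth_on_open[OF assms(1)])
  then show ?thesis
    by (rule iffD2[OF smooth_on_cong, rotated]) (use assms matrix_inv_O31 in auto)
qed

lemma smooth_family_matrix_inv:
  "smooth_family V g \<Longrightarrow> (\<And>\<epsilon> x. \<epsilon> \<in> V \<Longrightarrow> g \<epsilon> x \<in> O31) \<Longrightarrow> smooth_family V (\<lambda>\<epsilon> x. matrix_inv (g \<epsilon> x))"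
  unfolding smooth_family_def by (rule smooth_on_matrix_inv) auto

lemma loop_matrix_inv: "g \<in> loops_in O31 \<Longrightarrow> (\<lambda>x. matrix_inv (g x)) \<in> loops_in O31"
  by (auto simp: loops_in_def intro!: smooth_on_matrix_inv O31_matrix_inv)

lemma O31_matrix_inv_derivative:
  assumes S: "open S" "x \<in> S" "\<And>y. y \<in> S \<Longrightarrow> g y \<in> O31" and g: "(g has_vector_derivative g') (at x)"
  shows "((\<lambda>y. matrix_inv (g y)) has_vector_derivative - (matrix_inv (g x) ** g' ** matrix_inv (g x))) (at x)"
proof -
  have gx: "g x \<in> O31" using S by auto
  have l: "bounded_linear (\<lambda>X. J ** transpose X ** J)"
    by (intro bounded_linear_compose[OF bounded_bilinear.bounded_linear_left[OF bounded_bilinear_matrix_mult]]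
       bounded_linear_compose[OF bounded_bilinear.bounded_linear_right[OF bounded_bilinear_matrix_mult]] bounded_linear_transpose)
  define D where "D = J ** transpose g' ** J"
  have "((\<lambda>y. J ** transpose (g y) ** J) has_vector_derivative D) (at x)"
    unfolding D_def by (rule bounded_linear.has_vector_derivative[OF l g])
  then have D: "((\<lambda>y. matrix_inv (g y)) has_vector_derivative D) (at x)"
    by (rule has_vector_derivative_transform_within_open[OF _ S(1,2)]) (use S(3) matrix_inv_O31(1) in auto)
  have "((\<lambda>y. matrix_inv (g y) ** g y) has_vector_derivative matrix_inv (g x) ** g' + D ** g x) (at x)"
    by (rule matrix_has_vector_derivative[OF D g])
  then have "((\<lambda>y. mat 1) has_vector_derivative matrix_inv (g x) ** g' + D ** g x) (at x)"
    by (rule has_vector_derivative_transform_within_open[OF _ S(1,2)]) (use S(3) matrix_inv_O31(2) in auto)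
  then have "matrix_inv (g x) ** g' + D ** g x = 0"
    using vector_derivative_unique_at has_vector_derivative_const by blast
  then have "D ** g x = - (matrix_inv (g x) ** g')" by (simp add: eq_neg_iff_add_eq_0 add.commute)
  then have "D ** (g x ** matrix_inv (g x)) = - (matrix_inv (g x) ** g' ** matrix_inv (g x))"
    by (simp add: matrix_mul_assoc matrix_minus_mult)
  then show ?thesis using D matrix_inv_O31(3)[OF gx] by simp
qed

text \<open>Differentiate \<open>g\<^sup>T J g = J\<close> and write \<open>g' = g \<eta>\<close>.\<close>

lemma O31_logarithmic_derivative:
  assumes S: "open S" "x \<in> S" "\<And>y. y \<in> S \<Longrightarrow> g y \<in> O31" and g: "(g has_vector_derivative g') (at x)"
  shows "matrix_inv (g x) ** g' \<in> o31"
proof -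
  have gx: "g x \<in> O31" using S by auto
  define \<eta> where "\<eta> = matrix_inv (g x) ** g'"
  have g': "g' = g x ** \<eta>" by (simp add: \<eta>_def O31_cancel[OF gx])
  have t: "((\<lambda>y. transpose (g y)) has_vector_derivative transpose g') (at x)"
    by (rule bounded_linear.has_vector_derivative[OF bounded_linear_transpose g])
  have "((\<lambda>y. transpose (g y) ** (J ** g y)) has_vector_derivative
      transpose (g x) ** (J ** g' + 0 ** g x) + transpose g' ** (J ** g x)) (at x)"
    by (intro matrix_has_vector_derivative t g has_vector_derivative_const)
  then have "((\<lambda>y. J) has_vector_derivative
      transpose (g x) ** (J ** g' + 0 ** g x) + transpose g' ** (J ** g x)) (at x)"
    by (rule has_vector_derivative_transform_within_open[OF _ S(1,2)])
      (use S(3) O31_iff matrix_mul_assoc in metis)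
  then have "transpose (g x) ** (J ** g' + 0 ** g x) + transpose g' ** (J ** g x) = 0"
    using vector_derivative_unique_at has_vector_derivative_const by blast
  then have "(transpose (g x) ** J ** g x) ** \<eta> + transpose \<eta> ** (transpose (g x) ** J ** g x) = 0"
    unfolding g' matrix_transpose_mul by (simp add: matrix_mul_assoc)
  then have "transpose \<eta> ** J + J ** \<eta> = 0"
    using gx unfolding O31_iff by (simp add: add.commute)
  then show ?thesis unfolding \<eta>_def[symmetric] o31_iff .
qed

lemma gauge_loop:
  assumes "g \<in> loops_in O31" "L \<in> loops_in o31"
  shows "gauge g L \<in> loops_in o31"
  unfolding gauge_def
proof (rule loops_in_UNIV_range)
  show "(\<lambda>x. matrix_inv (g x) ** L x ** g x + matrix_inv (g x) ** dx g x) \<in> loops_in UNIV"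
    by (intro loop_intros loop_dx[OF assms(1)]) (auto intro: loops_in_UNIV loop_matrix_inv assms)
  show "matrix_inv (g x) ** L x ** g x + matrix_inv (g x) ** dx g x \<in> o31" for x
    using assms
    by (auto intro!: o31_add o31_conj O31_logarithmic_derivative[OF open_UNIV UNIV_I] intro: loops_inD(3) loop_has_dx)
qed

lemma gauge_mult:
  assumes "g \<in> loops_in O31" "h \<in> loops_in O31"
  shows "gauge (\<lambda>x. g x ** h x) L = gauge h (gauge g L)"
proof
  fix x
  have g: "g x \<in> O31" and h: "h x \<in> O31" using assms loops_inD(3) by auto
  have "dx (\<lambda>x. g x ** h x) x = g x ** dx h x + dx g x ** h x"
    by (rule dx_eqI) (intro matrix_has_vector_derivative loop_has_dx[OF assms(1)] loop_has_dx[OF assms(2)])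
  then show "gauge (\<lambda>x. g x ** h x) L x = gauge h (gauge g L) x"
    by (simp add: gauge_def matrix_inv_mult_O31[OF g h] mat_algebra O31_cancel[OF g])
qed

lemma smooth_family_gauge:
  assumes "smooth_family V L" "smooth_family V g" "\<And>\<epsilon> x. \<epsilon> \<in> V \<Longrightarrow> g \<epsilon> x \<in> O31"
  shows "smooth_family V (\<lambda>\<epsilon>. gauge (g \<epsilon>) (L \<epsilon>))"
  unfolding gauge_def
  by (intro smooth_family_add smooth_family_matrix_mult smooth_family_matrix_inv smooth_family_dx assms)

text \<open>The covariant derivative of a loop \<open>Q\<close>: the Hamiltonian field of the bracket on the loop algebra,
  and at the same time the infinitesimal gauge action of \<open>Q\<close>.\<close>

definition cov :: "loop \<Rightarrow> loop \<Rightarrow> loop" where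
  "cov K Q = (\<lambda>x. dx Q x + (K x ** Q x - Q x ** K x))"

lemma loop_cov: "K \<in> loops_in o31 \<Longrightarrow> Q \<in> loops_in o31 \<Longrightarrow> cov K Q \<in> loops_in o31"
  unfolding cov_def
  by (rule loops_in_UNIV_range)
    (auto intro!: loop_add intro: loops_in_UNIV loop_commutator loop_dx_o31 o31_add loops_inD(3)[of _ o31] loops_inD(3)[OF loop_commutator])

text \<open>When both a loop and the gauge transformation applied to it vary, the second variation contributes the
  infinitesimal gauge action of \<open>\<eta> = g\<^sup>-\<^sup>1 \<partial>g/\<partial>\<epsilon>\<close>, which is its covariant derivative. The derivative of \<open>\<eta>\<close> along
  the circle appears because mixed partial derivatives commute.\<close>

lemma gauge_variation:
  assumes L: "smooth_family V L" and g: "smooth_family V g" "\<And>\<epsilon> x. \<epsilon> \<in> V \<Longrightarrow> g \<epsilon> x \<in> O31" and \<epsilon>: "\<epsilon> \<in> V"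
  defines "\<eta> \<equiv> \<lambda>y. matrix_inv (g \<epsilon> y) ** dx (\<lambda>e. g e y) \<epsilon>"
  shows "dx (\<lambda>e. gauge (g e) (L e) x) \<epsilon> =
    matrix_inv (g \<epsilon> x) ** dx (\<lambda>e. L e x) \<epsilon> ** g \<epsilon> x + cov (gauge (g \<epsilon>) (L \<epsilon>)) \<eta> x"
proof -
  have V: "open V" using smooth_family_open[OF L] .
  have O: "g \<epsilon> x \<in> O31" using g(2) \<epsilon> by auto
  let ?A = "matrix_inv (g \<epsilon> x)" and ?dg = "\<lambda>y. dx (\<lambda>e. g e y) \<epsilon>" and ?dL = "dx (\<lambda>e. L e x) \<epsilon>"
  have de: "((\<lambda>e. gauge (g e) (L e) x) has_vector_derivative
      ((?A ** L \<epsilon> x) ** ?dg x + (?A ** ?dL + - (?A ** ?dg x ** ?A) ** L \<epsilon> x) ** g \<epsilon> x)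
      + (?A ** dx (\<lambda>e. dx (g e) x) \<epsilon> + - (?A ** ?dg x ** ?A) ** dx (g \<epsilon>) x)) (at \<epsilon>)"
    unfolding gauge_def
    by (intro has_vector_derivative_add matrix_has_vector_derivative O31_matrix_inv_derivative[OF V \<epsilon> g(2)]
      smooth_family_has_dx(2)[OF g(1) \<epsilon>] smooth_family_has_dx(2)[OF L \<epsilon>]
      smooth_family_has_dx(2)[OF smooth_family_dx[OF g(1)] \<epsilon>]) 
  have "dx \<eta> x = ?A ** dx ?dg x + - (?A ** dx (g \<epsilon>) x ** ?A) ** ?dg x"
    unfolding \<eta>_def
    by (rule dx_eqI)
      (intro matrix_has_vector_derivative O31_matrix_inv_derivative[OF open_UNIV UNIV_I g(2)[OF \<epsilon>]]
        smooth_family_has_dx(1)[OF g(1) \<epsilon>] smooth_family_has_dx(1)[OF smooth_family_variation[OF g(1)] \<epsilon>])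
  moreover have "dx ?dg x = dx (\<lambda>e. dx (g e) x) \<epsilon>"
    using variation_dx_commute[OF g(1) \<epsilon>] by simp
  ultimately show ?thesis
    unfolding dx_eqI[OF de] cov_def
    by (simp add: gauge_def \<eta>_def mat_algebra O31_cancel[OF O] algebra_simps)
qed

section \<open>Integrals over the circle\<close>

definition circle_integral :: "(real \<Rightarrow> real) \<Rightarrow> real" where
  "circle_integral f = integral {0..2 * pi} f"

lemma loop_integrable:
  fixes f :: "real \<Rightarrow> real"
  assumes "f \<in> loops_in UNIV"
  shows "f integrable_on {0..2 * pi}"
  using smooth_continuous_on[OF loops_inD(1)[OF assms]] by (intro integrable_continuous_real) 

lemma circle_integral_add:
  "f \<in> loops_in UNIV \<Longrightarrow> g \<in> loops_in UNIV \<Longrightarrow> circle_integral (\<lambda>x. f x + g x) = circle_integral f + circle_integral g"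
  unfolding circle_integral_def by (intro integral_add loop_integrable)

lemma circle_integral_diff:
  "f \<in> loops_in UNIV \<Longrightarrow> g \<in> loops_in UNIV \<Longrightarrow> circle_integral (\<lambda>x. f x - g x) = circle_integral f - circle_integral g"
  unfolding circle_integral_def by (intro integral_diff loop_integrable)

lemma circle_integral_dx:
  assumes "f \<in> loops_in UNIV"
  shows "circle_integral (dx f) = 0"
proof -
  have "(dx f has_integral (f (2 * pi) - f 0)) {0..2 * pi}"
    by (rule fundamental_theorem_of_calculus)
      (auto intro: has_vector_derivative_at_within loop_has_dx[OF assms])
  then show ?thesis
    using loops_inD(2)[OF assms, of 0] by (simp add: circle_integral_def integral_unique)
qed

lemma periodic_wrap:
  assumes "\<And>x. f (x + 2 * pi) = f x"
  obtains y where "y \<in> {0..2 * pi}" "f y = f x"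
proof -
  have nat: "f (x + 2 * pi * real n) = f x" for x n
  proof (induction n)
    case (Suc n)
    then show ?case using assms[of "x + 2 * pi * real n"] by (simp add: algebra_simps)
  qed auto
  have int: "f (x + 2 * pi * of_int k) = f x" for x k
  proof (cases "k \<ge> 0")
    case True
    then show ?thesis using nat[of x "nat k"] by simp
  next
    case False
    then show ?thesis using nat[of "x + 2 * pi * of_int k" "nat (- k)"] by simp
  qed
  define k where "k = \<lfloor>x / (2 * pi)\<rfloor>"
  have "of_int k \<le> x / (2 * pi)" "x / (2 * pi) < of_int k + 1"
    unfolding k_def by linarith+
  then have "2 * pi * of_int k \<le> x" "x \<le> 2 * pi + 2 * pi * of_int k"
    by (auto simp: field_simps)
  then show ?thesis
    using that[of "x - 2 * pi * of_int k"] int[of x "- k"] by simp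
qed

text \<open>The fundamental lemma of the calculus of variations is used in this form throughout: a function is tested
  against itself.\<close>

lemma circle_integral_nonneg_eq_0:
  assumes f: "f \<in> loops_in UNIV" and "\<And>x. f x \<ge> 0" and "circle_integral f = 0"
  shows "f x = 0"
proof -
  obtain y where y: "y \<in> {0..2 * pi}" "f y = f x"
    using periodic_wrap[of f x] loops_inD(2)[OF f] by metis
  have "f y = 0"
    using integral_eq_0_iff[of 0 "2 * pi" f] assms y smooth_continuous_on[OF loops_inD(1)[OF f]]
    by (auto simp: circle_integral_def)
  then show ?thesis using y by simp
qed

lemma loop_trace: "(f :: loop) \<in> loops_in UNIV \<Longrightarrow> (\<lambda>x. trace (f x)) \<in> loops_in UNIV"
  by (rule loop_bounded_linear[OF bounded_linear_trace])

text \<open>Integration by parts for the derivative; the commutator is skew because the trace is cyclic.\<close>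

lemma cov_skew_adjoint:
  assumes K: "K \<in> loops_in o31" and Q: "Q \<in> loops_in o31" and R: "R \<in> loops_in o31"
  shows "circle_integral (\<lambda>x. trace (Q x ** cov K R x)) = - circle_integral (\<lambda>x. trace (cov K Q x ** R x))"
proof -
  note U = loops_in_UNIV[OF K] loops_in_UNIV[OF Q] loops_in_UNIV[OF R]
    loops_in_UNIV[OF loop_cov[OF K R]] loops_in_UNIV[OF loop_cov[OF K Q]]
  have "((\<lambda>y. trace (Q y ** R y)) has_vector_derivative trace (Q x ** dx R x + dx Q x ** R x)) (at x)" for x
    by (intro bounded_linear.has_vector_derivative[OF bounded_linear_trace] matrix_has_vector_derivative loop_has_dx[OF Q] loop_has_dx[OF R])
  then have *: "dx (\<lambda>y. trace (Q y ** R y)) x = trace (Q x ** dx R x + dx Q x ** R x)" for x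
    by (rule dx_eqI)
  have "trace (Q x ** cov K R x) + trace (cov K Q x ** R x) = dx (\<lambda>y. trace (Q y ** R y)) x" for x
    unfolding * cov_def
    using trace_mul_sym[of "Q x ** R x" "K x"] by (simp add: mat_algebra trace_add trace_sub)
  then have "circle_integral (\<lambda>x. trace (Q x ** cov K R x) + trace (cov K Q x ** R x)) = 0"
    using circle_integral_dx[OF loop_trace[OF loop_matrix_mult[OF U(2,3)]]] by simp
  then show ?thesis
    by (subst (asm) circle_integral_add) (auto intro!: loop_trace loop_matrix_mult U)
qed

section \<open>Open sets of loops and variational derivatives\<close>

lemma smooth_family_dx_iter:
  "smooth_family V F \<Longrightarrow> smooth_family V (\<lambda>\<epsilon>. (dx ^^ j) (F \<epsilon>))"
proof (induction j)
  case (Suc j)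
  show ?case using smooth_family_dx[OF Suc.IH[OF Suc.prems]] by simp
qed simp

lemma loop_dx_iter: "f \<in> loops_in UNIV \<Longrightarrow> (dx ^^ j) f \<in> loops_in UNIV"
  by (induction j) (auto intro: loop_dx)

text \<open>Uniformity in the circle variable comes from compactness of the circle.\<close>

lemma smooth_family_uniform:
  fixes F :: "real \<Rightarrow> real \<Rightarrow> 'b::real_normed_vector"
  assumes F: "smooth_family V F" "\<And>\<epsilon> x. \<epsilon> \<in> V \<Longrightarrow> F \<epsilon> (x + 2 * pi) = F \<epsilon> x" and V: "0 \<in> V" and r: "r > 0"
  shows "\<exists>d>0. \<forall>\<epsilon>. \<bar>\<epsilon>\<bar> < d \<longrightarrow> \<epsilon> \<in> V \<and> (\<forall>x. norm (F \<epsilon> x - F 0 x) < r)"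
proof -
  obtain a where a: "a > 0" "cball 0 a \<subseteq> V"
    using smooth_family_open[OF F(1)] V open_contains_cball by blast
  have "continuous_on (cball 0 a \<times> {0..2 * pi}) (\<lambda>(\<epsilon>, x). F \<epsilon> x)"
    by (rule continuous_on_subset[OF smooth_family_continuous[OF F(1)]]) (use a in auto)
  then have "uniformly_continuous_on (cball 0 a \<times> {0..2 * pi}) (\<lambda>(\<epsilon>, x). F \<epsilon> x)"
    by (rule compact_uniformly_continuous) (intro compact_Times compact_cball compact_Icc)
  then obtain d where d: "d > 0" and D: "\<And>p q. p \<in> cball 0 a \<times> {0..2 * pi} \<Longrightarrow> q \<in> cball 0 a \<times> {0..2 * pi} \<Longrightarrow>
      dist q p < d \<Longrightarrow> dist ((\<lambda>(\<epsilon>, x). F \<epsilon> x) q) ((\<lambda>(\<epsilon>, x). F \<epsilon> x) p) < r"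
    unfolding uniformly_continuous_on_def using r by metis
  show ?thesis
  proof (intro exI[of _ "min a d"] conjI allI impI)
    fix \<epsilon> x :: real assume e: "\<bar>\<epsilon>\<bar> < min a d"
    then have eV: "\<epsilon> \<in> cball 0 a" by simp
    then show "\<epsilon> \<in> V" using a by auto
    have per: "(F \<epsilon> (x + 2 * pi), F 0 (x + 2 * pi)) = (F \<epsilon> x, F 0 x)" for x
      using F(2) V \<open>\<epsilon> \<in> V\<close> by auto
    obtain y where y: "y \<in> {0..2 * pi}" "(F \<epsilon> y, F 0 y) = (F \<epsilon> x, F 0 x)"
      using periodic_wrap[of "\<lambda>x. (F \<epsilon> x, F 0 x)" x] per by metis
    have "dist (\<epsilon>, y) (0, y) < d" using e by (simp add: dist_Pair_Pair)
    from D[OF _ _ this] y eV a have "dist (F \<epsilon> y) (F 0 y) < r" by auto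
    then show "norm (F \<epsilon> x - F 0 x) < r" using y by (simp add: dist_norm)
  qed (use a d in auto)
qed

text \<open>Openness only involves finitely many derivatives along the circle, and each of them is itself a smooth
  family.\<close>

lemma loop_open_family:
  assumes U: "loop_open U" and F: "smooth_family V F" "\<And>\<epsilon>. \<epsilon> \<in> V \<Longrightarrow> F \<epsilon> \<in> loops_in o31" and V: "0 \<in> V" "F 0 \<in> U"
  shows "\<exists>d>0. {-d<..<d} \<subseteq> V \<and> (\<forall>\<epsilon>\<in>{-d<..<d}. F \<epsilon> \<in> U)"
proof -
  obtain n r where r: "r > 0" and
    n: "\<And>L'. L' \<in> loops_in o31 \<Longrightarrow> (\<And>j x. j \<le> n \<Longrightarrow> norm ((dx ^^ j) L' x - (dx ^^ j) (F 0) x) < r) \<Longrightarrow> L' \<in> U"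
    using U V(2) unfolding loop_open_def by metis
  have "\<exists>d>0. \<forall>\<epsilon>. \<bar>\<epsilon>\<bar> < d \<longrightarrow> \<epsilon> \<in> V \<and> (\<forall>x. norm ((dx ^^ j) (F \<epsilon>) x - (dx ^^ j) (F 0) x) < r)" for j
    by (rule smooth_family_uniform[OF smooth_family_dx_iter[OF F(1)] _ V(1) r])
      (use F(2) loop_dx_iter loops_in_UNIV loops_inD(2) in blast)
  then obtain d where d: "\<And>j. d j > 0" and
    D: "\<And>j \<epsilon>. \<bar>\<epsilon>\<bar> < d j \<Longrightarrow> \<epsilon> \<in> V \<and> (\<forall>x. norm ((dx ^^ j) (F \<epsilon>) x - (dx ^^ j) (F 0) x) < r)"
    by metis
  define m where "m = Min (d ` {..n})"
  have m: "m > 0" "\<And>j. j \<le> n \<Longrightarrow> m \<le> d j" using d unfolding m_def by auto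
  have "\<epsilon> \<in> V \<and> F \<epsilon> \<in> U" if "\<epsilon> \<in> {-m<..<m}" for \<epsilon>
  proof -
    have "\<bar>\<epsilon>\<bar> < d j" if "j \<le> n" for j using m(2)[OF that] \<open>\<epsilon> \<in> {-m<..<m}\<close> by auto
    then have "\<epsilon> \<in> V" "\<And>j x. j \<le> n \<Longrightarrow> norm ((dx ^^ j) (F \<epsilon>) x - (dx ^^ j) (F 0) x) < r" using D by blast+
    then show ?thesis using n F(2) by blast
  qed
  then show ?thesis using m(1) by blast
qed

lemma variationI:
  assumes "smooth_family V \<gamma>" "0 \<in> V" "\<And>\<epsilon>. \<epsilon> \<in> V \<Longrightarrow> \<gamma> \<epsilon> \<in> S"
  shows "variation S \<gamma>"
proof -
  obtain a where a: "a > 0" "ball 0 a \<subseteq> V"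
    using smooth_family_open[OF assms(1)] assms(2) openE by blast
  moreover have "ball 0 a = {-a<..<a}" by (auto simp: dist_real_def)
  ultimately have "smooth_family {-a<..<a} \<gamma>" using smooth_family_subset[OF assms(1)] by auto
  then show ?thesis
    unfolding variation_def smooth_family_case_prod using a \<open>ball 0 a = {-a<..<a}\<close> assms(3) by blast
qed

lemma variationE:
  assumes "variation S \<gamma>"
  obtains d where "d > 0" "smooth_family {-d<..<d} \<gamma>" "\<And>\<epsilon>. \<epsilon> \<in> {-d<..<d} \<Longrightarrow> \<gamma> \<epsilon> \<in> S"
  using assms unfolding variation_def smooth_family_case_prod by blast

lemma variation_loop_open:
  assumes "loop_open U" "smooth_family V \<gamma>" "0 \<in> V" "\<And>\<epsilon>. \<epsilon> \<in> V \<Longrightarrow> \<gamma> \<epsilon> \<in> loops_in o31" "\<gamma> 0 \<in> U"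
  shows "variation U \<gamma>"
proof -
  obtain d where "d > 0" "{-d<..<d} \<subseteq> V" "\<And>\<epsilon>. \<epsilon> \<in> {-d<..<d} \<Longrightarrow> \<gamma> \<epsilon> \<in> U"
    using loop_open_family[OF assms(1,2,4,3,5)] by blast
  then show ?thesis
    by (intro variationI[of "{-d<..<d}"] smooth_family_subset[OF assms(2)]) auto
qed

lemma has_variational_derivativeD:
  assumes "has_variational_derivative S h L Q"
  shows "Q \<in> loops_in o31"
    "variation S \<gamma> \<Longrightarrow> \<gamma> 0 = L \<Longrightarrow>
      ((\<lambda>\<epsilon>. h (\<gamma> \<epsilon>)) has_real_derivative circle_integral (\<lambda>x. trace (Q x ** dx (\<lambda>\<epsilon>. \<gamma> \<epsilon> x) 0))) (at 0)"
  using assms unfolding has_variational_derivative_def circle_integral_def dx_def by auto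

lemma has_variational_derivativeI:
  assumes "Q \<in> loops_in o31"
    "\<And>\<gamma>. variation S \<gamma> \<Longrightarrow> \<gamma> 0 = L \<Longrightarrow>
      ((\<lambda>\<epsilon>. h (\<gamma> \<epsilon>)) has_real_derivative circle_integral (\<lambda>x. trace (Q x ** dx (\<lambda>\<epsilon>. \<gamma> \<epsilon> x) 0))) (at 0)"
  shows "has_variational_derivative S h L Q"
  using assms unfolding has_variational_derivative_def circle_integral_def dx_def by auto

lemma variation_mono: "S \<subseteq> T \<Longrightarrow> variation S \<gamma> \<Longrightarrow> variation T \<gamma>"
  unfolding variation_def by blast

lemma has_variational_derivative_mono:
  assumes "has_variational_derivative T h L Q" "S \<subseteq> T"
  shows "has_variational_derivative S h L Q"
  using assms variation_mono unfolding has_variational_derivative_def by blast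

lemma has_real_derivative_eventually_cong:
  assumes "d > 0" "\<And>\<epsilon>. \<epsilon> \<in> {-d<..<d} \<Longrightarrow> f \<epsilon> = g \<epsilon>" "(f has_real_derivative D) (at 0)"
  shows "(g has_real_derivative D) (at 0)"
  using assms by (intro has_field_derivative_transform_within_open[OF assms(3), of "{-d<..<d}"]) auto

lemma has_variational_derivative_cong:
  assumes "has_variational_derivative S h L Q" "\<And>L. L \<in> S \<Longrightarrow> h L = k L"
  shows "has_variational_derivative S k L Q"
proof (rule has_variational_derivativeI[OF has_variational_derivativeD(1)[OF assms(1)]])
  fix \<gamma> assume v: "variation S \<gamma>" "\<gamma> 0 = L"
  from variationE[OF v(1)] obtain d where "d > 0" "\<And>\<epsilon>. \<epsilon> \<in> {-d<..<d} \<Longrightarrow> \<gamma> \<epsilon> \<in> S" by blast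
  then show "((\<lambda>\<epsilon>. k (\<gamma> \<epsilon>)) has_real_derivative circle_integral (\<lambda>x. trace (Q x ** dx (\<lambda>\<epsilon>. \<gamma> \<epsilon> x) 0))) (at 0)"
    by (intro has_real_derivative_eventually_cong[OF \<open>d > 0\<close> _ has_variational_derivativeD(2)[OF assms(1) v]] assms(2))
qed

lemma affine_family:
  assumes "L \<in> loops_in o31" "T \<in> loops_in o31"
  shows "smooth_family UNIV (\<lambda>\<epsilon> x. L x + \<epsilon> *\<^sub>R T x)" "(\<lambda>x. L x + \<epsilon> *\<^sub>R T x) \<in> loops_in o31"
    "dx (\<lambda>\<epsilon>. L x + \<epsilon> *\<^sub>R T x) 0 = T x"
proof -
  show "smooth_family UNIV (\<lambda>\<epsilon> x. L x + \<epsilon> *\<^sub>R T x)"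
    by (intro smooth_family_add smooth_family_bilinear[OF bounded_bilinear_scaleR]
        smooth_family_loop smooth_family_param smooth_on_ident open_UNIV loops_inD(1)[OF assms(1)] loops_inD(1)[OF assms(2)])
  show "(\<lambda>x. L x + \<epsilon> *\<^sub>R T x) \<in> loops_in o31"
    by (rule loops_in_UNIV_range) (auto intro!: loop_intros o31_add o31_scaleR intro: loops_in_UNIV loops_inD(3) assms)
  have "((\<lambda>\<epsilon>. L x + \<epsilon> *\<^sub>R T x) has_vector_derivative T x) (at 0)"
    by (auto intro!: derivative_eq_intros)
  then show "dx (\<lambda>\<epsilon>. L x + \<epsilon> *\<^sub>R T x) 0 = T x" by (rule dx_eqI)
qed

text \<open>The difference \<open>D\<close> of two gradients is tested against \<open>D\<^sup>T\<close>, which again lies in the Lie algebra and for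
  which the trace form is the sum of the squares of the entries of \<open>D\<close>.\<close>

lemma variational_derivative_unique:
  assumes U: "loop_open U" "L \<in> U" and Q: "has_variational_derivative U h L Q" "has_variational_derivative U h L R"
  shows "Q = R"
proof
  fix x
  note Qo = has_variational_derivativeD(1)[OF Q(1)] and Ro = has_variational_derivativeD(1)[OF Q(2)]
  have L: "L \<in> loops_in o31" using U unfolding loop_open_def by auto
  define T where "T = (\<lambda>x. transpose (Q x - R x))"
  have QR: "(\<lambda>x. Q x - R x) \<in> loops_in UNIV" by (intro loop_intros loops_in_UNIV[OF Qo] loops_in_UNIV[OF Ro])
  have TU: "T \<in> loops_in UNIV"
    unfolding T_def by (intro loop_bounded_linear[OF bounded_linear_transpose] QR)
  have T: "T \<in> loops_in o31"
    by (rule loops_in_UNIV_range[OF TU])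
      (auto simp: T_def intro!: o31_transpose o31_diff loops_inD(3)[OF Qo] loops_inD(3)[OF Ro])
  let ?g = "\<lambda>\<epsilon> x. L x + \<epsilon> *\<^sub>R T x"
  have "variation U ?g"
    by (rule variation_loop_open[OF U(1) affine_family(1)[OF L T]]) (use affine_family[OF L T] U in auto)
  from has_variational_derivativeD(2)[OF Q(1) this] has_variational_derivativeD(2)[OF Q(2) this]
  have "circle_integral (\<lambda>x. trace (Q x ** T x)) = circle_integral (\<lambda>x. trace (R x ** T x))"
    unfolding affine_family(3)[OF L T] by (auto intro: DERIV_unique)
  then have "circle_integral (\<lambda>x. trace (Q x ** T x) - trace (R x ** T x)) = 0"
    by (subst circle_integral_diff)
      (auto intro!: loop_trace loop_matrix_mult loops_in_UNIV[OF Qo] loops_in_UNIV[OF Ro] loops_in_UNIV[OF T])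
  then have "circle_integral (\<lambda>x. trace ((Q x - R x) ** transpose (Q x - R x))) = 0"
    by (simp add: T_def matrix_minus_mult trace_sub)
  moreover have "(\<lambda>x. trace ((Q x - R x) ** transpose (Q x - R x))) \<in> loops_in UNIV"
    using loop_trace[OF loop_matrix_mult[OF QR TU]] unfolding T_def .
  ultimately have "trace ((Q x - R x) ** transpose (Q x - R x)) = 0"
    using circle_integral_nonneg_eq_0[of "\<lambda>x. trace ((Q x - R x) ** transpose (Q x - R x))" x] trace_transpose_pos(1) by blast
  then show "Q x = R x" by (simp add: trace_transpose_pos)
qed

lemma var_deriv_eq:
  assumes "loop_open U" "L \<in> U" "has_variational_derivative U h L Q"
  shows "var_deriv U h L = Q"
  unfolding var_deriv_def using assms variational_derivative_unique by blast

lemma functional_var_deriv: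
  assumes "loop_open U" "L \<in> U" "h \<in> functionals U"
  shows "has_variational_derivative U h L (var_deriv U h L)"
  using assms var_deriv_eq unfolding functionals_def by fastforce

section \<open>Reduction by an isotropy group\<close>

definition annihilator :: "mat4 set \<Rightarrow> mat4 set" where
  "annihilator \<hh> = {R \<in> o31. \<forall>X\<in>\<hh>. trace (R ** X) = 0}"

text \<open>The bracket of the loop algebra as a function of the gradients.\<close>

definition pairing :: "loop \<Rightarrow> loop \<Rightarrow> loop \<Rightarrow> real" where
  "pairing K Q R = circle_integral (\<lambda>x. trace (R x ** cov K Q x))"

text \<open>What is known at a point of the space of invariants about the gradient of an extension that is constant on
  the gauge leaves: how it pairs with variations inside that space, and, integrated by parts, the
  infinitesimal form of constancy on the leaves.\<close>

definition adapted_gradient :: "loop set \<Rightarrow> mat4 set \<Rightarrow> functional \<Rightarrow> loop \<Rightarrow> loop \<Rightarrow> bool" where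
  "adapted_gradient KK \<hh> h K Q \<longleftrightarrow>
     has_variational_derivative KK h K Q \<and> (\<forall>x. cov K Q x \<in> annihilator \<hh>)"

lemma pairing_antisym:
  assumes "K \<in> loops_in o31" "Q \<in> loops_in o31" "R \<in> loops_in o31"
  shows "pairing K R Q = - pairing K Q R"
  unfolding pairing_def cov_skew_adjoint[OF assms]
  by (simp add: trace_mul_sym[of "cov K Q _"])

lemma bracket_1_pairing: "bracket_1 U \<H> \<F> L = pairing L (var_deriv U \<H> L) (var_deriv U \<F> L)"
  by (simp add: bracket_1_def pairing_def cov_def circle_integral_def Let_def)

lemma loop_variation:
  assumes "smooth_family V F" "\<And>\<epsilon>. \<epsilon> \<in> V \<Longrightarrow> F \<epsilon> \<in> loops_in UNIV" "\<epsilon> \<in> V"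
  shows "(\<lambda>x. dx (\<lambda>e. F e x) \<epsilon>) \<in> loops_in UNIV"
proof (rule loops_inI)
  show "smooth_on UNIV (\<lambda>x. dx (\<lambda>e. F e x) \<epsilon>)"
    using smooth_family_curve[OF smooth_family_variation[OF assms(1)] assms(3)] .
  show "dx (\<lambda>e. F e (x + 2 * pi)) \<epsilon> = dx (\<lambda>e. F e x) \<epsilon>" for x
    by (rule dx_cong[OF smooth_family_open[OF assms(1)] assms(3)]) (use assms(2) loops_inD(2) in blast)
qed simp

lemma trace_scaleR: "trace (c *\<^sub>R X) = c * trace (X :: mat4)"
  by (simp add: trace_4 algebra_simps)

lemma matrix_inv_one: "matrix_inv (mat 1 :: mat4) = mat 1"
  by (rule matrix_inv_unique) simp

lemma gauge_one: "gauge (\<lambda>_. mat 1) L = L"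
proof -
  have "dx (\<lambda>_. mat 1 :: mat4) x = 0" for x by (rule dx_eqI) (rule has_vector_derivative_const)
  then show ?thesis by (simp add: gauge_def matrix_inv_one)
qed

text \<open>This carries covariant derivatives at the normal form of a loop back to the loop itself.\<close>

lemma cov_gauge:
  assumes g: "g \<in> loops_in O31" and Q: "Q \<in> loops_in o31"
  shows "cov L (\<lambda>x. g x ** Q x ** matrix_inv (g x)) x = g x ** cov (gauge g L) Q x ** matrix_inv (g x)"
proof -
  have O: "\<And>x. g x \<in> O31" by (rule loops_inD(3)[OF g])
  let ?A = "matrix_inv (g x)" and ?K = "gauge g L x"
  have dg: "dx g x = g x ** ?K - L x ** g x"
    unfolding gauge_def by (simp add: mat_algebra O31_cancel[OF O])
  have "dx (\<lambda>x. g x ** Q x ** matrix_inv (g x)) x =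
     g x ** Q x ** - (?A ** dx g x ** ?A) + (g x ** dx Q x + dx g x ** Q x) ** ?A"
    by (rule dx_eqI)
      (intro matrix_has_vector_derivative O31_matrix_inv_derivative[OF open_UNIV UNIV_I O]
        loop_has_dx[OF g] loop_has_dx[OF Q])
  then show ?thesis
    unfolding cov_def by (simp add: dg mat_algebra O31_cancel[OF O] matrix_inv_O31(3)[OF O])
qed

definition gauge_path :: "mat4 set \<Rightarrow> mat4 \<Rightarrow> (real \<Rightarrow> real) \<Rightarrow> (real \<Rightarrow> loop) \<Rightarrow> bool" where
  "gauge_path H X \<phi> g \<longleftrightarrow> smooth_family UNIV g \<and> (\<forall>\<epsilon>. g \<epsilon> \<in> loops_in H) \<and> g 0 = (\<lambda>_. mat 1) \<and>
     (\<forall>x. dx (\<lambda>\<epsilon>. g \<epsilon> x) 0 = \<phi> x *\<^sub>R X)"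

text \<open>A group \<open>H\<close> with Lie algebra \<open>\<hh>\<close> acts by gauge transformations on the loops in \<open>U\<close>; the normalizer \<open>G\<close> brings
  every loop in \<open>U\<close> to its normal form in \<open>KK\<close> and depends smoothly on the loop. Paths of gauge transformations
  are only required in the directions of a spanning set \<open>B\<close> of \<open>\<hh>\<close>, where they can be written down
  explicitly. The last two assumptions concern the algebra of gradients, which depends on the group: adapted
  gradients exist, and the bracket does not depend on the choice among them.\<close>

locale isotropy_reduction =
  fixes H \<hh> B :: "mat4 set" and KK U :: "loop set" and G :: "loop \<Rightarrow> loop"
  assumes H_O31: "H \<subseteq> O31" and \<hh>_o31: "\<hh> \<subseteq> o31"
    and H_tangent: "\<And>S t g g'. open S \<Longrightarrow> t \<in> S \<Longrightarrow> (\<And>s. s \<in> S \<Longrightarrow> g s \<in> H) \<Longrightarrow>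
        (g has_vector_derivative g') (at (t::real)) \<Longrightarrow> matrix_inv (g t) ** g' \<in> \<hh>"
    and H_Ad: "\<And>g X. g \<in> H \<Longrightarrow> X \<in> \<hh> \<Longrightarrow> matrix_inv g ** X ** g \<in> \<hh>"
    and H_path: "\<And>X \<phi>. X \<in> B \<Longrightarrow> \<phi> \<in> loops_in UNIV \<Longrightarrow> \<exists>g. gauge_path H X \<phi> g"
    and B_o31: "B \<subseteq> o31"
    and \<hh>_span: "\<hh> \<subseteq> span B"
    and U: "loop_open U" "KK \<subseteq> U"
    and G_loop: "\<And>L. L \<in> U \<Longrightarrow> G L \<in> loops_in H"
    and G_slice: "\<And>L. L \<in> U \<Longrightarrow> gauge (G L) L \<in> KK"
    and G_fixed: "\<And>K. K \<in> KK \<Longrightarrow> gauge (G K) K = K"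
    and G_smooth: "\<And>V \<gamma>. smooth_family V \<gamma> \<Longrightarrow> (\<And>\<epsilon>. \<epsilon> \<in> V \<Longrightarrow> \<gamma> \<epsilon> \<in> U) \<Longrightarrow> smooth_family V (\<lambda>\<epsilon>. G (\<gamma> \<epsilon>))"
    and adapted_exists: "\<And>h K. h \<in> functionals KK \<Longrightarrow> K \<in> KK \<Longrightarrow> \<exists>Q. adapted_gradient KK \<hh> h K Q"
    and pairing_unique: "\<And>h f K P Q R. K \<in> KK \<Longrightarrow> adapted_gradient KK \<hh> h K P \<Longrightarrow>
        adapted_gradient KK \<hh> h K Q \<Longrightarrow> adapted_gradient KK \<hh> f K R \<Longrightarrow> pairing K P R = pairing K Q R"
begin

lemma loops_H_O31: "g \<in> loops_in H \<Longrightarrow> g \<in> loops_in O31"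
  using loops_in_mono[OF H_O31] by auto

lemma U_loops: "L \<in> U \<Longrightarrow> L \<in> loops_in o31"
  using U unfolding loop_open_def by auto

definition extension :: "functional \<Rightarrow> functional" where
  "extension f = (\<lambda>L. f (gauge (G L) L))"

lemma annihilator_conj:
  assumes "g \<in> H" "R \<in> annihilator \<hh>"
  shows "g ** R ** matrix_inv g \<in> annihilator \<hh>"
proof -
  have g: "g \<in> O31" using assms H_O31 by auto
  have "g ** R ** matrix_inv g \<in> o31"
    using o31_conj[OF O31_matrix_inv[OF g], of R] assms(2) matrix_inv_inv_O31[OF g]
    by (simp add: annihilator_def)
  moreover have "trace (g ** R ** matrix_inv g ** X) = 0" if "X \<in> \<hh>" for X
  proof -
    have "trace (g ** (R ** matrix_inv g ** X)) = trace ((R ** matrix_inv g ** X) ** g)"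
      by (rule trace_mul_sym)
    also have "\<dots> = trace (R ** (matrix_inv g ** X ** g))" by (simp add: matrix_mul_assoc)
    also have "\<dots> = 0" using assms(2) H_Ad[OF assms(1) that] by (simp add: annihilator_def)
    finally show ?thesis by (simp add: matrix_mul_assoc)
  qed
  ultimately show ?thesis by (simp add: annihilator_def)
qed

text \<open>By skew-adjointness, pairing with the infinitesimal gauge action of \<open>\<eta>\<close> amounts to pairing \<open>\<eta>\<close> with the
  covariant derivative, which annihilates it.\<close>

lemma trace_annihilated:
  assumes K: "K \<in> loops_in o31" and Q: "Q \<in> loops_in o31" "\<And>x. cov K Q x \<in> annihilator \<hh>"
    and \<eta>: "\<eta> \<in> loops_in UNIV" "\<And>x. \<eta> x \<in> \<hh>"
  shows "circle_integral (\<lambda>x. trace (Q x ** cov K \<eta> x)) = 0"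
proof -
  have "\<eta> \<in> loops_in o31" using \<eta> \<hh>_o31 by (auto intro: loops_in_UNIV_range)
  from cov_skew_adjoint[OF K Q(1) this]
  have "circle_integral (\<lambda>x. trace (Q x ** cov K \<eta> x)) = - circle_integral (\<lambda>x. trace (cov K Q x ** \<eta> x))" .
  also have "(\<lambda>x. trace (cov K Q x ** \<eta> x)) = (\<lambda>x. 0)"
    using Q(2) \<eta>(2) by (auto simp: annihilator_def)
  finally show ?thesis by (simp add: circle_integral_def)
qed

text \<open>By the chain rule the derivative of \<open>f\<close> of the normal form pairs an adapted gradient \<open>Q\<close> at the normal form
  with the variation of the normal form. The part of this variation that comes from the varying normalizer
  is an infinitesimal gauge transformation, which \<open>Q\<close> does not see; hence the gradient of the extension is
  the conjugate of \<open>Q\<close> by the normalizer.\<close>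

lemma extension_gradient:
  assumes f: "f \<in> functionals KK" and L: "L \<in> U"
  obtains Q where "has_variational_derivative U (extension f) L Q" "\<And>x. cov L Q x \<in> annihilator \<hh>"
proof -
  define g K where "g = G L" and "K = gauge g L"
  have Lo: "L \<in> loops_in o31" using U_loops[OF L] .
  have gH: "g \<in> loops_in H" using G_loop[OF L] by (simp add: g_def)
  then have gO: "g \<in> loops_in O31" by (rule loops_H_O31)
  have K: "K \<in> KK" using G_slice[OF L] by (simp add: K_def g_def)
  have Ko: "K \<in> loops_in o31" unfolding K_def by (rule gauge_loop[OF gO Lo])
  from adapted_exists[OF f K] obtain Q where Q: "has_variational_derivative KK f K Q"
    "\<And>x. cov K Q x \<in> annihilator \<hh>" unfolding adapted_gradient_def by blast
  note Qo = has_variational_derivativeD(1)[OF Q(1)]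
  define R where "R = (\<lambda>x. g x ** Q x ** matrix_inv (g x))"
  have RU: "R \<in> loops_in UNIV"
    unfolding R_def by (intro loop_intros loops_in_UNIV[OF gO] loops_in_UNIV[OF Qo] loops_in_UNIV[OF loop_matrix_inv[OF gO]])
  have Ro: "R \<in> loops_in o31"
  proof (rule loops_in_UNIV_range[OF RU])
    show "R x \<in> o31" for x
      using o31_conj[OF O31_matrix_inv[OF loops_inD(3)[OF gO]] loops_inD(3)[OF Qo], of x x]
      by (simp add: R_def matrix_inv_inv_O31[OF loops_inD(3)[OF gO]])
  qed
  have "cov L R x \<in> annihilator \<hh>" for x
    unfolding R_def cov_gauge[OF gO Qo] K_def[symmetric]
    by (intro annihilator_conj loops_inD(3)[OF gH] Q(2))
  moreover have "has_variational_derivative U (extension f) L R"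
  proof (rule has_variational_derivativeI[OF Ro])
    fix \<gamma> assume v: "variation U \<gamma>" and \<gamma>0: "\<gamma> 0 = L"
    from variationE[OF v] obtain d where d: "d > 0" and \<gamma>: "smooth_family {-d<..<d} \<gamma>"
      and \<gamma>U: "\<And>\<epsilon>. \<epsilon> \<in> {-d<..<d} \<Longrightarrow> \<gamma> \<epsilon> \<in> U" by blast
    let ?V = "{-d<..<d}" and ?g = "\<lambda>\<epsilon>. G (\<gamma> \<epsilon>)"
    have V0: "0 \<in> ?V" using d by auto
    have g: "smooth_family ?V ?g" by (rule G_smooth[OF \<gamma> \<gamma>U])
    have gHe: "?g \<epsilon> x \<in> H" if "\<epsilon> \<in> ?V" for \<epsilon> x using G_loop[OF \<gamma>U[OF that]] loops_inD(3) by blast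
    then have gOe: "?g \<epsilon> x \<in> O31" if "\<epsilon> \<in> ?V" for \<epsilon> x using that H_O31 by blast
    let ?P = "\<lambda>\<epsilon>. gauge (?g \<epsilon>) (\<gamma> \<epsilon>)"
    define \<eta> where "\<eta> = (\<lambda>y. matrix_inv (?g 0 y) ** dx (\<lambda>e. ?g e y) 0)"
    define T where "T = (\<lambda>x. dx (\<lambda>\<epsilon>. \<gamma> \<epsilon> x) 0)"
    have TU: "T \<in> loops_in UNIV"
      unfolding T_def by (rule loop_variation[OF \<gamma> _ V0]) (use U_loops \<gamma>U loops_in_UNIV in blast)
    have \<eta>U: "\<eta> \<in> loops_in UNIV"
      unfolding \<eta>_def
      by (intro loop_matrix_mult loop_variation[OF g _ V0] loops_in_UNIV[OF loop_matrix_inv[of "G (\<gamma> 0)"]])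
        (use G_loop \<gamma>U V0 loops_H_O31 loops_in_UNIV in blast)+
    have \<eta>\<hh>: "\<eta> x \<in> \<hh>" for x
      unfolding \<eta>_def
      by (rule H_tangent[of ?V 0 "\<lambda>e. ?g e x", OF open_greaterThanLessThan V0 _ smooth_family_has_dx(2)[OF g V0]])
        (rule gHe)
    have "variation KK ?P"
      by (rule variationI[OF smooth_family_gauge[OF \<gamma> g gOe] V0]) (use G_slice \<gamma>U in auto)
    moreover have "?P 0 = K" by (simp add: \<gamma>0 K_def g_def)
    ultimately have D: "((\<lambda>\<epsilon>. f (?P \<epsilon>)) has_real_derivative circle_integral (\<lambda>x. trace (Q x ** dx (\<lambda>\<epsilon>. ?P \<epsilon> x) 0))) (at 0)"
      by (rule has_variational_derivativeD(2)[OF Q(1)])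
    have "trace (Q x ** dx (\<lambda>\<epsilon>. ?P \<epsilon> x) 0) = trace (R x ** T x) + trace (Q x ** cov K \<eta> x)" for x
    proof -
      have "dx (\<lambda>\<epsilon>. ?P \<epsilon> x) 0 = matrix_inv (g x) ** T x ** g x + cov K \<eta> x"
        using gauge_variation[OF \<gamma> g gOe V0] unfolding T_def \<eta>_def by (simp add: \<gamma>0 K_def g_def)
      moreover have "trace (Q x ** (matrix_inv (g x) ** T x ** g x)) = trace (R x ** T x)"
        unfolding R_def using trace_mul_sym[of "Q x ** matrix_inv (g x) ** T x" "g x"]
        by (simp add: matrix_mul_assoc)
      ultimately show ?thesis by (simp add: matrix_add_ldistrib trace_add)
    qed
    then have "circle_integral (\<lambda>x. trace (Q x ** dx (\<lambda>\<epsilon>. ?P \<epsilon> x) 0))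
        = circle_integral (\<lambda>x. trace (R x ** T x) + trace (Q x ** cov K \<eta> x))" by simp
    also have "\<dots> = circle_integral (\<lambda>x. trace (R x ** T x)) + circle_integral (\<lambda>x. trace (Q x ** cov K \<eta> x))"
    proof (rule circle_integral_add)
      have "\<eta> \<in> loops_in o31" using \<eta>U \<eta>\<hh> \<hh>_o31 by (auto intro: loops_in_UNIV_range)
      then show "(\<lambda>x. trace (Q x ** cov K \<eta> x)) \<in> loops_in UNIV"
        by (intro loop_trace loop_matrix_mult loops_in_UNIV[OF Qo] loops_in_UNIV[OF loop_cov[OF Ko]])
    qed (intro loop_trace loop_matrix_mult RU TU)
    also have "circle_integral (\<lambda>x. trace (Q x ** cov K \<eta> x)) = 0"
      by (rule trace_annihilated[OF Ko Qo Q(2) \<eta>U \<eta>\<hh>])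
    finally show "((\<lambda>\<epsilon>. extension f (\<gamma> \<epsilon>)) has_real_derivative
        circle_integral (\<lambda>x. trace (R x ** dx (\<lambda>\<epsilon>. \<gamma> \<epsilon> x) 0))) (at 0)"
      using D by (simp add: extension_def T_def)
  qed
  ultimately show thesis by (rule that[rotated])
qed

text \<open>Instead of comparing normal forms of gauge equivalent loops, the extension is differentiated along the
  path of gauge transformations: its gradient does not see that direction.\<close>

lemma extension_constant_on_leaves:
  assumes f: "f \<in> functionals KK"
  shows "constant_on_leaves H U (extension f)"
  unfolding constant_on_leaves_def
proof (intro ballI allI impI)
  fix L and g :: "real \<Rightarrow> loop"
  assume L: "L \<in> U" and "smooth_on UNIV (\<lambda>(\<epsilon>, x). g \<epsilon> x) \<and> (\<forall>\<epsilon>. g \<epsilon> \<in> loops_in H) \<and>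
    g 0 = (\<lambda>_. mat 1) \<and> (\<forall>\<epsilon>\<in>{0..1}. gauge (g \<epsilon>) L \<in> U)"
  then have g: "smooth_family UNIV g" and gH: "\<And>\<epsilon>. g \<epsilon> \<in> loops_in H" and g0: "g 0 = (\<lambda>_. mat 1)"
    and gU: "\<And>\<epsilon>. \<epsilon> \<in> {0..1} \<Longrightarrow> gauge (g \<epsilon>) L \<in> U"
    by (auto simp: smooth_family_case_prod)
  have Lo: "L \<in> loops_in o31" by (rule U_loops[OF L])
  define \<phi> where "\<phi> \<epsilon> = extension f (gauge (g \<epsilon>) L)" for \<epsilon>
  have D: "(\<phi> has_real_derivative 0) (at c)" if c: "c \<in> {0..1}" for c
  proof -
    define p where "p = (\<lambda>\<epsilon>. g (c + 1 * \<epsilon>))"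
    have p: "smooth_family UNIV p" unfolding p_def by (rule smooth_family_reparam[OF g]) auto
    have pH: "p \<epsilon> x \<in> H" and pO: "p \<epsilon> x \<in> O31" for \<epsilon> x
      using loops_inD(3)[OF gH] H_O31 by (auto simp: p_def)
    have sL: "smooth_family UNIV (\<lambda>\<epsilon>. L)" by (intro smooth_family_loop loops_inD(1)[OF Lo] open_UNIV)
    let ?\<gamma> = "\<lambda>\<epsilon>. gauge (p \<epsilon>) L"
    have \<gamma>0: "?\<gamma> 0 \<in> U" using gU[OF c] by (simp add: p_def)
    have "variation U ?\<gamma>"
      by (rule variation_loop_open[OF U(1) smooth_family_gauge[OF sL p pO]])
        (use \<gamma>0 gauge_loop[OF loops_H_O31[OF gH] Lo] in \<open>auto simp: p_def\<close>)
    moreover obtain Q where Q: "has_variational_derivative U (extension f) (?\<gamma> 0) Q"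
      "\<And>x. cov (?\<gamma> 0) Q x \<in> annihilator \<hh>"
      using extension_gradient[OF f \<gamma>0] by blast
    ultimately have d: "((\<lambda>\<epsilon>. extension f (?\<gamma> \<epsilon>)) has_real_derivative
        circle_integral (\<lambda>x. trace (Q x ** dx (\<lambda>\<epsilon>. ?\<gamma> \<epsilon> x) 0))) (at 0)"
      using has_variational_derivativeD(2) by blast
    define \<eta> where "\<eta> = (\<lambda>y. matrix_inv (p 0 y) ** dx (\<lambda>e. p e y) 0)"
    have p0: "p 0 \<in> loops_in O31" using loops_H_O31[OF gH] by (simp add: p_def)
    have pl: "p \<epsilon> \<in> loops_in UNIV" for \<epsilon> using loops_in_UNIV[OF gH] by (simp add: p_def)
    have "\<eta> \<in> loops_in UNIV"
      unfolding \<eta>_def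
      by (intro loop_matrix_mult loop_variation[OF p pl UNIV_I] loops_in_UNIV[OF loop_matrix_inv[OF p0]])
    moreover have "\<eta> x \<in> \<hh>" for x
      unfolding \<eta>_def
      by (rule H_tangent[of UNIV 0 "\<lambda>e. p e x", OF open_UNIV UNIV_I pH smooth_family_has_dx(2)[OF p UNIV_I]])
    ultimately have "circle_integral (\<lambda>x. trace (Q x ** cov (?\<gamma> 0) \<eta> x)) = 0"
      by (rule trace_annihilated[OF U_loops[OF \<gamma>0] has_variational_derivativeD(1)[OF Q(1)] Q(2)])
    moreover have "dx (\<lambda>\<epsilon>. ?\<gamma> \<epsilon> x) 0 = cov (?\<gamma> 0) \<eta> x" for x
    proof -
      have "dx (\<lambda>e::real. L x) 0 = 0" by (rule dx_eqI) (rule has_vector_derivative_const)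
      then show ?thesis
        using gauge_variation[OF sL p pO UNIV_I[of 0], where x = x] by (simp add: \<eta>_def)
    qed
    ultimately have "((\<lambda>\<epsilon>. \<phi> (c + \<epsilon>)) has_real_derivative 0) (at 0)"
      using d by (simp add: \<phi>_def p_def)
    then show ?thesis using DERIV_shift[of \<phi> 0 0 c] by (simp add: add.commute)
  qed
  have "\<phi> 1 = \<phi> 0"
  proof (rule DERIV_isconst_end[of 0 1 \<phi>])
    show "continuous_on {0..1} \<phi>"
      by (intro continuous_at_imp_continuous_on ballI DERIV_isCont[OF D]) auto
    show "DERIV \<phi> x :> 0" if "0 < x" "x < 1" for x using D that by auto
  qed simp
  then show "extension f (gauge (g 1) L) = extension f L"
    by (simp add: \<phi>_def g0 gauge_one)
qed

lemma gauge_extension_exists: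
  assumes "f \<in> functionals KK"
  shows "gauge_extension KK H U f (extension f)"
proof -
  have "extension f \<in> functionals U"
    unfolding functionals_def using extension_gradient[OF assms] by blast
  moreover have "extension f K = f K" if "K \<in> KK" for K
    using G_fixed[OF that] by (simp add: extension_def)
  ultimately show ?thesis
    unfolding gauge_extension_def using extension_constant_on_leaves[OF assms] by blast
qed

text \<open>Let \<open>Q\<close> be the gradient of an extension that is constant on the leaves. If \<open>X\<close> is one of the spanning
  directions, let \<open>\<phi>\<close> be the trace of \<open>X\<close> against the covariant derivative of \<open>Q\<close>, and vary \<open>K\<close> by a path of gauge
  transformations with initial velocity \<open>\<phi> X\<close>: the derivative is minus the integral of \<open>\<phi>\<^sup>2\<close>, and it
  vanishes.\<close>

lemma gauge_extension_adapted:
  assumes W: "loop_open W" "KK \<subseteq> W" and F: "gauge_extension KK H W f F" and K: "K \<in> KK"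
  shows "adapted_gradient KK \<hh> f K (var_deriv W F K)"
proof -
  define Q where "Q = var_deriv W F K"
  have KW: "K \<in> W" using W K by auto
  have Ko: "K \<in> loops_in o31" using W KW unfolding loop_open_def by auto
  have Q: "has_variational_derivative W F K Q"
    unfolding Q_def using functional_var_deriv[OF W(1) KW] F unfolding gauge_extension_def by blast
  note Qo = has_variational_derivativeD(1)[OF Q]
  have leaves: "constant_on_leaves H W F" using F unfolding gauge_extension_def by blast
  have "has_variational_derivative KK f K Q"
    using has_variational_derivative_cong[OF has_variational_derivative_mono[OF Q W(2)]] F
    unfolding gauge_extension_def by blast
  moreover have zero: "trace (cov K Q x ** X) = 0" if X: "X \<in> B" for X x
  proof -
    define \<phi> where "\<phi> = (\<lambda>x. trace (cov K Q x ** X))"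
    have covU: "cov K Q \<in> loops_in UNIV" by (rule loops_in_UNIV[OF loop_cov[OF Ko Qo]])
    have \<phi>: "\<phi> \<in> loops_in UNIV" unfolding \<phi>_def
      by (intro loop_trace loop_matrix_mult covU loop_const) auto
    obtain g where g: "smooth_family UNIV g" "\<And>\<epsilon>. g \<epsilon> \<in> loops_in H" "g 0 = (\<lambda>_. mat 1)"
      "\<And>x. dx (\<lambda>\<epsilon>. g \<epsilon> x) 0 = \<phi> x *\<^sub>R X"
      using H_path[OF X \<phi>] unfolding gauge_path_def by blast
    have gO: "g \<epsilon> x \<in> O31" for \<epsilon> x using loops_inD(3)[OF g(2)] H_O31 by auto
    have sK: "smooth_family UNIV (\<lambda>\<epsilon>. K)" by (intro smooth_family_loop loops_inD(1)[OF Ko] open_UNIV)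
    let ?\<gamma> = "\<lambda>\<epsilon>. gauge (g \<epsilon>) K"
    have s\<gamma>: "smooth_family UNIV ?\<gamma>" by (rule smooth_family_gauge[OF sK g(1) gO])
    have \<gamma>o: "?\<gamma> \<epsilon> \<in> loops_in o31" for \<epsilon> by (rule gauge_loop[OF loops_H_O31[OF g(2)] Ko])
    have \<gamma>0: "?\<gamma> 0 = K" by (simp add: g(3) gauge_one)
    obtain d where d: "d > 0" "\<And>\<epsilon>. \<epsilon> \<in> {-d<..<d} \<Longrightarrow> ?\<gamma> \<epsilon> \<in> W"
      using loop_open_family[OF W(1) s\<gamma> \<gamma>o UNIV_I] \<gamma>0 KW by auto
    \<comment> \<open>The path is traversed with speed \<open>s\<close>, so that it stays in \<open>W\<close> up to time \<open>1\<close>.\<close>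
    have const: "F (?\<gamma> s) = F K" if s: "s \<in> {-d<..<d}" for s
    proof -
      have "smooth_family UNIV (\<lambda>\<epsilon>. g (0 + s * \<epsilon>))" by (rule smooth_family_reparam[OF g(1)]) auto
      then have "smooth_on UNIV (\<lambda>(\<epsilon>, x). g (s * \<epsilon>) x)"
        by (simp add: smooth_family_case_prod)
      moreover have "gauge (g (s * \<epsilon>)) K \<in> W" if e: "\<epsilon> \<in> {0..1}" for \<epsilon>
      proof (rule d(2))
        have "\<bar>s * \<epsilon>\<bar> \<le> \<bar>s\<bar>" using e by (simp add: abs_mult mult_left_le)
        then show "s * \<epsilon> \<in> {-d<..<d}" using s by auto
      qed
      ultimately show ?thesis
        using leaves[unfolded constant_on_leaves_def, rule_format, OF KW, of "\<lambda>\<epsilon>. g (s * \<epsilon>)"] g(2,3) by simp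
    qed
    have v: "variation W ?\<gamma>"
      by (rule variation_loop_open[OF W(1) s\<gamma>]) (use \<gamma>o \<gamma>0 KW in auto)
    have "((\<lambda>\<epsilon>. F K) has_real_derivative 0) (at 0)" by simp
    then have "((\<lambda>\<epsilon>. F (?\<gamma> \<epsilon>)) has_real_derivative 0) (at 0)"
      by (rule has_real_derivative_eventually_cong[OF d(1), rotated]) (use const in simp)
    then have I0: "circle_integral (\<lambda>x. trace (Q x ** dx (\<lambda>\<epsilon>. ?\<gamma> \<epsilon> x) 0)) = 0"
      using has_variational_derivativeD(2)[OF Q v \<gamma>0] DERIV_unique by blast
    define \<eta> where "\<eta> = (\<lambda>x. \<phi> x *\<^sub>R X)"
    have \<eta>: "\<eta> \<in> loops_in o31"
      by (rule loops_in_UNIV_range) (use B_o31 X in \<open>auto simp: \<eta>_def intro!: loop_intros \<phi> o31_scaleR\<close>)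
    have "dx (\<lambda>\<epsilon>. ?\<gamma> \<epsilon> x) 0 = cov K \<eta> x" for x
    proof -
      have "dx (\<lambda>e::real. K x) 0 = 0" by (rule dx_eqI) (rule has_vector_derivative_const)
      then show ?thesis
        using gauge_variation[OF sK g(1) gO UNIV_I[of 0], where x = x]
        unfolding \<gamma>0 by (simp add: g(3,4) matrix_inv_one \<eta>_def)
    qed
    with I0 have "circle_integral (\<lambda>x. trace (cov K Q x ** \<eta> x)) = 0"
      using cov_skew_adjoint[OF Ko Qo \<eta>] by simp
    moreover have "trace (cov K Q x ** \<eta> x) = \<phi> x * \<phi> x" for x
      unfolding \<eta>_def matrix_scaleR_mult trace_scaleR by (simp add: \<phi>_def)
    ultimately have "circle_integral (\<lambda>x. \<phi> x * \<phi> x) = 0" by simp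
    then have "\<phi> x * \<phi> x = 0"
      by (intro circle_integral_nonneg_eq_0[OF loop_mult[OF \<phi> \<phi>]]) auto
    then show ?thesis by (simp add: \<phi>_def)
  qed
  moreover have "cov K Q x \<in> annihilator \<hh>" for x
  proof -
    have "trace (cov K Q x ** X) = 0" if "X \<in> span B" for X
      using that
    proof (induction rule: span_induct_alt)
      case base
      show ?case by (simp add: trace_def)
    next
      case (step c x' y)
      then show ?case
        using zero by (simp add: matrix_add_ldistrib trace_add matrix_scaleR_mult trace_scaleR)
    qed
    then show ?thesis
      using loops_inD(3)[OF loop_cov[OF Ko Qo]] \<hh>_span by (auto simp: annihilator_def)
  qed
  ultimately show ?thesis unfolding adapted_gradient_def Q_def by blast
qed

lemma adapted_o31: "adapted_gradient KK \<hh> f K Q \<Longrightarrow> Q \<in> loops_in o31"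
  unfolding adapted_gradient_def has_variational_derivative_def by blast

text \<open>The gradients of all extensions are adapted. Independence of the choice among adapted gradients is
  known in the first argument; skew-symmetry of the pairing transfers it to the second.\<close>

theorem geometric_bracket_eq:
  assumes h: "h \<in> functionals KK" and f: "f \<in> functionals KK" and K: "K \<in> KK"
    and Q: "adapted_gradient KK \<hh> h K Q" and R: "adapted_gradient KK \<hh> f K R"
  shows "geometric_bracket KK H h f K = pairing K Q R"
proof -
  have Ko: "K \<in> loops_in o31" using U U_loops K by auto
  have eq: "bracket_1 W \<H> \<F> K = pairing K Q R"
    if "loop_open W" "KK \<subseteq> W" "gauge_extension KK H W h \<H>" "gauge_extension KK H W f \<F>" for W \<H> \<F>
  proof -
    note a = gauge_extension_adapted[OF that(1,2,3) K] and b = gauge_extension_adapted[OF that(1,2,4) K]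
    have "pairing K (var_deriv W \<H> K) (var_deriv W \<F> K) = pairing K Q (var_deriv W \<F> K)"
      by (rule pairing_unique[OF K a Q b])
    also have "\<dots> = - pairing K (var_deriv W \<F> K) Q"
      by (rule pairing_antisym[OF Ko]) (use b Q adapted_o31 in auto)
    also have "pairing K (var_deriv W \<F> K) Q = pairing K R Q"
      by (rule pairing_unique[OF K b R Q])
    also have "- pairing K R Q = pairing K Q R"
      using pairing_antisym[OF Ko adapted_o31[OF R] adapted_o31[OF Q]] by simp
    finally show ?thesis unfolding bracket_1_pairing .
  qed
  show ?thesis
    unfolding geometric_bracket_def
  proof (rule the_equality)
    show "\<exists>W \<H> \<F>. loop_open W \<and> KK \<subseteq> W \<and> gauge_extension KK H W h \<H> \<and> gauge_extension KK H W f \<F> \<and>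
        pairing K Q R = bracket_1 W \<H> \<F> K"
      using eq[OF U] U gauge_extension_exists h f by metis
  qed (use eq in blast)
qed

end

section \<open>Coordinates on the spaces of invariants\<close>

lemma K_mat_o31_mat: "K_mat k0 k1 k2 = o31_mat 0 k0 0 k1 k2 0"
  by (simp add: K_mat_def o31_mat_def)

lemma K_L_loop: "K \<in> K_L \<Longrightarrow> K \<in> loops_in o31"
  unfolding K_L_def K_mat_o31_mat by (auto intro!: loop_o31_mat loop_const intro: loops_in_UNIV)

lemma K_LI:
  assumes "k0 \<in> loops_in {0<..}" "k1 \<in> loops_in UNIV" "k2 \<in> loops_in UNIV"
  shows "(\<lambda>x. K_mat (k0 x) (k1 x) (k2 x)) \<in> K_L"
  unfolding K_L_def
  by (rule CollectI, rule exI[of _ k0], rule exI[of _ k1], rule exI[of _ k2]) (simp add: assms)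

lemma K_L_iff:
  "K \<in> K_L \<longleftrightarrow> K \<in> loops_in o31 \<and> (\<forall>x. K x $ 1 $ 2 > 0 \<and> K x $ 1 $ 1 = 0 \<and> K x $ 1 $ 3 = 0 \<and> K x $ 2 $ 3 = 0)"
proof
  assume "K \<in> K_L"
  then show "K \<in> loops_in o31 \<and> (\<forall>x. K x $ 1 $ 2 > 0 \<and> K x $ 1 $ 1 = 0 \<and> K x $ 1 $ 3 = 0 \<and> K x $ 2 $ 3 = 0)"
    using K_L_loop loops_inD(3) by (fastforce simp: K_L_def K_mat_o31_mat)
next
  assume K: "K \<in> loops_in o31 \<and> (\<forall>x. K x $ 1 $ 2 > 0 \<and> K x $ 1 $ 1 = 0 \<and> K x $ 1 $ 3 = 0 \<and> K x $ 2 $ 3 = 0)"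
  have eq: "K = (\<lambda>x. K_mat (K x $ 1 $ 2) (K x $ 2 $ 1) (K x $ 3 $ 1))"
  proof
    fix x
    have "K x \<in> o31" using K loops_inD(3) by blast
    from o31_entries[OF this] show "K x = K_mat (K x $ 1 $ 2) (K x $ 2 $ 1) (K x $ 3 $ 1)"
      using K unfolding K_mat_o31_mat by metis
  qed
  have "(\<lambda>x. K x $ i $ j) \<in> loops_in UNIV" for i j using loop_entry K by blast
  moreover have "(\<lambda>x. K x $ 1 $ 2) \<in> loops_in {0<..}"
    by (rule loops_in_UNIV_range) (use K loop_entry in auto)
  ultimately show "K \<in> K_L" by (subst eq) (rule K_LI)
qed

lemma k0_level_iff: "K \<in> k0_level c \<longleftrightarrow> K \<in> K_L \<and> (\<forall>x. K x $ 1 $ 2 = c x)"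
  by (simp add: k0_level_def)

lemma K_M_eq: "K_M = K_L1"
proof -
  have "(\<lambda>x. K_mat 1 (a x) (b x)) \<in> K_L1" if "a \<in> loops_in UNIV" "b \<in> loops_in UNIV" for a b
  proof -
    have "(\<lambda>x. 1) \<in> loops_in {0::real<..}" by (rule loop_const) simp
    then have "(\<lambda>x. K_mat 1 (a x) (b x)) \<in> K_L" by (rule K_LI[OF _ that])
    then show ?thesis by (simp add: K_L1_def k0_level_iff K_mat_o31_mat)
  qed
  moreover have "K \<in> K_M" if K: "K \<in> K_L1" for K
  proof -
    from K obtain k0 k1 k2 where k: "K = (\<lambda>x. K_mat (k0 x) (k1 x) (k2 x))" "k1 \<in> loops_in UNIV" "k2 \<in> loops_in UNIV"
      and "\<forall>x. K x $ 1 $ 2 = 1"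
      unfolding K_L1_def k0_level_def K_L_def by blast
    then have "K = (\<lambda>x. K_mat 1 (k1 x) (k2 x))" by (simp add: K_mat_o31_mat)
    then show ?thesis unfolding K_M_def using k by blast
  qed
  ultimately show ?thesis unfolding K_M_def by blast
qed

lemma k0_level_variation:
  assumes v: "variation K_L \<gamma>"
  defines "T \<equiv> \<lambda>x. dx (\<lambda>\<epsilon>. \<gamma> \<epsilon> x) 0"
  shows "T x \<in> o31" "T x $ 1 $ 1 = 0" "T x $ 1 $ 3 = 0" "T x $ 2 $ 3 = 0"
    "variation (k0_level c) \<gamma> \<Longrightarrow> T x $ 1 $ 2 = 0"
proof -
  from variationE[OF v] obtain d where d: "d > 0" and \<gamma>: "smooth_family {-d<..<d} \<gamma>"
    and K: "\<And>\<epsilon>. \<epsilon> \<in> {-d<..<d} \<Longrightarrow> \<gamma> \<epsilon> \<in> K_L" by blast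
  have V0: "0 \<in> {-d<..<d}" using d by auto
  have D: "((\<lambda>\<epsilon>. \<gamma> \<epsilon> x) has_vector_derivative T x) (at 0)"
    unfolding T_def by (rule smooth_family_has_dx(2)[OF \<gamma> V0])
  show "T x \<in> o31"
    by (rule dx_in_o31[OF open_greaterThanLessThan V0 _ D]) (use K K_L_iff loops_inD(3) in blast)
  have *: "T x $ i $ j = 0" if "e > 0" "\<And>\<epsilon>. \<epsilon> \<in> {-e<..<e} \<Longrightarrow> \<gamma> \<epsilon> x $ i $ j = c" for e i j c
  proof -
    have "T x $ i $ j = dx (\<lambda>\<epsilon>. \<gamma> \<epsilon> x $ i $ j) 0"
      using dx_bounded_linear[OF bounded_linear_entry D] by simp
    also have "\<dots> = dx (\<lambda>\<epsilon>. c) 0" by (rule dx_cong[of "{-e<..<e}"]) (use that in auto)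
    also have "\<dots> = 0" by (rule dx_eqI) (rule has_vector_derivative_const)
    finally show ?thesis .
  qed
  show "T x $ 1 $ 1 = 0" "T x $ 1 $ 3 = 0" "T x $ 2 $ 3 = 0"
    by (rule *[OF d]; use K K_L_iff in blast)+
  assume "variation (k0_level c) \<gamma>"
  from variationE[OF this] obtain e where "e > 0" "\<And>\<epsilon>. \<epsilon> \<in> {-e<..<e} \<Longrightarrow> \<gamma> \<epsilon> \<in> k0_level c" by blast
  then show "T x $ 1 $ 2 = 0" by (intro *[of e]) (auto simp: k0_level_iff)
qed

text \<open>The gradient of a functional on \<open>\<K>\<^sub>L\<close> is only seen through its \<open>z\<close>-part, which pairs with the
  variations of \<open>k\<^sub>1, k\<^sub>2\<close>, and its first \<open>w\<close>-component, which pairs with the variation of \<open>k\<^sub>0\<close>.\<close>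

lemma trace_tangent:
  assumes "variation K_L \<gamma>" "Q \<in> o31"
  defines "T \<equiv> \<lambda>x. dx (\<lambda>\<epsilon>. \<gamma> \<epsilon> x) 0"
  shows "trace (Q ** T x) = 2 * (Q$1$2 * T x$2$1 + Q$1$3 * T x$3$1 + Q$2$1 * T x$1$2)"
  using k0_level_variation[OF assms(1)] unfolding T_def
  by (subst trace_o31[OF assms(2)]) auto

lemma k0_level_gradient_change:
  assumes Q: "has_variational_derivative S h K Q" and R: "R \<in> loops_in o31"
    and S: "S \<subseteq> K_L" and z: "\<And>x. R x $ 1 $ 2 = Q x $ 1 $ 2" "\<And>x. R x $ 1 $ 3 = Q x $ 1 $ 3"
    and w: "S \<subseteq> k0_level c \<or> (\<forall>x. R x $ 2 $ 1 = Q x $ 2 $ 1)"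
  shows "has_variational_derivative S h K R"
proof (rule has_variational_derivativeI[OF R])
  fix \<gamma> assume v: "variation S \<gamma>" and \<gamma>0: "\<gamma> 0 = K"
  have v': "variation K_L \<gamma>" by (rule variation_mono[OF S v])
  have "trace (R x ** dx (\<lambda>\<epsilon>. \<gamma> \<epsilon> x) 0) = trace (Q x ** dx (\<lambda>\<epsilon>. \<gamma> \<epsilon> x) 0)" for x
    using w k0_level_variation(5)[OF v', of c x] variation_mono[OF _ v]
    by (auto simp: trace_tangent[OF v'] loops_inD(3)[OF R] loops_inD(3)[OF has_variational_derivativeD(1)[OF Q]] z)
  then show "((\<lambda>\<epsilon>. h (\<gamma> \<epsilon>)) has_real_derivative circle_integral (\<lambda>x. trace (R x ** dx (\<lambda>\<epsilon>. \<gamma> \<epsilon> x) 0))) (at 0)"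
    using has_variational_derivativeD(2)[OF Q v \<gamma>0] by simp
qed

lemma k0_level_affine:
  assumes K: "K \<in> k0_level c" and f: "f \<in> loops_in UNIV" "g \<in> loops_in UNIV"
  defines "T \<equiv> \<lambda>x. o31_mat 0 0 0 (f x) (g x) 0"
  shows "variation (k0_level c) (\<lambda>\<epsilon> x. K x + \<epsilon> *\<^sub>R T x)" "T \<in> loops_in o31"
proof -
  show T: "T \<in> loops_in o31" unfolding T_def by (intro loop_o31_mat f loop_const) auto
  have Ko: "K \<in> loops_in o31" using K K_L_loop by (auto simp: k0_level_iff)
  show "variation (k0_level c) (\<lambda>\<epsilon> x. K x + \<epsilon> *\<^sub>R T x)"
    by (rule variationI[OF affine_family(1)[OF Ko T] UNIV_I])
      (use K affine_family(2)[OF Ko T] in \<open>auto simp: k0_level_iff K_L_iff T_def\<close>)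
qed

text \<open>Both gradients are tested against the variation of \<open>k\<^sub>1, k\<^sub>2\<close> given by the difference of their
  \<open>z\<close>-parts.\<close>

lemma k0_level_gradient_unique:
  assumes K: "K \<in> k0_level c"
    and P: "has_variational_derivative (k0_level c) h K P" and Q: "has_variational_derivative (k0_level c) h K Q"
  shows "P x $ 1 $ 2 = Q x $ 1 $ 2" "P x $ 1 $ 3 = Q x $ 1 $ 3"
proof -
  note Po = has_variational_derivativeD(1)[OF P] and Qo = has_variational_derivativeD(1)[OF Q]
  define f g where "f x = P x $ 1 $ 2 - Q x $ 1 $ 2" and "g x = P x $ 1 $ 3 - Q x $ 1 $ 3" for x
  have f: "f \<in> loops_in UNIV" and g: "g \<in> loops_in UNIV"
    unfolding f_def g_def by (intro loop_diff loop_entry[OF Po] loop_entry[OF Qo])+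
  define T where "T = (\<lambda>x. o31_mat 0 0 0 (f x) (g x) 0)"
  have v: "variation (k0_level c) (\<lambda>\<epsilon> x. K x + \<epsilon> *\<^sub>R T x)" "T \<in> loops_in o31"
    unfolding T_def by (rule k0_level_affine[OF K f g])+
  have Ko: "K \<in> loops_in o31" using K K_L_loop by (auto simp: k0_level_iff)
  have "circle_integral (\<lambda>x. trace (P x ** T x)) = circle_integral (\<lambda>x. trace (Q x ** T x))"
  proof (rule DERIV_unique)
    show "((\<lambda>\<epsilon>. h (\<lambda>x. K x + \<epsilon> *\<^sub>R T x)) has_real_derivative circle_integral (\<lambda>x. trace (P x ** T x))) (at 0)"
      using has_variational_derivativeD(2)[OF P v(1)] unfolding affine_family(3)[OF Ko v(2)] by simp
    show "((\<lambda>\<epsilon>. h (\<lambda>x. K x + \<epsilon> *\<^sub>R T x)) has_real_derivative circle_integral (\<lambda>x. trace (Q x ** T x))) (at 0)"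
      using has_variational_derivativeD(2)[OF Q v(1)] unfolding affine_family(3)[OF Ko v(2)] by simp
  qed
  then have "circle_integral (\<lambda>x. trace (P x ** T x) - trace (Q x ** T x)) = 0"
    by (subst circle_integral_diff)
      (auto intro!: loop_trace loop_matrix_mult loops_in_UNIV[OF Po] loops_in_UNIV[OF Qo] loops_in_UNIV[OF v(2)])
  moreover have "trace (P x ** T x) - trace (Q x ** T x) = 2 * (f x * f x + g x * g x)" for x
    unfolding trace_o31[OF loops_inD(3)[OF Po] loops_inD(3)[OF v(2)]] trace_o31[OF loops_inD(3)[OF Qo] loops_inD(3)[OF v(2)]]
    by (simp add: T_def f_def g_def algebra_simps)
  ultimately have "circle_integral (\<lambda>x. 2 * (f x * f x + g x * g x)) = 0" by simp
  then have "2 * (f x * f x + g x * g x) = 0"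
    by (rule circle_integral_nonneg_eq_0[rotated 2]) (auto intro!: loop_intros f g)
  then have "f x * f x + g x * g x = 0" by (metis mult_eq_0_iff zero_neq_numeral)
  then have "f x = 0 \<and> g x = 0" by (simp only: sum_squares_eq_zero_iff)
  then show "P x $ 1 $ 2 = Q x $ 1 $ 2" "P x $ 1 $ 3 = Q x $ 1 $ 3" by (simp_all add: f_def g_def)
qed

section \<open>Adapted gradients\<close>

definition \<hh>\<^sub>L :: "mat4 set" where "\<hh>\<^sub>L = {o31_mat 0 0 0 w1 w2 b | w1 w2 b. True}"

definition \<hh>\<^sub>M :: "mat4 set" where "\<hh>\<^sub>M = {o31_mat a 0 0 w1 w2 b | a w1 w2 b. True}"

text \<open>The trace form pairs \<open>a\<close> with \<open>a\<close>, \<open>z\<close> with \<open>w\<close> and \<open>b\<close> with \<open>b\<close>.\<close>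

lemma annihilator_\<hh>\<^sub>L: "R \<in> annihilator \<hh>\<^sub>L \<longleftrightarrow> R \<in> o31 \<and> R$1$2 = 0 \<and> R$1$3 = 0 \<and> R$2$3 = 0"
proof
  assume R: "R \<in> annihilator \<hh>\<^sub>L"
  then have o: "R \<in> o31" by (simp add: annihilator_def)
  have "trace (R ** o31_mat 0 0 0 w1 w2 b) = 0" for w1 w2 b
    using R unfolding annihilator_def \<hh>\<^sub>L_def by blast
  from this[of 1 0 0] this[of 0 1 0] this[of 0 0 1] o
  show "R \<in> o31 \<and> R$1$2 = 0 \<and> R$1$3 = 0 \<and> R$2$3 = 0"
    by (simp add: trace_o31[OF o o31_mat_in_o31])
next
  assume "R \<in> o31 \<and> R$1$2 = 0 \<and> R$1$3 = 0 \<and> R$2$3 = 0"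
  then show "R \<in> annihilator \<hh>\<^sub>L"
    by (auto simp: annihilator_def \<hh>\<^sub>L_def trace_o31[OF _ o31_mat_in_o31])
qed

lemma annihilator_\<hh>\<^sub>M:
  "R \<in> annihilator \<hh>\<^sub>M \<longleftrightarrow> R \<in> o31 \<and> R$1$1 = 0 \<and> R$1$2 = 0 \<and> R$1$3 = 0 \<and> R$2$3 = 0"
proof
  assume R: "R \<in> annihilator \<hh>\<^sub>M"
  then have o: "R \<in> o31" by (simp add: annihilator_def)
  have "trace (R ** o31_mat a 0 0 w1 w2 b) = 0" for a w1 w2 b
    using R unfolding annihilator_def \<hh>\<^sub>M_def by blast
  from this[of 0 1 0 0] this[of 0 0 1 0] this[of 0 0 0 1] this[of 1 0 0 0] o
  show "R \<in> o31 \<and> R$1$1 = 0 \<and> R$1$2 = 0 \<and> R$1$3 = 0 \<and> R$2$3 = 0"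
    by (simp add: trace_o31[OF o o31_mat_in_o31])
next
  assume "R \<in> o31 \<and> R$1$1 = 0 \<and> R$1$2 = 0 \<and> R$1$3 = 0 \<and> R$2$3 = 0"
  then show "R \<in> annihilator \<hh>\<^sub>M"
    by (auto simp: annihilator_def \<hh>\<^sub>M_def trace_o31[OF _ o31_mat_in_o31])
qed

lemma cov_entries:
  assumes K: "K \<in> K_L" and Q: "Q \<in> loops_in o31"
  shows
    "cov K Q x $ 1 $ 1 = dx (\<lambda>x. Q x$1$1) x + K x$1$2 * Q x$2$1 - K x$2$1 * Q x$1$2 - K x$3$1 * Q x$1$3"
    "cov K Q x $ 1 $ 2 = dx (\<lambda>x. Q x$1$2) x - K x$1$2 * Q x$1$1"
    "cov K Q x $ 1 $ 3 = dx (\<lambda>x. Q x$1$3) x + K x$1$2 * Q x$2$3"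
    "cov K Q x $ 2 $ 3 = dx (\<lambda>x. Q x$2$3) x + K x$2$1 * Q x$1$3 + K x$1$2 * Q x$3$1 - K x$3$1 * Q x$1$2"
    "cov K Q x $ 2 $ 1 = dx (\<lambda>x. Q x$2$1) x + K x$2$1 * Q x$1$1 - K x$3$1 * Q x$2$3"
    "cov K Q x $ 3 $ 1 = dx (\<lambda>x. Q x$3$1) x + K x$3$1 * Q x$1$1 + K x$2$1 * Q x$2$3"
proof -
  obtain k0 k1 k2 where k: "K x = o31_mat 0 k0 0 k1 k2 0" using K by (auto simp: K_L_def K_mat_o31_mat)
  obtain a z1 z2 w1 w2 b where q: "Q x = o31_mat a z1 z2 w1 w2 b"
    using o31_entries[OF loops_inD(3)[OF Q]] by metis
  have dx: "dx Q x $ i $ j = dx (\<lambda>x. Q x $ i $ j) x" for i j by (rule dx_entry[OF loop_has_dx[OF Q]])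
  show
    "cov K Q x $ 1 $ 1 = dx (\<lambda>x. Q x$1$1) x + K x$1$2 * Q x$2$1 - K x$2$1 * Q x$1$2 - K x$3$1 * Q x$1$3"
    "cov K Q x $ 1 $ 2 = dx (\<lambda>x. Q x$1$2) x - K x$1$2 * Q x$1$1"
    "cov K Q x $ 1 $ 3 = dx (\<lambda>x. Q x$1$3) x + K x$1$2 * Q x$2$3"
    "cov K Q x $ 2 $ 3 = dx (\<lambda>x. Q x$2$3) x + K x$2$1 * Q x$1$3 + K x$1$2 * Q x$3$1 - K x$3$1 * Q x$1$2"
    "cov K Q x $ 2 $ 1 = dx (\<lambda>x. Q x$2$1) x + K x$2$1 * Q x$1$1 - K x$3$1 * Q x$2$3"
    "cov K Q x $ 3 $ 1 = dx (\<lambda>x. Q x$3$1) x + K x$3$1 * Q x$1$1 + K x$2$1 * Q x$2$3"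
    unfolding cov_def by (simp_all add: dx[symmetric] matrix_mult_4 k q)
qed

text \<open>The conditions on the entries \<open>z\<close> and \<open>b\<close> of the covariant derivative of \<open>(a, z, w, b)\<close> are solved in
  turn for \<open>a\<close>, \<open>b\<close> and \<open>w\<^sub>2\<close>, each time dividing by \<open>k\<^sub>0\<close>.\<close>

lemma complete_to_annihilator:
  assumes K: "K \<in> K_L" and l: "z1 \<in> loops_in UNIV" "z2 \<in> loops_in UNIV" "w1 \<in> loops_in UNIV"
  shows "\<exists>Q. Q \<in> loops_in o31 \<and> (\<forall>x. cov K Q x \<in> annihilator \<hh>\<^sub>L \<and> Q x $ 1 $ 1 = dx z1 x / K x $ 1 $ 2 \<and>
    Q x $ 1 $ 2 = z1 x \<and> Q x $ 1 $ 3 = z2 x \<and> Q x $ 2 $ 1 = w1 x)"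
proof -
  have Ko: "K \<in> loops_in o31" by (rule K_L_loop[OF K])
  have k0: "(\<lambda>x. K x $ 1 $ 2) \<in> loops_in {0<..}"
    by (rule loops_in_UNIV_range[OF loop_entry[OF Ko]]) (use K K_L_iff in auto)
  have k0_pos: "K x $ 1 $ 2 > 0" for x using K K_L_iff by auto
  define a where "a = (\<lambda>x. dx z1 x / K x $ 1 $ 2)"
  define b where "b = (\<lambda>x. - dx z2 x / K x $ 1 $ 2)"
  define w2 where "w2 = (\<lambda>x. (K x$3$1 * z1 x - K x$2$1 * z2 x - dx b x) / K x$1$2)"
  have ab: "a \<in> loops_in UNIV" "b \<in> loops_in UNIV"
    unfolding a_def b_def by (intro loop_divide loop_uminus loop_dx[OF l(1)] loop_dx[OF l(2)] k0)+
  have w2: "w2 \<in> loops_in UNIV"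
    unfolding w2_def by (intro loop_divide loop_diff loop_mult loop_dx[OF ab(2)] l loop_entry[OF Ko] k0)
  define Q where "Q = (\<lambda>x. o31_mat (a x) (z1 x) (z2 x) (w1 x) (w2 x) (b x))"
  have Q: "Q \<in> loops_in o31" unfolding Q_def by (rule loop_o31_mat[OF ab(1) l w2 ab(2)])
  have "cov K Q x \<in> annihilator \<hh>\<^sub>L" for x
    unfolding annihilator_\<hh>\<^sub>L using loops_inD(3)[OF loop_cov[OF Ko Q], of x] k0_pos[of x]
    by (simp add: cov_entries[OF K Q]) (simp add: Q_def a_def b_def w2_def)
  with Q show ?thesis by (intro exI[of _ Q]) (simp add: Q_def a_def)
qed

lemma adapted_exists_L:
  assumes h: "h \<in> functionals K_L" and K: "K \<in> K_L"
  shows "\<exists>Q. adapted_gradient K_L \<hh>\<^sub>L h K Q"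
proof -
  from h K obtain P where P: "has_variational_derivative K_L h K P" unfolding functionals_def by blast
  note e = loop_entry[OF has_variational_derivativeD(1)[OF P]]
  obtain Q where Q: "Q \<in> loops_in o31" "\<And>x. cov K Q x \<in> annihilator \<hh>\<^sub>L"
    "\<And>x. Q x $ 1 $ 2 = P x $ 1 $ 2" "\<And>x. Q x $ 1 $ 3 = P x $ 1 $ 3" "\<And>x. Q x $ 2 $ 1 = P x $ 2 $ 1"
    using complete_to_annihilator[OF K e[of 1 2] e[of 1 3] e[of 2 1]] by metis
  have "has_variational_derivative K_L h K Q"
    by (rule k0_level_gradient_change[OF P Q(1)]) (simp_all add: Q)
  with Q(2) show ?thesis unfolding adapted_gradient_def by blast
qed

text \<open>On \<open>\<K>\<^sub>M\<close> the component \<open>w\<^sub>1\<close> of a gradient is arbitrary, because \<open>k\<^sub>0\<close> does not vary. The larger algebra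
  \<open>\<hh>\<^sub>M\<close> imposes one more condition, that the entry \<open>a\<close> of the covariant derivative vanishes, and this
  determines \<open>w\<^sub>1\<close>.\<close>

lemma adapted_exists_M:
  assumes h: "h \<in> functionals K_M" and K: "K \<in> K_M"
  shows "\<exists>Q. adapted_gradient K_M \<hh>\<^sub>M h K Q"
proof -
  from h K obtain P where P: "has_variational_derivative K_M h K P" unfolding functionals_def by blast
  note e = loop_entry[OF has_variational_derivativeD(1)[OF P]]
  have KL: "K \<in> K_L" and k0: "\<And>x. K x $ 1 $ 2 = 1" using K by (auto simp: K_M_eq K_L1_def k0_level_iff)
  note k = loop_entry[OF K_L_loop[OF KL]]
  define z1 where "z1 = (\<lambda>x. P x $ 1 $ 2)"
  have z1: "z1 \<in> loops_in UNIV" unfolding z1_def by (rule e)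
  define w1 where "w1 = (\<lambda>x. K x$2$1 * z1 x + K x$3$1 * P x$1$3 - dx (dx z1) x)"
  have w1: "w1 \<in> loops_in UNIV"
    unfolding w1_def by (intro loop_diff loop_add loop_mult loop_dx[OF loop_dx[OF z1]] z1 e k)
  obtain Q where Q: "Q \<in> loops_in o31" "\<And>x. cov K Q x \<in> annihilator \<hh>\<^sub>L" "\<And>x. Q x $ 1 $ 1 = dx z1 x"
    "\<And>x. Q x $ 1 $ 2 = P x $ 1 $ 2" "\<And>x. Q x $ 1 $ 3 = P x $ 1 $ 3" "\<And>x. Q x $ 2 $ 1 = w1 x"
    using complete_to_annihilator[OF KL z1 e[of 1 3] w1] unfolding k0 div_by_1 z1_def by metis
  have "has_variational_derivative K_M h K Q"
    by (rule k0_level_gradient_change[OF P Q(1), of "\<lambda>_. 1"]) (auto simp: Q K_M_eq K_L1_def k0_level_iff)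
  moreover have "cov K Q x $ 1 $ 1 = 0" for x
    unfolding cov_entries[OF KL Q(1)] Q k0 by (simp add: w1_def z1_def)
  ultimately show ?thesis
    using Q(2) unfolding adapted_gradient_def annihilator_\<hh>\<^sub>L annihilator_\<hh>\<^sub>M by blast
qed

lemma dx_diff:
  assumes "f \<in> loops_in UNIV" "g \<in> loops_in UNIV"
  shows "dx (\<lambda>x. f x - g x) x = dx f x - dx g x"
  by (rule dx_eqI) (intro has_vector_derivative_diff loop_has_dx[OF assms(1)] loop_has_dx[OF assms(2)])

lemma cov_diff:
  assumes "P \<in> loops_in o31" "Q \<in> loops_in o31"
  shows "cov K (\<lambda>x. P x - Q x) x = cov K P x - cov K Q x"
  unfolding cov_def dx_diff[OF loops_in_UNIV[OF assms(1)] loops_in_UNIV[OF assms(2)]]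
  by (simp add: mat_algebra)

text \<open>Annihilation of \<open>\<hh>\<^sub>L\<close> leaves no freedom beyond the first \<open>w\<close>-component once the \<open>z\<close>-part is given. If two
  gradients differ by \<open>d\<close> in that component, the integrands differ by the total derivative of \<open>2 z\<^sub>1 d\<close>, where
  \<open>z\<^sub>1\<close> belongs to \<open>R\<close>.\<close>

lemma pairing_z_part:
  assumes K: "K \<in> K_L" and P: "P \<in> loops_in o31" "\<And>x. cov K P x \<in> annihilator \<hh>\<^sub>L"
    and Q: "Q \<in> loops_in o31" "\<And>x. cov K Q x \<in> annihilator \<hh>\<^sub>L"
    and R: "R \<in> loops_in o31" "\<And>x. cov K R x \<in> annihilator \<hh>\<^sub>L"
    and z: "\<And>x. P x $ 1 $ 2 = Q x $ 1 $ 2" "\<And>x. P x $ 1 $ 3 = Q x $ 1 $ 3"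
  shows "pairing K P R = pairing K Q R"
proof -
  have Ko: "K \<in> loops_in o31" by (rule K_L_loop[OF K])
  have k0: "K x $ 1 $ 2 > 0" for x using K K_L_iff by auto
  define D where "D = (\<lambda>x. P x - Q x)"
  have Do: "D \<in> loops_in o31"
    unfolding D_def by (rule loops_in_UNIV_range)
      (auto intro!: loop_diff o31_diff loops_in_UNIV[OF P(1)] loops_in_UNIV[OF Q(1)] loops_inD(3)[OF P(1)] loops_inD(3)[OF Q(1)])
  have cD: "cov K D x $ 1 $ 2 = 0" "cov K D x $ 1 $ 3 = 0" "cov K D x $ 2 $ 3 = 0" "cov K D x \<in> o31" for x
    using P(2)[of x] Q(2)[of x] unfolding D_def cov_diff[OF P(1) Q(1)] annihilator_\<hh>\<^sub>L
    by (auto intro: o31_diff)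
  have dx0: "dx (\<lambda>x. 0::real) x = 0" for x by (rule dx_eqI) (rule has_vector_derivative_const)
  have D12: "D x $ 1 $ 2 = 0" "D x $ 1 $ 3 = 0" for x using z by (auto simp: D_def)
  have D11: "D x $ 1 $ 1 = 0" "D x $ 2 $ 3 = 0" for x
    using cD(1,2)[of x] k0[of x] unfolding cov_entries[OF K Do] D12 dx0 by auto
  have D31: "D x $ 3 $ 1 = 0" for x
    using cD(3)[of x] k0[of x] unfolding cov_entries[OF K Do] D12 D11 dx0 by auto
  define d r where "d x = D x $ 2 $ 1" and "r x = R x $ 1 $ 2" for x
  have d: "d \<in> loops_in UNIV" and r: "r \<in> loops_in UNIV"
    unfolding d_def r_def by (intro loop_entry[OF Do] loop_entry[OF R(1)])+
  have dr: "dx (\<lambda>x. d x * r x) x = d x * dx r x + dx d x * r x" for x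
    by (rule dx_eqI)
      (intro bounded_bilinear.has_vector_derivative[OF bounded_bilinear_mult] loop_has_dx[OF d] loop_has_dx[OF r])
  have "trace (R x ** cov K D x) = 2 * dx (\<lambda>x. d x * r x) x" for x
  proof -
    have "K x $ 1 $ 2 * R x $ 1 $ 1 = dx r x"
      using R(2)[of x] unfolding annihilator_\<hh>\<^sub>L cov_entries[OF K R(1)] r_def by simp
    then have "R x $ 1 $ 1 * (K x $ 1 $ 2 * d x) = d x * dx r x" by (simp add: mult.commute mult.left_commute)
    then show ?thesis
      unfolding dr trace_o31[OF loops_inD(3)[OF R(1)] cD(4)] cD(1-3) cov_entries[OF K Do] D12 D11 D31 dx0
      by (simp add: d_def[symmetric] r_def[symmetric] algebra_simps)
  qed
  then have "circle_integral (\<lambda>x. trace (R x ** cov K D x)) = circle_integral (\<lambda>x. 2 * dx (\<lambda>x. d x * r x) x)"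
    by simp
  also have "\<dots> = 2 * circle_integral (dx (\<lambda>x. d x * r x))"
    by (simp add: circle_integral_def)
  also have "\<dots> = 0" using circle_integral_dx[OF loop_mult[OF d r]] by simp
  finally have "circle_integral (\<lambda>x. trace (R x ** cov K P x) - trace (R x ** cov K Q x)) = 0"
    unfolding D_def cov_diff[OF P(1) Q(1)] by (simp add: matrix_minus_mult trace_sub)
  then show ?thesis
    unfolding pairing_def
    by (subst (asm) circle_integral_diff)
      (auto intro!: loop_trace loop_matrix_mult loops_in_UNIV[OF R(1)] loops_in_UNIV[OF loop_cov[OF Ko P(1)]] loops_in_UNIV[OF loop_cov[OF Ko Q(1)]])
qed

lemma adapted_gradient_level:
  assumes "adapted_gradient KK \<hh> h K Q" "k0_level c \<subseteq> KK" "annihilator \<hh> \<subseteq> annihilator \<hh>\<^sub>L"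
  shows "has_variational_derivative (k0_level c) h K Q" "Q \<in> loops_in o31" "cov K Q x \<in> annihilator \<hh>\<^sub>L"
  using assms has_variational_derivative_mono has_variational_derivativeD(1)
  unfolding adapted_gradient_def by blast+

lemma pairing_unique_level:
  assumes K: "K \<in> k0_level c" and KK: "k0_level c \<subseteq> KK" and \<hh>: "annihilator \<hh> \<subseteq> annihilator \<hh>\<^sub>L"
    and "adapted_gradient KK \<hh> h K P" "adapted_gradient KK \<hh> h K Q" "adapted_gradient KK \<hh> f K R"
  shows "pairing K P R = pairing K Q R"
proof -
  note P = adapted_gradient_level[OF assms(4) KK \<hh>] and Q = adapted_gradient_level[OF assms(5) KK \<hh>]
    and R = adapted_gradient_level[OF assms(6) KK \<hh>]
  have KL: "K \<in> K_L" using K by (simp add: k0_level_iff)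
  show ?thesis
    by (rule pairing_z_part[OF KL P(2,3) Q(2,3) R(2,3) k0_level_gradient_unique[OF K P(1) Q(1)]])
qed

section \<open>The isotropy groups\<close>

lemma norm_real2: "(norm (v :: real^2))\<^sup>2 = (v$1)\<^sup>2 + (v$2)\<^sup>2"
  by (simp add: norm_vec_def L2_set_def sum_2)

lemma vector_2 [simp]: "(vector [a, b] :: 'a::zero^2) $ 1 = a" "(vector [a, b] :: 'a::zero^2) $ 2 = b"
  by (simp_all add: vector_def)

definition rot :: "real \<Rightarrow> real \<Rightarrow> real^2^2" where
  "rot c s = vector [vector [c, - s], vector [s, c]]"

lemma rot_nth [simp]: "rot c s $ 1 $ 1 = c" "rot c s $ 1 $ 2 = - s" "rot c s $ 2 $ 1 = s" "rot c s $ 2 $ 2 = c"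
  by (simp_all add: rot_def)

lemma block_diag_nth [simp]:
  "block_diag \<alpha> A $ 1 $ 1 = \<alpha>" "block_diag \<alpha> A $ 1 $ 2 = 0" "block_diag \<alpha> A $ 1 $ 3 = 0" "block_diag \<alpha> A $ 1 $ 4 = 0"
  "block_diag \<alpha> A $ 2 $ 1 = 0" "block_diag \<alpha> A $ 2 $ 2 = A$1$1" "block_diag \<alpha> A $ 2 $ 3 = A$1$2" "block_diag \<alpha> A $ 2 $ 4 = 0"
  "block_diag \<alpha> A $ 3 $ 1 = 0" "block_diag \<alpha> A $ 3 $ 2 = A$2$1" "block_diag \<alpha> A $ 3 $ 3 = A$2$2" "block_diag \<alpha> A $ 3 $ 4 = 0"
  "block_diag \<alpha> A $ 4 $ 1 = 0" "block_diag \<alpha> A $ 4 $ 2 = 0" "block_diag \<alpha> A $ 4 $ 3 = 0" "block_diag \<alpha> A $ 4 $ 4 = 1 / \<alpha>"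
  by (simp_all add: block_diag_def)

lemma N_minus_nth [simp]:
  "N_minus \<xi> $ 1 $ 1 = 1" "N_minus \<xi> $ 1 $ 2 = 0" "N_minus \<xi> $ 1 $ 3 = 0" "N_minus \<xi> $ 1 $ 4 = 0"
  "N_minus \<xi> $ 2 $ 1 = \<xi>$1" "N_minus \<xi> $ 2 $ 2 = 1" "N_minus \<xi> $ 2 $ 3 = 0" "N_minus \<xi> $ 2 $ 4 = 0"
  "N_minus \<xi> $ 3 $ 1 = \<xi>$2" "N_minus \<xi> $ 3 $ 2 = 0" "N_minus \<xi> $ 3 $ 3 = 1" "N_minus \<xi> $ 3 $ 4 = 0"
  "N_minus \<xi> $ 4 $ 1 = ((\<xi>$1)\<^sup>2 + (\<xi>$2)\<^sup>2) / 2" "N_minus \<xi> $ 4 $ 2 = \<xi>$1" "N_minus \<xi> $ 4 $ 3 = \<xi>$2" "N_minus \<xi> $ 4 $ 4 = 1"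
  by (simp_all add: N_minus_def norm_real2)

lemma J_nth [simp]:
  "J $ 1 $ 1 = 0" "J $ 1 $ 2 = 0" "J $ 1 $ 3 = 0" "J $ 1 $ 4 = -1"
  "J $ 2 $ 1 = 0" "J $ 2 $ 2 = 1" "J $ 2 $ 3 = 0" "J $ 2 $ 4 = 0"
  "J $ 3 $ 1 = 0" "J $ 3 $ 2 = 0" "J $ 3 $ 3 = 1" "J $ 3 $ 4 = 0"
  "J $ 4 $ 1 = -1" "J $ 4 $ 2 = 0" "J $ 4 $ 3 = 0" "J $ 4 $ 4 = 0"
  by (simp_all add: J_def)

lemma mat_1_nth [simp]: "(mat 1 :: mat4) $ i $ j = (if i = j then 1 else 0)"
  by (simp add: mat_def)

lemma N_minus_O31: "N_minus \<xi> \<in> O31"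
  by (simp add: O31_iff mat4_eq_iff forall_4 matrix_mult_4 transpose_def power2_eq_square field_simps)

lemma block_diag_rot_O31:
  assumes "\<alpha> \<noteq> 0" "c\<^sup>2 + s\<^sup>2 = 1"
  shows "block_diag \<alpha> (rot c s) \<in> O31"
  using assms by (simp add: O31_iff mat4_eq_iff forall_4 matrix_mult_4 transpose_def power2_eq_square algebra_simps)

lemma N_minus_inv: "matrix_inv (N_minus \<xi>) = N_minus (- \<xi>)"
  by (rule matrix_inv_unique) (simp add: mat4_eq_iff forall_4 matrix_mult_4 power2_eq_square field_simps)

lemma block_diag_rot_inv:
  assumes "\<alpha> \<noteq> 0" "c\<^sup>2 + s\<^sup>2 = 1"
  shows "matrix_inv (block_diag \<alpha> (rot c s)) = block_diag (1 / \<alpha>) (rot c (- s))"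
  by (rule matrix_inv_unique)
    (use assms in \<open>simp add: mat4_eq_iff forall_4 matrix_mult_4 power2_eq_square algebra_simps\<close>)

abbreviation e\<^sub>4 :: "real^4" where "e\<^sub>4 \<equiv> axis 4 1"

lemma mult_e4: "A *v e\<^sub>4 = c *\<^sub>R e\<^sub>4 \<longleftrightarrow> A$1$4 = 0 \<and> A$2$4 = 0 \<and> A$3$4 = 0 \<and> (A :: mat4)$4$4 = c"
  by (simp add: vec_eq_iff forall_4 matrix_vector_mult_4 axis_def)

lemma O31_column4:
  assumes "\<Theta> \<in> O31"
  shows "(\<Theta>$2$4)\<^sup>2 + (\<Theta>$3$4)\<^sup>2 = 2 * \<Theta>$1$4 * \<Theta>$4$4"
proof -
  have "(transpose \<Theta> ** J ** \<Theta>) $ 4 $ 4 = 0" using assms by (simp add: O31_iff)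
  then show ?thesis by (simp add: matrix_mult_4 transpose_def power2_eq_square algebra_simps)
qed

lemma H_L_iff: "g \<in> H_L \<longleftrightarrow> g \<in> O31 \<and> g *v e\<^sub>4 = 1 *\<^sub>R e\<^sub>4"
  by (simp add: H_L_def)

text \<open>The isotropy group of the origin of the Moebius sphere is the stabilizer of the line through
  \<open>e\<^sub>4\<close>, because a null vector whose middle components vanish and whose last component does not is a multiple of
  \<open>e\<^sub>4\<close>.\<close>

lemma H_M_iff: "g \<in> H_M \<longleftrightarrow> g \<in> O31 \<and> (\<exists>c. c \<noteq> 0 \<and> g *v e\<^sub>4 = c *\<^sub>R e\<^sub>4)"
proof -
  have "Lift 0 = e\<^sub>4" by (simp add: Lift_def vec_eq_iff forall_4 axis_def)
  then have "g \<in> H_M \<longleftrightarrow> g \<in> O31 \<and> g$4$4 \<noteq> 0 \<and> g$2$4 = 0 \<and> g$3$4 = 0"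
    by (auto simp: H_M_def conf_finite_def conf_act_def Proj_def matrix_vector_mult_4 axis_def vec_eq_iff forall_2)
  also have "\<dots> \<longleftrightarrow> g \<in> O31 \<and> (\<exists>c. c \<noteq> 0 \<and> g *v e\<^sub>4 = c *\<^sub>R e\<^sub>4)"
    using O31_column4[of g] by (auto simp: mult_e4)
  finally show ?thesis .
qed

lemma \<hh>\<^sub>L_iff: "X \<in> \<hh>\<^sub>L \<longleftrightarrow> X \<in> o31 \<and> X *v e\<^sub>4 = 0 *\<^sub>R e\<^sub>4"
proof
  assume "X \<in> \<hh>\<^sub>L"
  then show "X \<in> o31 \<and> X *v e\<^sub>4 = 0 *\<^sub>R e\<^sub>4"
    unfolding mult_e4 by (auto simp: \<hh>\<^sub>L_def o31_mat_in_o31)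
next
  assume X: "X \<in> o31 \<and> X *v e\<^sub>4 = 0 *\<^sub>R e\<^sub>4"
  then obtain a z1 z2 w1 w2 b where x: "X = o31_mat a z1 z2 w1 w2 b" using o31_entries by metis
  with X have "a = 0" "z1 = 0" "z2 = 0" unfolding mult_e4 by auto
  then show "X \<in> \<hh>\<^sub>L" using x by (auto simp: \<hh>\<^sub>L_def)
qed

lemma \<hh>\<^sub>M_iff: "X \<in> \<hh>\<^sub>M \<longleftrightarrow> X \<in> o31 \<and> (\<exists>c. X *v e\<^sub>4 = c *\<^sub>R e\<^sub>4)"
proof
  assume "X \<in> \<hh>\<^sub>M"
  then show "X \<in> o31 \<and> (\<exists>c. X *v e\<^sub>4 = c *\<^sub>R e\<^sub>4)"
    unfolding mult_e4 by (auto simp: \<hh>\<^sub>M_def o31_mat_in_o31)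
next
  assume X: "X \<in> o31 \<and> (\<exists>c. X *v e\<^sub>4 = c *\<^sub>R e\<^sub>4)"
  then obtain a z1 z2 w1 w2 b where x: "X = o31_mat a z1 z2 w1 w2 b" using o31_entries by metis
  with X have "z1 = 0" "z2 = 0" unfolding mult_e4 by auto
  then show "X \<in> \<hh>\<^sub>M" using x by (auto simp: \<hh>\<^sub>M_def)
qed

lemma scaleR_matrix_vector: "(A :: mat4) *v (c *\<^sub>R v) = c *\<^sub>R (A *v v)"
  by (simp add: matrix_vector_mult_scaleR)

lemma inv_fixes_line:
  assumes "g \<in> O31" "g *v e\<^sub>4 = c *\<^sub>R e\<^sub>4" "c \<noteq> 0"
  shows "matrix_inv g *v e\<^sub>4 = (1 / c) *\<^sub>R e\<^sub>4"
proof -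
  have "c *\<^sub>R (matrix_inv g *v e\<^sub>4) = matrix_inv g *v (g *v e\<^sub>4)"
    by (simp add: assms(2) scaleR_matrix_vector)
  also have "\<dots> = e\<^sub>4" by (simp add: matrix_vector_mul_assoc matrix_inv_O31(2)[OF assms(1)])
  finally have "(1 / c) *\<^sub>R (c *\<^sub>R (matrix_inv g *v e\<^sub>4)) = (1 / c) *\<^sub>R e\<^sub>4" by simp
  then show ?thesis using assms(3) by simp
qed

text \<open>The matrices \<open>g\<close> have \<open>e\<^sub>4\<close> as an eigenvector with eigenvalue \<open>c\<close>; hence so do \<open>g'\<close>, with eigenvalue \<open>c'\<close>, and
  \<open>g\<^sup>-\<^sup>1\<close>, with eigenvalue \<open>1 / c\<close>.\<close>

lemma isotropy_tangent:
  assumes S: "open S" "t \<in> S" and g: "\<And>s. s \<in> S \<Longrightarrow> g s \<in> O31" "\<And>s. s \<in> S \<Longrightarrow> c s \<noteq> 0 \<and> g s *v e\<^sub>4 = c s *\<^sub>R e\<^sub>4"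
    and g': "(g has_vector_derivative g') (at (t::real))"
  shows "matrix_inv (g t) ** g' \<in> o31" "(matrix_inv (g t) ** g') *v e\<^sub>4 = (dx c t / c t) *\<^sub>R e\<^sub>4"
proof -
  show "matrix_inv (g t) ** g' \<in> o31" by (rule O31_logarithmic_derivative[OF S g(1) g'])
  have d: "g' $ i $ j = dx (\<lambda>s. g s $ i $ j) t" for i j
    using dx_bounded_linear[OF bounded_linear_entry g'] by simp
  have zero: "g' $ i $ 4 = 0" if "i \<in> {1, 2, 3}" for i
  proof -
    have "g' $ i $ 4 = dx (\<lambda>s. 0) t"
      unfolding d by (rule dx_cong[OF S]) (use g(2) that in \<open>auto simp: mult_e4\<close>)
    also have "\<dots> = 0" by (rule dx_eqI) (rule has_vector_derivative_const)
    finally show ?thesis .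
  qed
  have "g' $ 4 $ 4 = dx c t"
    unfolding d by (rule dx_cong[OF S]) (use g(2) in \<open>auto simp: mult_e4\<close>)
  then have "g' *v e\<^sub>4 = dx c t *\<^sub>R e\<^sub>4" using zero by (simp add: mult_e4)
  moreover have "matrix_inv (g t) *v e\<^sub>4 = (1 / c t) *\<^sub>R e\<^sub>4"
    using g S(2) by (intro inv_fixes_line) auto
  ultimately show "(matrix_inv (g t) ** g') *v e\<^sub>4 = (dx c t / c t) *\<^sub>R e\<^sub>4"
    by (simp add: matrix_vector_mul_assoc[symmetric] scaleR_matrix_vector)
qed

lemma H_L_tangent:
  assumes S: "open S" "t \<in> S" "\<And>s. s \<in> S \<Longrightarrow> g s \<in> H_L" and g': "(g has_vector_derivative g') (at (t::real))"
  shows "matrix_inv (g t) ** g' \<in> \<hh>\<^sub>L"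
proof -
  have "dx (\<lambda>_. 1::real) t = 0" by (rule dx_eqI) (rule has_vector_derivative_const)
  then show ?thesis
    using isotropy_tangent[OF S(1,2) _ _ g', of "\<lambda>_. 1"] S(3) unfolding \<hh>\<^sub>L_iff H_L_iff by auto
qed

lemma H_M_tangent:
  assumes S: "open S" "t \<in> S" "\<And>s. s \<in> S \<Longrightarrow> g s \<in> H_M" and g': "(g has_vector_derivative g') (at (t::real))"
  shows "matrix_inv (g t) ** g' \<in> \<hh>\<^sub>M"
proof -
  have "\<forall>s\<in>S. \<exists>c. c \<noteq> 0 \<and> g s *v e\<^sub>4 = c *\<^sub>R e\<^sub>4" using S(3) unfolding H_M_iff by blast
  then obtain c where "\<And>s. s \<in> S \<Longrightarrow> c s \<noteq> 0 \<and> g s *v e\<^sub>4 = c s *\<^sub>R e\<^sub>4" by metis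
  from isotropy_tangent[OF S(1,2) _ this g'] S(3) show ?thesis unfolding \<hh>\<^sub>M_iff H_M_iff by blast
qed

lemma isotropy_Ad:
  assumes g: "g \<in> O31" "c \<noteq> 0" "g *v e\<^sub>4 = c *\<^sub>R e\<^sub>4" and X: "X \<in> o31" "X *v e\<^sub>4 = a *\<^sub>R e\<^sub>4"
  shows "matrix_inv g ** X ** g \<in> o31" "(matrix_inv g ** X ** g) *v e\<^sub>4 = a *\<^sub>R e\<^sub>4"
  using o31_conj[OF g(1) X(1)] inv_fixes_line[OF g(1,3,2)] g X
  by (simp_all add: matrix_vector_mul_assoc[symmetric] scaleR_matrix_vector)

lemma H_L_Ad: "g \<in> H_L \<Longrightarrow> X \<in> \<hh>\<^sub>L \<Longrightarrow> matrix_inv g ** X ** g \<in> \<hh>\<^sub>L"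
  unfolding H_L_iff \<hh>\<^sub>L_iff using isotropy_Ad[of g 1 X 0] by simp

lemma H_M_Ad: "g \<in> H_M \<Longrightarrow> X \<in> \<hh>\<^sub>M \<Longrightarrow> matrix_inv g ** X ** g \<in> \<hh>\<^sub>M"
  unfolding H_M_iff \<hh>\<^sub>M_iff using isotropy_Ad[of g _ X] by blast

lemma H_L_O31: "H_L \<subseteq> O31" and H_M_O31: "H_M \<subseteq> O31"
  by (auto simp: H_L_def H_M_def)

lemma H_L_mult: "A \<in> H_L \<Longrightarrow> B \<in> H_L \<Longrightarrow> A ** B \<in> H_L"
  unfolding H_L_iff by (auto simp: O31_mult matrix_vector_mul_assoc[symmetric])

lemma H_M_mult:
  assumes "A \<in> H_M" "B \<in> H_M"
  shows "A ** B \<in> H_M"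
proof -
  from assms obtain a b where "A \<in> O31" "a \<noteq> 0" "A *v e\<^sub>4 = a *\<^sub>R e\<^sub>4" "B \<in> O31" "b \<noteq> 0" "B *v e\<^sub>4 = b *\<^sub>R e\<^sub>4"
    unfolding H_M_iff by blast
  then show ?thesis
    unfolding H_M_iff
    by (auto simp: O31_mult matrix_vector_mul_assoc[symmetric] scaleR_matrix_vector intro!: exI[of _ "a * b"])
qed

lemma H_L_subset_H_M: "H_L \<subseteq> H_M"
  by (force simp: H_L_iff H_M_iff)

lemma N_minus_H_L: "N_minus \<xi> \<in> H_L"
  unfolding H_L_iff mult_e4 by (simp add: N_minus_O31)

lemma block_diag_H_L: "c\<^sup>2 + s\<^sup>2 = 1 \<Longrightarrow> block_diag 1 (rot c s) \<in> H_L"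
  unfolding H_L_iff mult_e4 by (simp add: block_diag_rot_O31)

lemma block_diag_H_M: "\<alpha> \<noteq> 0 \<Longrightarrow> c\<^sup>2 + s\<^sup>2 = 1 \<Longrightarrow> block_diag \<alpha> (rot c s) \<in> H_M"
  unfolding H_M_iff mult_e4 by (auto simp: block_diag_rot_O31)

lemma smooth_family_N_minus:
  assumes "smooth_family V \<xi>1" "smooth_family V \<xi>2"
  shows "smooth_family V (\<lambda>\<epsilon> x. N_minus (vector [\<xi>1 \<epsilon> x, \<xi>2 \<epsilon> x]))"
proof -
  have V: "open V" by (rule smooth_family_open[OF assms(1)])
  have "smooth_family V (\<lambda>\<epsilon> x. ((\<xi>1 \<epsilon> x)\<^sup>2 + (\<xi>2 \<epsilon> x)\<^sup>2) / 2)"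
    by (rule smooth_family_bounded_linear[OF bounded_linear_divide])
      (intro smooth_family_add smooth_family_power2 assms)
  then show ?thesis
    unfolding smooth_family_mat4_iff[OF V] by (simp add: forall_4 assms smooth_family_const[OF V])
qed

lemma smooth_family_block_diag:
  assumes "smooth_family V \<alpha>" "smooth_family V c" "smooth_family V s" "\<And>\<epsilon> x. \<epsilon> \<in> V \<Longrightarrow> \<alpha> \<epsilon> x > 0"
  shows "smooth_family V (\<lambda>\<epsilon> x. block_diag (\<alpha> \<epsilon> x) (rot (c \<epsilon> x) (s \<epsilon> x)))"
proof -
  have V: "open V" by (rule smooth_family_open[OF assms(1)])
  have "smooth_family V (\<lambda>\<epsilon> x. 1 / \<alpha> \<epsilon> x)"
    by (intro smooth_family_divide smooth_family_const V assms)
  then show ?thesis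
    unfolding smooth_family_mat4_iff[OF V]
    by (simp add: forall_4 assms smooth_family_const[OF V] smooth_family_uminus)
qed

definition \<hh>_basis :: "mat4 set" where
  "\<hh>_basis = {o31_mat 0 0 0 1 0 0, o31_mat 0 0 0 0 1 0, o31_mat 0 0 0 0 0 1}"

lemma smooth_family_scaled: "\<phi> \<in> loops_in UNIV \<Longrightarrow> smooth_family UNIV (\<lambda>\<epsilon> x. \<epsilon> * \<phi> x)"
  by (intro smooth_family_mult smooth_family_param smooth_family_loop smooth_on_ident open_UNIV loops_inD(1))

lemma gauge_pathI:
  assumes g: "smooth_family UNIV g" and H: "\<And>\<epsilon> x. g \<epsilon> x \<in> H" and "\<And>\<epsilon> x. g \<epsilon> (x + 2 * pi) = g \<epsilon> x"
    and "\<And>x. g 0 x = mat 1"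
    and d: "\<And>x i j. ((\<lambda>\<epsilon>. g \<epsilon> x $ i $ j) has_real_derivative \<phi> x * X $ i $ j) (at 0)"
  shows "gauge_path H X \<phi> g"
proof -
  have "dx (\<lambda>\<epsilon>. g \<epsilon> x) 0 $ i $ j = \<phi> x * X $ i $ j" for x i j
  proof -
    have "dx (\<lambda>\<epsilon>. g \<epsilon> x) 0 $ i $ j = dx (\<lambda>\<epsilon>. g \<epsilon> x $ i $ j) 0"
      using dx_bounded_linear[OF bounded_linear_entry smooth_family_has_dx(2)[OF g UNIV_I]] by metis
    also have "\<dots> = \<phi> x * X $ i $ j"
      by (rule dx_eqI) (use d has_real_derivative_iff_has_vector_derivative in blast)
    finally show ?thesis .
  qed
  then have "dx (\<lambda>\<epsilon>. g \<epsilon> x) 0 = \<phi> x *\<^sub>R X" for x by (simp add: mat4_eq_iff)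
  then show ?thesis
    unfolding gauge_path_def using assms smooth_family_curve[OF g] by (auto intro!: loops_inI)
qed

lemma gauge_path_H_L:
  assumes X: "X \<in> \<hh>_basis" and \<phi>: "\<phi> \<in> loops_in UNIV"
  shows "\<exists>g. gauge_path H_L X \<phi> g"
proof -
  have per: "\<phi> (x + 2 * pi) = \<phi> x" for x using loops_inD(2)[OF \<phi>] .
  note s = smooth_family_scaled[OF \<phi>]
  note c = smooth_family_const[OF open_UNIV]
  have N0: "N_minus (vector [0, 0]) = mat 1" by (simp add: mat4_eq_iff forall_4)
  have D0: "block_diag 1 (rot 1 0) = mat 1" by (simp add: mat4_eq_iff forall_4)
  consider "X = o31_mat 0 0 0 1 0 0" | "X = o31_mat 0 0 0 0 1 0" | "X = o31_mat 0 0 0 0 0 1"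
    using X by (auto simp: \<hh>_basis_def)
  then show ?thesis
  proof cases
    case 1
    have "\<forall>i j. ((\<lambda>\<epsilon>. N_minus (vector [\<epsilon> * \<phi> x, 0]) $ i $ j) has_real_derivative \<phi> x * X $ i $ j) (at 0)" for x
      unfolding 1 by (auto simp: forall_4 intro!: derivative_eq_intros)
    then have "gauge_path H_L X \<phi> (\<lambda>\<epsilon> x. N_minus (vector [\<epsilon> * \<phi> x, 0]))"
      by (intro gauge_pathI smooth_family_N_minus s c) (auto simp: N_minus_H_L per N0)
    then show ?thesis by blast
  next
    case 2
    have "\<forall>i j. ((\<lambda>\<epsilon>. N_minus (vector [0, \<epsilon> * \<phi> x]) $ i $ j) has_real_derivative \<phi> x * X $ i $ j) (at 0)" for x
      unfolding 2 by (auto simp: forall_4 intro!: derivative_eq_intros)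
    then have "gauge_path H_L X \<phi> (\<lambda>\<epsilon> x. N_minus (vector [0, \<epsilon> * \<phi> x]))"
      by (intro gauge_pathI smooth_family_N_minus s c) (auto simp: N_minus_H_L per N0)
    then show ?thesis by blast
  next
    case 3
    let ?g = "\<lambda>\<epsilon> x. block_diag 1 (rot (cos (\<epsilon> * \<phi> x)) (- sin (\<epsilon> * \<phi> x)))"
    have "\<forall>i j. ((\<lambda>\<epsilon>. ?g \<epsilon> x $ i $ j) has_real_derivative \<phi> x * X $ i $ j) (at 0)" for x
      unfolding 3 by (auto simp: forall_4 intro!: derivative_eq_intros)
    moreover have "smooth_family UNIV (\<lambda>\<epsilon> x. cos (\<epsilon> * \<phi> x))" "smooth_family UNIV (\<lambda>\<epsilon> x. sin (\<epsilon> * \<phi> x))"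
      using smooth_on_cos_sin s unfolding smooth_family_def by blast+
    ultimately have "gauge_path H_L X \<phi> ?g"
      by (intro gauge_pathI smooth_family_block_diag smooth_family_uminus c)
        (auto simp: block_diag_H_L per D0)
    then show ?thesis by blast
  qed
qed

lemma gauge_path_H_M:
  assumes X: "X \<in> insert (o31_mat 1 0 0 0 0 0) \<hh>_basis" and \<phi>: "\<phi> \<in> loops_in UNIV"
  shows "\<exists>g. gauge_path H_M X \<phi> g"
proof (cases "X \<in> \<hh>_basis")
  case True
  then obtain g where "gauge_path H_L X \<phi> g" using gauge_path_H_L \<phi> by blast
  then have "gauge_path H_M X \<phi> g"
    unfolding gauge_path_def using loops_in_mono[OF H_L_subset_H_M] by blast
  then show ?thesis by blast
next
  case False
  then have X: "X = o31_mat 1 0 0 0 0 0" using assms by auto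
  have per: "\<phi> (x + 2 * pi) = \<phi> x" for x using loops_inD(2)[OF \<phi>] .
  have D0: "block_diag 1 (rot 1 0) = mat 1" by (simp add: mat4_eq_iff forall_4)
  let ?g = "\<lambda>\<epsilon> x. block_diag (exp (\<epsilon> * \<phi> x)) (rot 1 0)"
  have "\<forall>i j. ((\<lambda>\<epsilon>. ?g \<epsilon> x $ i $ j) has_real_derivative \<phi> x * X $ i $ j) (at 0)" for x
    unfolding X by (auto simp: forall_4 exp_minus[symmetric] divide_inverse intro!: derivative_eq_intros)
  moreover have "smooth_family UNIV (\<lambda>\<epsilon> x. exp (\<epsilon> * \<phi> x))"
    using smooth_on_exp smooth_family_scaled[OF \<phi>] unfolding smooth_family_def by blast
  ultimately have "gauge_path H_M X \<phi> ?g"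
    by (intro gauge_pathI smooth_family_block_diag smooth_family_const[OF open_UNIV])
      (auto simp: block_diag_H_M per D0)
  then show ?thesis by blast
qed

section \<open>Normal forms\<close>

definition z_norm :: "loop \<Rightarrow> real \<Rightarrow> real" where
  "z_norm L x = sqrt ((L x $ 1 $ 2)\<^sup>2 + (L x $ 1 $ 3)\<^sup>2)"

text \<open>The gauge transformations of both groups rotate and rescale \<open>z\<close>, so that the loops whose part \<open>z\<close> vanishes
  nowhere form a common domain for the two normal forms.\<close>

definition regular_loops :: "loop set" where
  "regular_loops = {L \<in> loops_in o31. \<forall>x. z_norm L x > 0}"

lemma loop_open_regular_loops: "loop_open regular_loops"
  unfolding loop_open_def
proof (intro conjI ballI)
  show "regular_loops \<subseteq> loops_in o31" by (auto simp: regular_loops_def)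
  fix L assume L: "L \<in> regular_loops"
  then have Lo: "L \<in> loops_in o31" and pos: "\<And>x. z_norm L x > 0" by (auto simp: regular_loops_def)
  have nP: "z_norm L x = norm (L x $ 1 $ 2, L x $ 1 $ 3)" for L x by (simp add: z_norm_def norm_Pair)
  have "continuous_on {0..2 * pi} (\<lambda>x. norm (L x $ 1 $ 2, L x $ 1 $ 3))"
    by (intro continuous_intros smooth_continuous_on[OF loops_inD(1)[OF loop_entry[OF Lo]]])
  then obtain y where y: "y \<in> {0..2 * pi}" "\<And>x. x \<in> {0..2 * pi} \<Longrightarrow> z_norm L y \<le> z_norm L x"
    using continuous_attains_inf[of "{0..2 * pi}" "z_norm L"] unfolding nP by auto
  have min: "z_norm L y \<le> z_norm L x" for x
  proof -
    have "z_norm L (x + 2 * pi) = z_norm L x" for x by (simp add: z_norm_def loops_inD(2)[OF Lo])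
    from periodic_wrap[of "z_norm L" x, OF this]
    obtain x' where "x' \<in> {0..2 * pi}" "z_norm L x' = z_norm L x" by blast
    then show ?thesis using y(2)[of x'] by simp
  qed
  have "L' \<in> regular_loops"
    if L': "L' \<in> loops_in o31" and close: "\<And>x. norm (L' x - L x) < z_norm L y / 2" for L'
  proof -
    have "z_norm L' x > 0" for x
    proof -
      have e: "\<bar>L x $ i $ j - L' x $ i $ j\<bar> < z_norm L y / 2" for i j
      proof -
        have "\<bar>(L' x - L x) $ i $ j\<bar> \<le> norm ((L' x - L x) $ i)" by (rule component_le_norm_cart)
        also have "\<dots> \<le> norm (L' x - L x)" by (rule Finite_Cartesian_Product.norm_nth_le)
        finally show ?thesis using close[of x] by (simp add: abs_minus_commute)
      qed
      have "norm (L x $ 1 $ 2, L x $ 1 $ 3) \<le> norm (L' x $ 1 $ 2, L' x $ 1 $ 3)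
          + norm (L x $ 1 $ 2 - L' x $ 1 $ 2, L x $ 1 $ 3 - L' x $ 1 $ 3)"
        using norm_triangle_sub[of "(L x $ 1 $ 2, L x $ 1 $ 3)" "(L' x $ 1 $ 2, L' x $ 1 $ 3)"] by simp
      also have "norm (L x $ 1 $ 2 - L' x $ 1 $ 2, L x $ 1 $ 3 - L' x $ 1 $ 3)
          \<le> \<bar>L x $ 1 $ 2 - L' x $ 1 $ 2\<bar> + \<bar>L x $ 1 $ 3 - L' x $ 1 $ 3\<bar>"
        using norm_Pair_le[of "L x $ 1 $ 2 - L' x $ 1 $ 2" "L x $ 1 $ 3 - L' x $ 1 $ 3"] by simp
      finally have "z_norm L x < z_norm L' x + z_norm L y" using e[of 1 2] e[of 1 3] by (simp add: nP)
      then show ?thesis using min[of x] by linarith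
    qed
    then show ?thesis using L' by (simp add: regular_loops_def)
  qed
  then show "\<exists>n. \<exists>\<delta>>0. \<forall>L'\<in>loops_in o31. (\<forall>j\<le>n. \<forall>x. norm ((dx ^^ j) L' x - (dx ^^ j) L x) < \<delta>) \<longrightarrow> L' \<in> regular_loops"
    using pos[of y] by (intro exI[of _ 0] exI[of _ "z_norm L y / 2"]) auto
qed

lemma K_L_regular: "K_L \<subseteq> regular_loops"
proof
  fix K assume "K \<in> K_L"
  then have K: "K \<in> loops_in o31" "\<And>x. K x $ 1 $ 2 > 0" using K_L_iff by auto
  then have "K x $ 1 $ 2 \<noteq> 0" for x using less_irrefl by metis
  with K(1) show "K \<in> regular_loops" by (simp add: regular_loops_def z_norm_def sum_power2_gt_zero_iff)
qed

text \<open>First \<open>z\<close> is rotated onto the positive first axis and divided by \<open>\<sigma> \<bar>z\<bar>\<close>; this changes \<open>a\<close> and \<open>b\<close> by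
  derivatives of \<open>z\<close>. Then a unipotent gauge transformation, which adds multiples of \<open>z\<^sub>1\<close> to \<open>a\<close> and \<open>b\<close>, makes
  both of them vanish. The scale is \<open>\<sigma> = 1\<close> for the cone, where \<open>\<bar>z\<bar>\<close> is the invariant \<open>k\<^sub>0\<close>, and the identity
  for the sphere.\<close>

definition rotation_gauge :: "(real \<Rightarrow> real) \<Rightarrow> loop \<Rightarrow> loop" where
  "rotation_gauge \<sigma> L = (\<lambda>x. block_diag (\<sigma> (z_norm L x)) (rot (L x $ 1 $ 2 / z_norm L x) (L x $ 1 $ 3 / z_norm L x)))"

definition unipotent_gauge :: "loop \<Rightarrow> loop" where
  "unipotent_gauge L = (\<lambda>x. N_minus (vector [- L x $ 1 $ 1 / L x $ 1 $ 2, - L x $ 2 $ 3 / L x $ 1 $ 2]))"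

definition normalizer :: "(real \<Rightarrow> real) \<Rightarrow> loop \<Rightarrow> loop" where
  "normalizer \<sigma> L = (\<lambda>x. rotation_gauge \<sigma> L x ** unipotent_gauge (gauge (rotation_gauge \<sigma> L) L) x)"

locale scale_function =
  fixes \<sigma> :: "real \<Rightarrow> real"
  assumes \<sigma>_smooth: "smooth_on {0<..} \<sigma>" and \<sigma>_pos: "r > 0 \<Longrightarrow> \<sigma> r > 0"
begin

lemma z_norm_unit:
  assumes "z_norm L x > 0"
  shows "(L x $ 1 $ 2 / z_norm L x)\<^sup>2 + (L x $ 1 $ 3 / z_norm L x)\<^sup>2 = 1"
proof -
  have "(z_norm L x)\<^sup>2 = (L x $ 1 $ 2)\<^sup>2 + (L x $ 1 $ 3)\<^sup>2" by (simp add: z_norm_def)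
  then show ?thesis
    unfolding power_divide add_divide_distrib[symmetric] using assms by (metis divide_self less_irrefl zero_less_power)
qed

lemma rotation_gauge_family:
  assumes \<gamma>: "smooth_family V \<gamma>" and pos: "\<And>\<epsilon> x. \<epsilon> \<in> V \<Longrightarrow> z_norm (\<gamma> \<epsilon>) x > 0"
  shows "smooth_family V (\<lambda>\<epsilon>. rotation_gauge \<sigma> (\<gamma> \<epsilon>))"
proof -
  have e: "smooth_family V (\<lambda>\<epsilon> x. \<gamma> \<epsilon> x $ i $ j)" for i j
    using \<gamma> smooth_family_mat4_iff smooth_family_open by blast
  have n: "smooth_family V (\<lambda>\<epsilon> x. z_norm (\<gamma> \<epsilon>) x)"
    unfolding z_norm_def
    by (intro smooth_family_sqrt smooth_family_add smooth_family_power2 e) (use pos in \<open>simp add: z_norm_def\<close>)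
  have "smooth_family V (\<lambda>\<epsilon> x. \<sigma> (z_norm (\<gamma> \<epsilon>) x))"
    using smooth_on_compose_real[OF \<sigma>_smooth n[unfolded smooth_family_def]] pos
    unfolding smooth_family_def by auto
  then show ?thesis
    unfolding rotation_gauge_def
    by (intro smooth_family_block_diag smooth_family_divide e n) (auto intro: \<sigma>_pos pos)
qed

lemma smooth_family_loops: "smooth_on UNIV f \<Longrightarrow> smooth_family UNIV (\<lambda>\<epsilon>. f)"
  by (rule smooth_family_loop) auto

lemma rotation_gauge_O31: "z_norm L x > 0 \<Longrightarrow> rotation_gauge \<sigma> L x \<in> O31"
  unfolding rotation_gauge_def using \<sigma>_pos[of "z_norm L x"] by (intro block_diag_rot_O31 z_norm_unit) auto

lemma rotation_gauge_loop:
  assumes "L \<in> regular_loops"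
  shows "rotation_gauge \<sigma> L \<in> loops_in O31"
proof -
  have L: "L \<in> loops_in o31" "\<And>x. z_norm L x > 0" using assms by (auto simp: regular_loops_def)
  have "smooth_family UNIV (\<lambda>\<epsilon>. rotation_gauge \<sigma> L)"
    by (rule rotation_gauge_family[OF smooth_family_loops[OF loops_inD(1)[OF L(1)]] L(2)])
  from smooth_family_curve[OF this] show ?thesis
    using rotation_gauge_O31[OF L(2)] loops_inD(2)[OF L(1)]
    by (intro loops_inI) (auto simp: rotation_gauge_def z_norm_def)
qed

lemma rotation_gauge_entries:
  assumes L: "L \<in> regular_loops"
  shows "gauge (rotation_gauge \<sigma> L) L x $ 1 $ 2 = z_norm L x / \<sigma> (z_norm L x)"
    "gauge (rotation_gauge \<sigma> L) L x $ 1 $ 3 = 0"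
proof -
  let ?g = "rotation_gauge \<sigma> L"
  have pos: "\<And>x. z_norm L x > 0" using L by (auto simp: regular_loops_def)
  have sq: "z_norm L x * z_norm L x = L x $ 1 $ 2 * L x $ 1 $ 2 + L x $ 1 $ 3 * L x $ 1 $ 3"
    by (simp add: z_norm_def power2_eq_square)
  have inv: "matrix_inv (?g x) = block_diag (1 / \<sigma> (z_norm L x)) (rot (L x $ 1 $ 2 / z_norm L x) (- (L x $ 1 $ 3 / z_norm L x)))"
    unfolding rotation_gauge_def using \<sigma>_pos[OF pos, of x] by (intro block_diag_rot_inv z_norm_unit pos) auto
  have d: "dx ?g x $ 1 $ j = 0" if "j = 2 \<or> j = 3" for j
  proof -
    have "dx ?g x $ 1 $ j = dx (\<lambda>x. ?g x $ 1 $ j) x" by (rule dx_entry[OF loop_has_dx[OF rotation_gauge_loop[OF L]]])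
    also have "(\<lambda>x. ?g x $ 1 $ j) = (\<lambda>x. 0)" using that by (auto simp: rotation_gauge_def)
    also have "dx (\<lambda>x. 0) x = (0::real)" by (rule dx_eqI) (rule has_vector_derivative_const)
    finally show ?thesis .
  qed
  have L14: "L x $ 1 $ 4 = 0" using o31_entries[OF loops_inD(3)[of L o31 x]] L
    unfolding regular_loops_def by (metis (no_types, lifting) o31_mat_nth(4) mem_Collect_eq)
  have *: "gauge ?g L x $ 1 $ j = (matrix_inv (?g x) ** L x ** ?g x) $ 1 $ j" if "j = 2 \<or> j = 3" for j
    unfolding gauge_def using d[OF that] by (simp add: matrix_mult_4 inv)
  show "gauge ?g L x $ 1 $ 3 = 0"
    unfolding *[OF disjI2[OF refl]]
    by (simp add: matrix_mult_4 inv) (simp add: rotation_gauge_def L14 field_simps)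
  have "\<sigma> (z_norm L x) * (L x $ 1 $ 2 * L x $ 1 $ 2) + \<sigma> (z_norm L x) * (L x $ 1 $ 3 * L x $ 1 $ 3)
      = z_norm L x * (z_norm L x * \<sigma> (z_norm L x))"
    using sq by algebra
  then show "gauge ?g L x $ 1 $ 2 = z_norm L x / \<sigma> (z_norm L x)"
    unfolding *[OF disjI1[OF refl]] using pos[of x] \<sigma>_pos[OF pos, of x]
    by (simp add: matrix_mult_4 inv) (simp add: rotation_gauge_def L14 field_simps)
qed

lemma unipotent_gauge_family:
  assumes \<gamma>: "smooth_family V \<gamma>" and pos: "\<And>\<epsilon> x. \<epsilon> \<in> V \<Longrightarrow> \<gamma> \<epsilon> x $ 1 $ 2 > 0"
  shows "smooth_family V (\<lambda>\<epsilon>. unipotent_gauge (\<gamma> \<epsilon>))"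
proof -
  have e: "smooth_family V (\<lambda>\<epsilon> x. \<gamma> \<epsilon> x $ i $ j)" for i j
    using \<gamma> smooth_family_mat4_iff smooth_family_open by blast
  show ?thesis
    unfolding unipotent_gauge_def
    by (intro smooth_family_N_minus smooth_family_divide smooth_family_uminus e pos)
qed

lemma unipotent_gauge_loop:
  assumes "L \<in> loops_in o31" "\<And>x. L x $ 1 $ 2 > 0"
  shows "unipotent_gauge L \<in> loops_in H_L"
proof -
  have "smooth_family UNIV (\<lambda>\<epsilon>. unipotent_gauge L)"
    by (rule unipotent_gauge_family[OF smooth_family_loops[OF loops_inD(1)[OF assms(1)]] assms(2)])
  from smooth_family_curve[OF this] show ?thesis
    using loops_inD(2)[OF assms(1)] by (intro loops_inI) (auto simp: unipotent_gauge_def N_minus_H_L)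
qed

lemma unipotent_gauge_entries:
  assumes L: "L \<in> loops_in o31" "\<And>x. L x $ 1 $ 2 > 0" "\<And>x. L x $ 1 $ 3 = 0"
  shows "gauge (unipotent_gauge L) L x $ 1 $ 1 = 0" "gauge (unipotent_gauge L) L x $ 1 $ 2 = L x $ 1 $ 2"
    "gauge (unipotent_gauge L) L x $ 1 $ 3 = 0" "gauge (unipotent_gauge L) L x $ 2 $ 3 = 0"
proof -
  let ?g = "unipotent_gauge L"
  have g: "?g \<in> loops_in H_L" by (rule unipotent_gauge_loop[OF L(1,2)])
  define p q where "p = - L x $ 1 $ 1 / L x $ 1 $ 2" and "q = - L x $ 2 $ 3 / L x $ 1 $ 2"
  have pq: "p * L x $ 1 $ 2 = - L x $ 1 $ 1" "q * L x $ 1 $ 2 = - L x $ 2 $ 3"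
    using L(2)[of x] by (simp_all add: p_def q_def)
  have gx: "?g x = N_minus (vector [p, q])" by (simp add: unipotent_gauge_def p_def q_def)
  have inv: "matrix_inv (N_minus (vector [p, q])) = N_minus (vector [- p, - q])"
  proof -
    have "- vector [p, q] = (vector [- p, - q] :: real^2)" by (simp add: vec_eq_iff forall_2)
    then show ?thesis unfolding N_minus_inv by simp
  qed
  obtain a z1 z2 w1 w2 b where l: "L x = o31_mat a z1 z2 w1 w2 b" using o31_entries[OF loops_inD(3)[OF L(1)]] by metis
  have z2: "z2 = 0" using L(3)[of x] by (simp add: l)
  have dxe: "dx ?g x $ i $ j = dx (\<lambda>x. ?g x $ i $ j) x" for i j by (rule dx_entry[OF loop_has_dx[OF g]])
  have dconst: "dx (\<lambda>x. c) x = 0" for c :: real by (rule dx_eqI) (rule has_vector_derivative_const)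
  have d: "dx ?g x $ 1 $ 1 = 0" "dx ?g x $ 1 $ 2 = 0" "dx ?g x $ 1 $ 3 = 0" "dx ?g x $ 2 $ 3 = 0"
    unfolding dxe by (simp_all add: unipotent_gauge_def dconst)
  show "gauge ?g L x $ 1 $ 1 = 0" "gauge ?g L x $ 1 $ 2 = L x $ 1 $ 2"
    "gauge ?g L x $ 1 $ 3 = 0" "gauge ?g L x $ 2 $ 3 = 0"
    using pq unfolding gauge_def gx inv l z2 by (simp_all add: matrix_mult_4 d algebra_simps)
qed

lemma normalizer_slice:
  assumes L: "L \<in> regular_loops"
  shows "gauge (normalizer \<sigma> L) L \<in> K_L"
    "gauge (normalizer \<sigma> L) L x $ 1 $ 2 = z_norm L x / \<sigma> (z_norm L x)"
proof -
  have Lo: "L \<in> loops_in o31" and pos: "\<And>x. z_norm L x > 0" using L by (auto simp: regular_loops_def)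
  let ?D = "rotation_gauge \<sigma> L"
  let ?L = "gauge ?D L"
  have D: "?D \<in> loops_in O31" by (rule rotation_gauge_loop[OF L])
  have L1: "?L \<in> loops_in o31" by (rule gauge_loop[OF D Lo])
  have p: "?L x $ 1 $ 2 > 0" for x unfolding rotation_gauge_entries[OF L] using pos \<sigma>_pos by simp
  have N: "unipotent_gauge ?L \<in> loops_in O31"
    using unipotent_gauge_loop[OF L1 p] loops_in_mono[OF H_L_O31] by blast
  have eq: "gauge (normalizer \<sigma> L) L = gauge (unipotent_gauge ?L) ?L"
    unfolding normalizer_def by (rule gauge_mult[OF D N])
  note e = unipotent_gauge_entries[OF L1 p rotation_gauge_entries(2)[OF L]]
  show "gauge (normalizer \<sigma> L) L \<in> K_L"
    unfolding K_L_iff eq using gauge_loop[OF N L1] e p by simp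
  show "gauge (normalizer \<sigma> L) L x $ 1 $ 2 = z_norm L x / \<sigma> (z_norm L x)"
    unfolding eq e rotation_gauge_entries[OF L] ..
qed

lemma normalizer_family:
  assumes \<gamma>: "smooth_family V \<gamma>" and r: "\<And>\<epsilon>. \<epsilon> \<in> V \<Longrightarrow> \<gamma> \<epsilon> \<in> regular_loops"
  shows "smooth_family V (\<lambda>\<epsilon>. normalizer \<sigma> (\<gamma> \<epsilon>))"
proof -
  have pos: "z_norm (\<gamma> \<epsilon>) x > 0" if "\<epsilon> \<in> V" for \<epsilon> x using r[OF that] by (simp add: regular_loops_def)
  have D: "smooth_family V (\<lambda>\<epsilon>. rotation_gauge \<sigma> (\<gamma> \<epsilon>))" by (rule rotation_gauge_family[OF \<gamma> pos])
  have "smooth_family V (\<lambda>\<epsilon>. unipotent_gauge (gauge (rotation_gauge \<sigma> (\<gamma> \<epsilon>)) (\<gamma> \<epsilon>)))"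
    by (rule unipotent_gauge_family[OF smooth_family_gauge[OF \<gamma> D rotation_gauge_O31[OF pos]]])
      (simp_all add: rotation_gauge_entries[OF r] pos \<sigma>_pos)
  then show ?thesis unfolding normalizer_def by (intro smooth_family_matrix_mult D)
qed

lemma normalizer_fixed:
  assumes K: "K \<in> K_L" and \<sigma>: "\<And>x. \<sigma> (K x $ 1 $ 2) = 1"
  shows "gauge (normalizer \<sigma> K) K = K"
proof -
  have e: "K x $ 1 $ 2 > 0" "K x $ 1 $ 1 = 0" "K x $ 1 $ 3 = 0" "K x $ 2 $ 3 = 0" for x using K K_L_iff by auto
  have "z_norm K x = K x $ 1 $ 2" for x using e[of x] by (simp add: z_norm_def)
  then have D: "rotation_gauge \<sigma> K = (\<lambda>_. mat 1)"
    using e \<sigma> by (auto simp: rotation_gauge_def mat4_eq_iff forall_4 less_imp_neq[symmetric])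
  have "unipotent_gauge K = (\<lambda>_. mat 1)"
    using e by (auto simp: unipotent_gauge_def mat4_eq_iff forall_4)
  then have "normalizer \<sigma> K = (\<lambda>_. mat 1)" unfolding normalizer_def D gauge_one by simp
  then show ?thesis by (simp add: gauge_one)
qed

lemma normalizer_loop:
  assumes L: "L \<in> regular_loops" and H: "H_L \<subseteq> H" "\<And>A B. A \<in> H \<Longrightarrow> B \<in> H \<Longrightarrow> A ** B \<in> H"
    "\<And>x. rotation_gauge \<sigma> L x \<in> H"
  shows "normalizer \<sigma> L \<in> loops_in H"
proof -
  have Lo: "L \<in> loops_in o31" and pos: "\<And>x. z_norm L x > 0" using L by (auto simp: regular_loops_def)
  let ?D = "rotation_gauge \<sigma> L"
  have D: "?D \<in> loops_in O31" by (rule rotation_gauge_loop[OF L])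
  have N: "unipotent_gauge (gauge ?D L) \<in> loops_in H_L"
    by (rule unipotent_gauge_loop[OF gauge_loop[OF D Lo]])
      (simp add: rotation_gauge_entries[OF L] pos \<sigma>_pos)
  show ?thesis
    unfolding normalizer_def
    by (rule loops_in_UNIV_range[OF loop_matrix_mult[OF loops_in_UNIV[OF D] loops_in_UNIV[OF N]]])
      (use H loops_inD(3)[OF N] in blast)
qed

end

interpretation cone_scale: scale_function "\<lambda>_. 1"
  by unfold_locales (auto intro: smooth_on_const)

interpretation sphere_scale: scale_function "\<lambda>r. r"
  by unfold_locales (auto intro: smooth_on_ident)

lemma span_\<hh>_basis:
  "\<hh>\<^sub>L \<subseteq> span \<hh>_basis" "\<hh>\<^sub>M \<subseteq> span (insert (o31_mat 1 0 0 0 0 0) \<hh>_basis)"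
proof -
  have eq: "o31_mat a 0 0 w1 w2 b = a *\<^sub>R o31_mat 1 0 0 0 0 0 + (w1 *\<^sub>R o31_mat 0 0 0 1 0 0 + w2 *\<^sub>R o31_mat 0 0 0 0 1 0 + b *\<^sub>R o31_mat 0 0 0 0 0 1)"
    for a w1 w2 b by (simp add: mat4_eq_iff forall_4)
  have "o31_mat a 0 0 w1 w2 b \<in> span (insert (o31_mat 1 0 0 0 0 0) \<hh>_basis)" for a w1 w2 b
    by (subst eq[of a w1 w2 b]) (intro span_add span_scale span_base; simp add: \<hh>_basis_def)
  then show "\<hh>\<^sub>M \<subseteq> span (insert (o31_mat 1 0 0 0 0 0) \<hh>_basis)" by (auto simp: \<hh>\<^sub>M_def)
  have eq: "o31_mat 0 0 0 w1 w2 b = w1 *\<^sub>R o31_mat 0 0 0 1 0 0 + w2 *\<^sub>R o31_mat 0 0 0 0 1 0 + b *\<^sub>R o31_mat 0 0 0 0 0 1"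
    for w1 w2 b by (simp add: mat4_eq_iff forall_4)
  have "o31_mat 0 0 0 w1 w2 b \<in> span \<hh>_basis" for w1 w2 b
    by (subst eq[of w1 w2 b]) (intro span_add span_scale span_base; simp add: \<hh>_basis_def)
  then show "\<hh>\<^sub>L \<subseteq> span \<hh>_basis" by (auto simp: \<hh>\<^sub>L_def)
qed

lemma annihilator_mono: "annihilator \<hh>\<^sub>M \<subseteq> annihilator \<hh>\<^sub>L"
  by (auto simp: annihilator_\<hh>\<^sub>L annihilator_\<hh>\<^sub>M)

interpretation cone: isotropy_reduction H_L \<hh>\<^sub>L \<hh>_basis K_L regular_loops "normalizer (\<lambda>_. 1)"
proof
  show "H_L \<subseteq> O31" by (rule H_L_O31)
  show "\<hh>\<^sub>L \<subseteq> o31" by (auto simp: \<hh>\<^sub>L_iff)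
  show "\<hh>_basis \<subseteq> o31" by (auto simp: \<hh>_basis_def o31_mat_in_o31)
  show "\<exists>g. gauge_path H_L X \<phi> g" if "X \<in> \<hh>_basis" "\<phi> \<in> loops_in UNIV" for X \<phi>
    by (rule gauge_path_H_L[OF that])
  show "normalizer (\<lambda>_. 1) L \<in> loops_in H_L" if L: "L \<in> regular_loops" for L
    by (rule cone_scale.normalizer_loop[OF L subset_refl H_L_mult])
      (use L cone_scale.z_norm_unit in \<open>auto simp: rotation_gauge_def regular_loops_def intro!: block_diag_H_L\<close>)
  show "pairing K P R = pairing K Q R" if K: "K \<in> K_L" and "adapted_gradient K_L \<hh>\<^sub>L h K P"
     "adapted_gradient K_L \<hh>\<^sub>L h K Q" "adapted_gradient K_L \<hh>\<^sub>L f K R" for h f K P Q R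
    by (rule pairing_unique_level[of K "\<lambda>x. K x $ 1 $ 2", OF _ _ subset_refl that(2-4)])
      (use K in \<open>auto simp: k0_level_iff\<close>)
  show "matrix_inv (g t) ** g' \<in> \<hh>\<^sub>L" if "open S" "t \<in> S" "\<And>s. s \<in> S \<Longrightarrow> g s \<in> H_L"
    "(g has_vector_derivative g') (at t)" for S t g g' by (rule H_L_tangent[OF that])
  show "matrix_inv g ** X ** g \<in> \<hh>\<^sub>L" if "g \<in> H_L" "X \<in> \<hh>\<^sub>L" for g X by (rule H_L_Ad[OF that])
  show "\<exists>Q. adapted_gradient K_L \<hh>\<^sub>L h K Q" if "h \<in> functionals K_L" "K \<in> K_L" for h K
    by (rule adapted_exists_L[OF that])
  show "smooth_family V (\<lambda>\<epsilon>. normalizer (\<lambda>_. 1) (\<gamma> \<epsilon>))" if "smooth_family V \<gamma>" "\<And>\<epsilon>. \<epsilon> \<in> V \<Longrightarrow> \<gamma> \<epsilon> \<in> regular_loops" for V \<gamma>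
    by (rule cone_scale.normalizer_family[OF that])
  show "gauge (normalizer (\<lambda>_. 1) L) L \<in> K_L" if "L \<in> regular_loops" for L
    by (rule cone_scale.normalizer_slice(1)[OF that])
  show "gauge (normalizer (\<lambda>_. 1) K) K = K" if "K \<in> K_L" for K
    by (rule cone_scale.normalizer_fixed[OF that]) simp
qed (rule span_\<hh>_basis(1) loop_open_regular_loops K_L_regular)+

interpretation sphere: isotropy_reduction H_M \<hh>\<^sub>M "insert (o31_mat 1 0 0 0 0 0) \<hh>_basis" K_M regular_loops "normalizer (\<lambda>r. r)"
proof
  show "H_M \<subseteq> O31" by (rule H_M_O31)
  show "\<hh>\<^sub>M \<subseteq> o31" by (auto simp: \<hh>\<^sub>M_iff)
  show "insert (o31_mat 1 0 0 0 0 0) \<hh>_basis \<subseteq> o31" by (auto simp: \<hh>_basis_def o31_mat_in_o31)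
  show "\<exists>g. gauge_path H_M X \<phi> g" if "X \<in> insert (o31_mat 1 0 0 0 0 0) \<hh>_basis" "\<phi> \<in> loops_in UNIV" for X \<phi>
    by (rule gauge_path_H_M[OF that])
  show "normalizer (\<lambda>r. r) L \<in> loops_in H_M" if L: "L \<in> regular_loops" for L
  proof (rule sphere_scale.normalizer_loop[OF L H_L_subset_H_M H_M_mult])
    have "z_norm L x > 0" for x using L by (simp add: regular_loops_def)
    then show "rotation_gauge (\<lambda>r. r) L x \<in> H_M" for x
      unfolding rotation_gauge_def
      by (intro block_diag_H_M sphere_scale.z_norm_unit less_imp_neq[symmetric])
  qed
  show "gauge (normalizer (\<lambda>r. r) L) L \<in> K_M" if L: "L \<in> regular_loops" for L
  proof -
    have "z_norm L x > 0" for x using L by (simp add: regular_loops_def)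
    then have "z_norm L x / z_norm L x = 1" for x by (metis divide_self less_irrefl)
    then show ?thesis
      using sphere_scale.normalizer_slice(1)[OF L]
      by (simp add: K_M_eq K_L1_def k0_level_iff sphere_scale.normalizer_slice(2)[OF L])
  qed
  show "gauge (normalizer (\<lambda>r. r) K) K = K" if "K \<in> K_M" for K
    by (rule sphere_scale.normalizer_fixed) (use that in \<open>auto simp: K_M_eq K_L1_def k0_level_iff\<close>)
  show "pairing K P R = pairing K Q R" if K: "K \<in> K_M" and "adapted_gradient K_M \<hh>\<^sub>M h K P"
     "adapted_gradient K_M \<hh>\<^sub>M h K Q" "adapted_gradient K_M \<hh>\<^sub>M f K R" for h f K P Q R
    by (rule pairing_unique_level[of K "\<lambda>_. 1", OF _ _ annihilator_mono that(2-4)])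
      (use K in \<open>auto simp: K_M_eq K_L1_def\<close>)
  show "K_M \<subseteq> regular_loops" using K_L_regular by (auto simp: K_M_eq K_L1_def k0_level_iff)
  show "matrix_inv (g t) ** g' \<in> \<hh>\<^sub>M" if "open S" "t \<in> S" "\<And>s. s \<in> S \<Longrightarrow> g s \<in> H_M"
    "(g has_vector_derivative g') (at t)" for S t g g' by (rule H_M_tangent[OF that])
  show "matrix_inv g ** X ** g \<in> \<hh>\<^sub>M" if "g \<in> H_M" "X \<in> \<hh>\<^sub>M" for g X by (rule H_M_Ad[OF that])
  show "\<exists>Q. adapted_gradient K_M \<hh>\<^sub>M h K Q" if "h \<in> functionals K_M" "K \<in> K_M" for h K
    by (rule adapted_exists_M[OF that])
  show "smooth_family V (\<lambda>\<epsilon>. normalizer (\<lambda>r. r) (\<gamma> \<epsilon>))" if "smooth_family V \<gamma>" "\<And>\<epsilon>. \<epsilon> \<in> V \<Longrightarrow> \<gamma> \<epsilon> \<in> regular_loops" for V \<gamma>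
    by (rule sphere_scale.normalizer_family[OF that])
qed (rule span_\<hh>_basis(2) loop_open_regular_loops)+

section \<open>The geometric Poisson brackets\<close>

lemma k0_level_subset: "k0_level c \<subseteq> K_L"
  by (auto simp: k0_level_def)

lemma functionals_mono: "h \<in> functionals T \<Longrightarrow> S \<subseteq> T \<Longrightarrow> h \<in> functionals S"
  unfolding functionals_def using has_variational_derivative_mono by blast

lemma functionals_cong: "h \<in> functionals S \<Longrightarrow> (\<And>L. L \<in> S \<Longrightarrow> h L = k L) \<Longrightarrow> k \<in> functionals S"
  unfolding functionals_def using has_variational_derivative_cong by blast

lemma adapted_gradient_restrict:
  assumes "adapted_gradient KK \<hh> h K Q" "k0_level c \<subseteq> KK" "annihilator \<hh> \<subseteq> annihilator \<hh>\<^sub>L"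
  shows "adapted_gradient (k0_level c) \<hh>\<^sub>L h K Q"
  using adapted_gradient_level[OF assms] unfolding adapted_gradient_def by blast

lemma adapted_gradient_cong:
  "adapted_gradient KK \<hh> h K Q \<Longrightarrow> (\<And>L. L \<in> KK \<Longrightarrow> h L = k L) \<Longrightarrow> adapted_gradient KK \<hh> k K Q"
  unfolding adapted_gradient_def using has_variational_derivative_cong by blast

lemma pairing_level:
  assumes K: "K \<in> k0_level c"
    and P: "adapted_gradient (k0_level c) \<hh>\<^sub>L h K P" and Q: "adapted_gradient (k0_level c) \<hh>\<^sub>L h K Q"
    and R: "adapted_gradient (k0_level c) \<hh>\<^sub>L f K R" and S: "adapted_gradient (k0_level c) \<hh>\<^sub>L f K S"
  shows "pairing K P R = pairing K Q S"
proof -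
  have Ko: "K \<in> loops_in o31" using K K_L_loop by (auto simp: k0_level_iff)
  note o = adapted_gradient_level(2)[OF _ order_refl order_refl]
  have "pairing K P R = pairing K Q R" by (rule pairing_unique_level[OF K order_refl order_refl P Q R])
  also have "\<dots> = - pairing K R Q" by (rule pairing_antisym[OF Ko o[OF R] o[OF Q]])
  also have "pairing K R Q = pairing K S Q" by (rule pairing_unique_level[OF K order_refl order_refl R S Q])
  also have "- pairing K S Q = pairing K Q S" using pairing_antisym[OF Ko o[OF S] o[OF Q]] by simp
  finally show ?thesis .
qed

lemma bracket_L_level:
  assumes h: "h \<in> functionals K_L" and f: "f \<in> functionals K_L" and K: "K \<in> k0_level c"
    and Q: "adapted_gradient (k0_level c) \<hh>\<^sub>L h K Q" and R: "adapted_gradient (k0_level c) \<hh>\<^sub>L f K R"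
  shows "bracket_L h f K = pairing K Q R"
proof -
  have KL: "K \<in> K_L" using K k0_level_subset by auto
  obtain P S where P: "adapted_gradient K_L \<hh>\<^sub>L h K P" and S: "adapted_gradient K_L \<hh>\<^sub>L f K S"
    using adapted_exists_L h f KL by blast
  have "bracket_L h f K = pairing K P S"
    unfolding bracket_L_def by (rule cone.geometric_bracket_eq[OF h f KL P S])
  also have "\<dots> = pairing K Q R"
    by (rule pairing_level[OF K adapted_gradient_restrict[OF P k0_level_subset order_refl] Q
          adapted_gradient_restrict[OF S k0_level_subset order_refl] R])
  finally show ?thesis .
qed

lemma bracket_M_level:
  assumes h: "h \<in> functionals K_L1" and f: "f \<in> functionals K_L1" and K: "K \<in> K_L1"
    and Q: "adapted_gradient K_L1 \<hh>\<^sub>L h K Q" and R: "adapted_gradient K_L1 \<hh>\<^sub>L f K R"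
  shows "bracket_M h f K = pairing K Q R"
proof -
  note [simp] = K_M_eq
  obtain P S where P: "adapted_gradient K_M \<hh>\<^sub>M h K P" and S: "adapted_gradient K_M \<hh>\<^sub>M f K S"
    using adapted_exists_M h f K by force
  have sub: "k0_level (\<lambda>_. 1) \<subseteq> K_M" by (simp add: K_L1_def)
  have "bracket_M h f K = pairing K P S"
    unfolding bracket_M_def by (rule sphere.geometric_bracket_eq[OF _ _ _ P S]) (use h f K in simp_all)
  also have "\<dots> = pairing K Q R"
    by (rule pairing_level[OF K[unfolded K_L1_def] adapted_gradient_restrict[OF P sub annihilator_mono] Q[unfolded K_L1_def]
          adapted_gradient_restrict[OF S sub annihilator_mono] R[unfolded K_L1_def]])
  finally show ?thesis .
qed

section \<open>The level sets of \<open>k\<^sub>0\<close>\<close>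

definition set_k0 :: "(real \<Rightarrow> real) \<Rightarrow> loop \<Rightarrow> loop" where
  "set_k0 c K = (\<lambda>x. K_mat (c x) (K x $ 2 $ 1) (K x $ 3 $ 1))"

lemma set_k0_level:
  assumes "c \<in> loops_in {0<..}" "K \<in> K_L"
  shows "set_k0 c K \<in> k0_level c"
  unfolding k0_level_iff set_k0_def using K_LI[OF assms(1) loop_entry loop_entry] K_L_loop[OF assms(2)]
  by (auto simp: K_mat_o31_mat)

lemma set_k0_fixed:
  assumes "K \<in> k0_level c"
  shows "set_k0 c K = K"
proof
  fix x
  obtain k0 k1 k2 where "K x = o31_mat 0 k0 0 k1 k2 0" using assms by (auto simp: k0_level_def K_L_def K_mat_o31_mat)
  moreover have "K x $ 1 $ 2 = c x" using assms by (simp add: k0_level_def)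
  ultimately show "set_k0 c K x = K x" by (simp add: set_k0_def K_mat_o31_mat)
qed

text \<open>A functional on a level set is extended so that it ignores \<open>k\<^sub>0\<close>. The gradient of the extension keeps only
  the \<open>z\<close>-part.\<close>

lemma level_extension:
  assumes c: "c \<in> loops_in {0<..}" and h: "h \<in> functionals (k0_level c)"
  shows "(\<lambda>K. h (set_k0 c K)) \<in> functionals K_L"
  unfolding functionals_def
proof (rule CollectI, rule ballI)
  fix K assume K: "K \<in> K_L"
  obtain P where P: "has_variational_derivative (k0_level c) h (set_k0 c K) P"
    using h set_k0_level[OF c K] unfolding functionals_def by blast
  note Po = has_variational_derivativeD(1)[OF P]
  define Q where "Q = (\<lambda>x. o31_mat 0 (P x $ 1 $ 2) (P x $ 1 $ 3) 0 0 0)"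
  have Q: "Q \<in> loops_in o31" unfolding Q_def by (intro loop_o31_mat loop_entry[OF Po] loop_const UNIV_I)
  have "has_variational_derivative K_L (\<lambda>K. h (set_k0 c K)) K Q"
  proof (rule has_variational_derivativeI[OF Q])
    fix \<gamma> assume v: "variation K_L \<gamma>" and \<gamma>0: "\<gamma> 0 = K"
    from variationE[OF v] obtain d where d: "d > 0" and \<gamma>: "smooth_family {-d<..<d} \<gamma>"
      and \<gamma>K: "\<And>\<epsilon>. \<epsilon> \<in> {-d<..<d} \<Longrightarrow> \<gamma> \<epsilon> \<in> K_L" by blast
    have V0: "0 \<in> {-d<..<d}" using d by auto
    let ?P = "\<lambda>\<epsilon>. set_k0 c (\<gamma> \<epsilon>)"
    have e: "smooth_family {-d<..<d} (\<lambda>\<epsilon> x. \<gamma> \<epsilon> x $ i $ j)" for i j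
      using \<gamma> smooth_family_mat4_iff smooth_family_open by blast
    have P': "smooth_family {-d<..<d} ?P"
      unfolding smooth_family_mat4_iff[OF open_greaterThanLessThan] set_k0_def K_mat_o31_mat
      by (simp add: forall_4 e smooth_family_const smooth_family_loop loops_inD(1)[OF c])
    have v': "variation (k0_level c) ?P"
      by (rule variationI[OF P' V0]) (rule set_k0_level[OF c \<gamma>K])
    have v'': "variation K_L ?P" by (rule variation_mono[OF k0_level_subset v'])
    have entry: "dx (\<lambda>\<epsilon>. F \<epsilon> x) 0 $ i $ j = dx (\<lambda>\<epsilon>. F \<epsilon> x $ i $ j) 0" if "smooth_family {-d<..<d} F"
      for F :: "real \<Rightarrow> loop" and x i j
      using dx_bounded_linear[OF bounded_linear_entry smooth_family_has_dx(2)[OF that V0]] by metis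
    have "trace (P x ** dx (\<lambda>\<epsilon>. ?P \<epsilon> x) 0) = trace (Q x ** dx (\<lambda>\<epsilon>. \<gamma> \<epsilon> x) 0)" for x
      unfolding trace_tangent[OF v'' loops_inD(3)[OF Po]] trace_tangent[OF v loops_inD(3)[OF Q]]
        k0_level_variation(5)[OF v'' v'] entry[OF P'] entry[OF \<gamma>]
      by (simp add: Q_def set_k0_def K_mat_o31_mat dx_eqI[OF has_vector_derivative_const])
    then show "((\<lambda>\<epsilon>. h (set_k0 c (\<gamma> \<epsilon>))) has_real_derivative
        circle_integral (\<lambda>x. trace (Q x ** dx (\<lambda>\<epsilon>. \<gamma> \<epsilon> x) 0))) (at 0)"
      using has_variational_derivativeD(2)[OF P v'] \<gamma>0 by simp
  qed
  then show "\<exists>Q. has_variational_derivative K_L (\<lambda>K. h (set_k0 c K)) K Q" by blast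
qed

lemma level_adapted_exists:
  assumes c: "c \<in> loops_in {0<..}" and h: "h \<in> functionals (k0_level c)" and K: "K \<in> k0_level c"
  shows "\<exists>Q. adapted_gradient (k0_level c) \<hh>\<^sub>L h K Q"
proof -
  obtain Q where "adapted_gradient K_L \<hh>\<^sub>L (\<lambda>K. h (set_k0 c K)) K Q"
    using adapted_exists_L[OF level_extension[OF c h]] K k0_level_subset by blast
  from adapted_gradient_restrict[OF this k0_level_subset order_refl]
  have "adapted_gradient (k0_level c) \<hh>\<^sub>L h K Q"
    by (rule adapted_gradient_cong) (simp add: set_k0_fixed)
  then show ?thesis by blast
qed

text \<open>Extensions to \<open>\<K>\<^sub>L\<close> of functionals on the level set may differ in their dependence on \<open>k\<^sub>0\<close>, hence in \<open>w\<^sub>1\<close>,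
  which the pairing of adapted gradients ignores.\<close>

lemma restricted_bracket_level:
  assumes c: "c \<in> loops_in {0<..}" and h: "h \<in> functionals (k0_level c)" and f: "f \<in> functionals (k0_level c)"
    and K: "K \<in> k0_level c"
    and Q: "adapted_gradient (k0_level c) \<hh>\<^sub>L h K Q" and R: "adapted_gradient (k0_level c) \<hh>\<^sub>L f K R"
  shows "restricted_bracket K_L bracket_L (k0_level c) h f K = pairing K Q R"
proof -
  have eq: "bracket_L h' f' K = pairing K Q R"
    if "h' \<in> functionals K_L" "f' \<in> functionals K_L" "\<And>L. L \<in> k0_level c \<Longrightarrow> h' L = h L \<and> f' L = f L" for h' f'
    by (rule bracket_L_level[OF that(1,2) K adapted_gradient_cong[OF Q] adapted_gradient_cong[OF R]])
      (simp_all add: that(3))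
  show ?thesis
    unfolding restricted_bracket_def
  proof (rule the_equality)
    let ?h = "\<lambda>K. h (set_k0 c K)" and ?f = "\<lambda>K. f (set_k0 c K)"
    have "?h \<in> functionals K_L" "?f \<in> functionals K_L" "\<And>L. L \<in> k0_level c \<Longrightarrow> ?h L = h L \<and> ?f L = f L"
      using level_extension[OF c h] level_extension[OF c f] by (auto simp: set_k0_fixed)
    with eq[OF this] show "\<exists>h'\<in>functionals K_L. \<exists>f'\<in>functionals K_L.
        (\<forall>L\<in>k0_level c. h' L = h L \<and> f' L = f L) \<and> pairing K Q R = bracket_L h' f' K"
      by (intro bexI[of _ ?h] bexI[of _ ?f]) auto
  qed (use eq in blast)
qed

theorem k0_level_poisson_submanifold:
  assumes c: "c \<in> loops_in {0<..}"
  shows "poisson_submanifold K_L bracket_L (k0_level c)"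
  unfolding poisson_submanifold_def poisson_map_def
proof (intro conjI ballI allI impI)
  show "k0_level c \<subseteq> K_L" by (rule k0_level_subset)
  show "\<exists>h'\<in>functionals K_L. \<forall>L\<in>k0_level c. h' L = h L" if "h \<in> functionals (k0_level c)" for h
    using level_extension[OF c that] by (intro bexI[of _ "\<lambda>K. h (set_k0 c K)"]) (auto simp: set_k0_fixed)
  show "(\<lambda>L. L) ` k0_level c \<subseteq> K_L" using k0_level_subset by auto
  show "variation K_L (\<lambda>\<epsilon>. \<gamma> \<epsilon>)" if "variation (k0_level c) \<gamma>" for \<gamma>
    using variation_mono[OF k0_level_subset that] .
  show "f \<circ> (\<lambda>L. L) \<in> functionals (k0_level c)" if "f \<in> functionals K_L" for f
    using functionals_mono[OF that k0_level_subset] by (simp add: comp_def)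
  show "restricted_bracket K_L bracket_L (k0_level c) (h \<circ> (\<lambda>L. L)) (f \<circ> (\<lambda>L. L)) K = bracket_L h f K"
    if hf: "h \<in> functionals K_L" "f \<in> functionals K_L" and K: "K \<in> k0_level c" for h f K
  proof -
    have l: "h \<in> functionals (k0_level c)" "f \<in> functionals (k0_level c)"
      using functionals_mono[OF _ k0_level_subset] hf by auto
    obtain Q R where "adapted_gradient (k0_level c) \<hh>\<^sub>L h K Q" "adapted_gradient (k0_level c) \<hh>\<^sub>L f K R"
      using level_adapted_exists[OF c _ K] l by blast
    from restricted_bracket_level[OF c l K this] bracket_L_level[OF hf K this]
    show ?thesis by (simp add: comp_def)
  qed
qed

lemma k0_level_partition: "partition_on K_L (k0_level ` loops_in {0<..})"
proof (rule partition_onI)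
  show "\<Union> (k0_level ` loops_in {0<..}) = K_L"
  proof (rule equalityI)
    show "K_L \<subseteq> \<Union> (k0_level ` loops_in {0<..})"
    proof
      fix K assume K: "K \<in> K_L"
      have "(\<lambda>x. K x $ 1 $ 2) \<in> loops_in {0<..}"
        by (rule loops_in_UNIV_range[OF loop_entry[OF K_L_loop[OF K]]]) (use K K_L_iff in auto)
      moreover have "K \<in> k0_level (\<lambda>x. K x $ 1 $ 2)" using K by (simp add: k0_level_iff)
      ultimately show "K \<in> \<Union> (k0_level ` loops_in {0<..})" by blast
    qed
    show "\<Union> (k0_level ` loops_in {0<..}) \<subseteq> K_L" using k0_level_subset by blast
  qed
  show "disjnt p q" if "p \<in> k0_level ` loops_in {0<..}" "q \<in> k0_level ` loops_in {0<..}" "p \<noteq> q" for p q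
  proof -
    from that obtain c d where cd: "p = k0_level c" "q = k0_level d" "c \<noteq> d" by blast
    have "c = d" if "K \<in> k0_level c" "K \<in> k0_level d" for K
      using that by (auto simp: k0_level_iff fun_eq_iff)
    then show ?thesis using cd by (auto simp: disjnt_iff)
  qed
  have "p \<noteq> {}" if p: "p \<in> k0_level ` loops_in {0<..}" for p
  proof -
    from p obtain c where c: "c \<in> loops_in {0<..}" "p = k0_level c" by blast
    have "(\<lambda>x. K_mat (c x) 0 0) \<in> K_L" by (rule K_LI[OF c(1)]) (auto intro: loop_const)
    then have "(\<lambda>x. K_mat (c x) 0 0) \<in> p" using c by (simp add: k0_level_iff K_mat_o31_mat)
    then show ?thesis by blast
  qed
  then show "{} \<notin> k0_level ` loops_in {0<..}" by blast
qed

section \<open>Comparison of the two brackets\<close>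

lemma one_loop: "(\<lambda>_. 1) \<in> loops_in {0::real<..}"
  by (rule loop_const) simp

text \<open>Both brackets are the pairing of adapted gradients, and at \<open>k\<^sub>0 = 1\<close> a gradient adapted to \<open>\<hh>\<^sub>M\<close> is also
  adapted to \<open>\<hh>\<^sub>L\<close>. The functionals on the two sides only need to agree on the common space of invariants,
  since the inverse map is arbitrary outside it.\<close>

lemma bracket_L1_eq_bracket_M:
  assumes h: "h \<in> functionals K_L1" and f: "f \<in> functionals K_L1" and K: "K \<in> K_L1"
    and h': "\<And>L. L \<in> K_L1 \<Longrightarrow> h' L = h L" and f': "\<And>L. L \<in> K_L1 \<Longrightarrow> f' L = f L"
  shows "bracket_L1 h f K = bracket_M h' f' K"
proof -
  obtain Q R where QR: "adapted_gradient K_L1 \<hh>\<^sub>L h K Q" "adapted_gradient K_L1 \<hh>\<^sub>L f K R"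
    using level_adapted_exists[OF one_loop] h f K unfolding K_L1_def by blast
  have QR': "adapted_gradient K_L1 \<hh>\<^sub>L h' K Q" "adapted_gradient K_L1 \<hh>\<^sub>L f' K R"
    by (rule adapted_gradient_cong[OF QR(1)] adapted_gradient_cong[OF QR(2)]; simp add: h' f')+
  have "bracket_L1 h f K = pairing K Q R"
    using restricted_bracket_level[OF one_loop, of h f K Q R] h f K QR
    unfolding bracket_L1_def K_L1_def by simp
  moreover have "h' \<in> functionals K_L1" "f' \<in> functionals K_L1"
    by (rule functionals_cong[OF h] functionals_cong[OF f]; simp add: h' f')+
  ultimately show ?thesis using bracket_M_level[OF _ _ K QR'] by simp
qed

lemma variation_cong:
  assumes v: "variation S \<gamma>" and "\<And>L. L \<in> S \<Longrightarrow> \<Phi> L = L"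
  shows "variation S (\<lambda>\<epsilon>. \<Phi> (\<gamma> \<epsilon>))"
proof -
  from variationE[OF v] obtain d where d: "d > 0" and \<gamma>: "smooth_family {-d<..<d} \<gamma>"
    and S: "\<And>\<epsilon>. \<epsilon> \<in> {-d<..<d} \<Longrightarrow> \<gamma> \<epsilon> \<in> S" by blast
  have "smooth_family {-d<..<d} (\<lambda>\<epsilon>. \<Phi> (\<gamma> \<epsilon>))"
    using smooth_family_cong[of "{-d<..<d}" "\<lambda>\<epsilon>. \<Phi> (\<gamma> \<epsilon>)" \<gamma>] S assms(2) \<gamma> by simp
  then show ?thesis
    by (rule variationI) (use d S assms(2) in auto)
qed

lemma identity_poisson_map:
  assumes \<Phi>: "\<And>K. K \<in> K_L1 \<Longrightarrow> \<Phi> K = K"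
  shows "poisson_map K_L1 bracket_L1 K_M bracket_M \<Phi>" "poisson_map K_M bracket_M K_L1 bracket_L1 \<Phi>"
proof -
  have f: "f \<circ> \<Phi> \<in> functionals K_L1" if "f \<in> functionals K_L1" for f
    by (rule functionals_cong[OF that]) (simp add: \<Phi>)
  have v: "variation K_L1 (\<lambda>\<epsilon>. \<Phi> (\<gamma> \<epsilon>))" if "variation K_L1 \<gamma>" for \<gamma>
    by (rule variation_cong[OF that \<Phi>])
  have b: "bracket_L1 (h \<circ> \<Phi>) (f \<circ> \<Phi>) K = bracket_M h f (\<Phi> K)" "bracket_M (h \<circ> \<Phi>) (f \<circ> \<Phi>) K = bracket_L1 h f (\<Phi> K)"
    if "h \<in> functionals K_L1" "f \<in> functionals K_L1" "K \<in> K_L1" for h f K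
    using bracket_L1_eq_bracket_M[OF f[OF that(1)] f[OF that(2)] that(3), of h f]
      bracket_L1_eq_bracket_M[OF that, of "h \<circ> \<Phi>" "f \<circ> \<Phi>"] that(3) by (simp_all add: \<Phi>)
  show "poisson_map K_L1 bracket_L1 K_M bracket_M \<Phi>"
    unfolding poisson_map_def K_M_eq using \<Phi> f v b by auto
  show "poisson_map K_M bracket_M K_L1 bracket_L1 \<Phi>"
    unfolding poisson_map_def K_M_eq using \<Phi> f v b by auto
qed

lemma identity_poisson_equivalence: "poisson_equivalence K_L1 bracket_L1 K_M bracket_M (\<lambda>K. K)"
proof -
  have "the_inv_into K_L1 (\<lambda>K. K) K = K" if "K \<in> K_L1" for K
    by (rule the_inv_into_f_f[of "\<lambda>K. K"]) (use that in \<open>auto simp: inj_on_def\<close>)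
  then show ?thesis
    unfolding poisson_equivalence_def
    using identity_poisson_map(1)[of "\<lambda>K. K"] identity_poisson_map(2)[of "the_inv_into K_L1 (\<lambda>K. K)"]
    by (simp add: K_M_eq bij_betw_def inj_on_def)
qed

section \<open>Moving frames\<close>

lemma inner_J_coords: "inner_J u v = - (u$1 * v$4) + u$2 * v$2 + u$3 * v$3 - u$4 * v$1"
  by (simp add: inner_J_def inner_vec_def sum_4 matrix_vector_mult_4)

lemma bounded_bilinear_inner_J: "bounded_bilinear inner_J"
  unfolding bilinear_conv_bounded_bilinear[symmetric] bilinear_def
  by (auto intro!: linearI simp: inner_J_coords algebra_simps)

lemma inner_J_transpose: "inner_J (A *v u) (A *v v) = u \<bullet> ((transpose A ** J ** A) *v v)"
proof -
  have e: "A *v u = u v* transpose A" by (metis transpose_matrix_vector transpose_transpose)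
  show ?thesis unfolding inner_J_def e dot_lmul_matrix by (simp only: matrix_vector_mul_assoc matrix_mul_assoc)
qed

lemma inner_J_O31: "\<Theta> \<in> O31 \<Longrightarrow> inner_J (\<Theta> *v u) (\<Theta> *v v) = inner_J u v"
  unfolding inner_J_transpose by (simp add: O31_iff inner_J_def)

lemma bounded_linear_mult_vec: "bounded_linear ((*v) (A :: mat4))"
  by (rule matrix_vector_mul_bounded_linear)

lemma bounded_linear_mat_vec_left: "bounded_linear (\<lambda>A :: mat4. A *v v)"
  unfolding linear_conv_bounded_linear[symmetric]
  by (auto intro!: linearI simp: vec_eq_iff matrix_vector_mult_4 algebra_simps)

lemma dx_mult_vec:
  assumes "smooth_on I u" "x \<in> I"
  shows "dx (\<lambda>y. (A :: mat4) *v u y) x = A *v dx u x" "dx (dx (\<lambda>y. A *v u y)) x = A *v dx (dx u) x"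
proof -
  have *: "dx (\<lambda>y. A *v f y) x = A *v dx f x" if "smooth_on I f" "x \<in> I" for f x
    by (rule dx_bounded_linear[OF bounded_linear_mult_vec smooth_on_has_vector_derivative[OF that]])
  show "dx (\<lambda>y. A *v u y) x = A *v dx u x" by (rule *[OF assms])
  have "dx (dx (\<lambda>y. A *v u y)) x = dx (\<lambda>y. A *v dx u y) x"
    by (rule dx_cong[OF smooth_on_open[OF assms(1)] assms(2)]) (rule *[OF assms(1)])
  then show "dx (dx (\<lambda>y. A *v u y)) x = A *v dx (dx u) x"
    using *[OF smooth_on_dx[OF assms(1)] assms(2)] by simp
qed

lemma dx_vec_nth:
  assumes "smooth_on I (f :: real \<Rightarrow> real^'n)" "x \<in> I"
  shows "dx f x $ i = dx (\<lambda>y. f y $ i) x" "dx (dx f) x $ i = dx (dx (\<lambda>y. f y $ i)) x"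
proof -
  have *: "dx f x $ i = dx (\<lambda>y. f y $ i) x" if "smooth_on I f" "x \<in> I" for f :: "real \<Rightarrow> real^'n" and x
    using dx_bounded_linear[OF bounded_linear_vec_nth smooth_on_has_vector_derivative[OF that]] by metis
  show "dx f x $ i = dx (\<lambda>y. f y $ i) x" by (rule *[OF assms])
  have "dx (dx f) x $ i = dx (\<lambda>y. dx f y $ i) x" by (rule *[OF smooth_on_dx[OF assms(1)] assms(2)])
  also have "\<dots> = dx (dx (\<lambda>y. f y $ i)) x"
    by (rule dx_cong[OF smooth_on_open[OF assms(1)] assms(2)]) (rule *[OF assms(1)])
  finally show "dx (dx f) x $ i = dx (dx (\<lambda>y. f y $ i)) x" .
qed

lemma dx_quotient:
  fixes a b :: "real \<Rightarrow> real"
  assumes a: "smooth_on S a" and b: "smooth_on S b" "\<And>y. y \<in> S \<Longrightarrow> b y > 0" and x: "x \<in> S"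
  shows "dx (\<lambda>y. a y / b y) x = (dx a x * b x - a x * dx b x) / (b x * b x)"
    "a x = 0 \<Longrightarrow> dx (dx (\<lambda>y. a y / b y)) x = dx (dx a) x / b x - 2 * dx a x * dx b x / (b x * b x)"
proof -
  have D: "(f has_real_derivative dx f y) (at y)" if "smooth_on S f" "y \<in> S" for f y
    using smooth_on_has_vector_derivative[OF that] by (simp add: has_real_derivative_iff_has_vector_derivative)
  have eqI: "dx f y = D'" if "(f has_real_derivative D') (at y)" for f D' and y :: real
    by (rule dx_eqI) (use that in \<open>simp add: has_real_derivative_iff_has_vector_derivative\<close>)
  have 1: "dx (\<lambda>y. a y / b y) y = (dx a y * b y - a y * dx b y) / (b y * b y)" if y: "y \<in> S" for y
    by (rule eqI) (use DERIV_divide[OF D[OF a y] D[OF b(1) y]] b(2)[OF y] in simp)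
  show "dx (\<lambda>y. a y / b y) x = (dx a x * b x - a x * dx b x) / (b x * b x)" by (rule 1[OF x])
  assume 0: "a x = 0"
  have "dx (dx (\<lambda>y. a y / b y)) x = dx (\<lambda>y. (dx a y * b y - a y * dx b y) / (b y * b y)) x"
    by (rule dx_cong[OF smooth_on_open[OF a] x]) (rule 1)
  also have "\<dots> = ((dx (dx a) x * b x - a x * dx (dx b) x) * (b x * b x)
      - (dx a x * b x - a x * dx b x) * (2 * b x * dx b x)) / ((b x * b x) * (b x * b x))"
  proof (rule eqI, rule DERIV_divide)
    note d = D[OF a x] D[OF b(1) x] D[OF smooth_on_dx[OF a] x] D[OF smooth_on_dx[OF b(1)] x]
    show "((\<lambda>y. dx a y * b y - a y * dx b y) has_real_derivative dx (dx a) x * b x - a x * dx (dx b) x) (at x)"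
      by (auto intro!: derivative_eq_intros d)
    show "((\<lambda>y. b y * b y) has_real_derivative 2 * b x * dx b x) (at x)"
      by (auto intro!: derivative_eq_intros d)
  qed (use b(2)[OF x] in simp)
  also have "\<dots> = dx (dx a) x / b x - 2 * dx a x * dx b x / (b x * b x)"
    using b(2)[OF x] 0 by (simp add: field_simps)
  finally show "dx (dx (\<lambda>y. a y / b y)) x = dx (dx a) x / b x - 2 * dx a x * dx b x / (b x * b x)" .
qed

lemma smooth_on_Proj:
  assumes "smooth_on S U" "\<And>y. y \<in> S \<Longrightarrow> U y $ 4 > 0"
  shows "smooth_on S (\<lambda>y. Proj (U y))"
proof -
  have e: "smooth_on S (\<lambda>y. U y $ i)" for i
    using smooth_on_vec_iff[OF smooth_on_open[OF assms(1)]] assms(1) by blast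
  show ?thesis
    unfolding smooth_on_vec_iff[OF smooth_on_open[OF assms(1)]]
    by (simp add: forall_2 Proj_def smooth_on_divide e assms(2))
qed

lemma dx_Proj:
  assumes U: "smooth_on S U" "\<And>y. y \<in> S \<Longrightarrow> U y $ 4 > 0" and x: "x \<in> S"
  defines "f \<equiv> \<lambda>y. Proj (U y)"
  shows "dx f x $ 1 = (dx U x $ 2 * U x $ 4 - U x $ 2 * dx U x $ 4) / (U x $ 4 * U x $ 4)"
    "dx f x $ 2 = (dx U x $ 3 * U x $ 4 - U x $ 3 * dx U x $ 4) / (U x $ 4 * U x $ 4)"
    "U x $ 2 = 0 \<Longrightarrow> dx (dx f) x $ 1 = dx (dx U) x $ 2 / U x $ 4 - 2 * dx U x $ 2 * dx U x $ 4 / (U x $ 4 * U x $ 4)"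
    "U x $ 3 = 0 \<Longrightarrow> dx (dx f) x $ 2 = dx (dx U) x $ 3 / U x $ 4 - 2 * dx U x $ 3 * dx U x $ 4 / (U x $ 4 * U x $ 4)"
proof -
  have e: "smooth_on S (\<lambda>y. U y $ i)" for i
    using smooth_on_vec_iff[OF smooth_on_open[OF U(1)]] U(1) by blast
  have f: "smooth_on S f" unfolding f_def by (rule smooth_on_Proj[OF U])
  have f12: "(\<lambda>y. f y $ 1) = (\<lambda>y. U y $ 2 / U y $ 4)" "(\<lambda>y. f y $ 2) = (\<lambda>y. U y $ 3 / U y $ 4)"
    by (auto simp: f_def Proj_def)
  note q = dx_quotient[OF e e[of 4] U(2) x]
  show "dx f x $ 1 = (dx U x $ 2 * U x $ 4 - U x $ 2 * dx U x $ 4) / (U x $ 4 * U x $ 4)"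
    "dx f x $ 2 = (dx U x $ 3 * U x $ 4 - U x $ 3 * dx U x $ 4) / (U x $ 4 * U x $ 4)"
    "U x $ 2 = 0 \<Longrightarrow> dx (dx f) x $ 1 = dx (dx U) x $ 2 / U x $ 4 - 2 * dx U x $ 2 * dx U x $ 4 / (U x $ 4 * U x $ 4)"
    "U x $ 3 = 0 \<Longrightarrow> dx (dx f) x $ 2 = dx (dx U) x $ 3 / U x $ 4 - 2 * dx U x $ 3 * dx U x $ 4 / (U x $ 4 * U x $ 4)"
    unfolding dx_vec_nth[OF f x] dx_vec_nth[OF U(1) x] f12 by (rule q; assumption)+
qed

lemma cone_multiple_Lift:
  assumes "u \<in> light_cone" "u $ 4 > 0"
  shows "u = (u $ 4) *\<^sub>R Lift (Proj u)"
proof -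
  have "(u$2)\<^sup>2 + (u$3)\<^sup>2 = 2 * u$1 * u$4"
    using assms(1) by (simp add: light_cone_def inner_J_coords power2_eq_square algebra_simps)
  then have "u$4 * (((u$2 / u$4)\<^sup>2 + (u$3 / u$4)\<^sup>2) / 2) = u$1"
    using assms(2) by (simp add: power_divide add_divide_distrib[symmetric]) (simp add: power2_eq_square)
  then show ?thesis
    using assms(2) by (simp add: vec_eq_iff forall_4 Lift_def norm_real2 Proj_def)
qed

lemma conf_act_Proj:
  assumes "u \<in> light_cone" "u $ 4 > 0"
  shows "conf_act g (Proj u) = Proj (g *v u)" "conf_finite g (Proj u) \<longleftrightarrow> (g *v u) $ 4 \<noteq> 0"
proof -
  have "g *v u = (u $ 4) *\<^sub>R (g *v Lift (Proj u))"
    using cone_multiple_Lift[OF assms] by (metis scaleR_matrix_vector)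
  then show "conf_act g (Proj u) = Proj (g *v u)" "conf_finite g (Proj u) \<longleftrightarrow> (g *v u) $ 4 \<noteq> 0"
    using assms(2) by (auto simp: conf_act_def conf_finite_def Proj_def)
qed

text \<open>Differentiate \<open>\<langle>u, u\<rangle> = 0\<close> twice and \<open>\<langle>u', u'\<rangle> = 1\<close> once.\<close>

lemma arc_length_relations:
  assumes u: "cone_curve I u" and s: "arc_length I u" and x: "x \<in> I"
  shows "inner_J (u x) (u x) = 0" "inner_J (u x) (dx u x) = 0" "inner_J (dx u x) (dx u x) = 1"
    "inner_J (u x) (dx (dx u) x) = -1" "inner_J (dx u x) (dx (dx u) x) = 0"
proof -
  have sm: "smooth_on I u" using u by (simp add: cone_curve_def)
  note I = smooth_on_open[OF sm]
  have 0: "inner_J (u y) (u y) = 0" if "y \<in> I" for y using u that by (auto simp: cone_curve_def light_cone_def)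
  have 1: "inner_J (dx u y) (dx u y) = 1" if "y \<in> I" for y
    using s that by (simp add: arc_length_def norm_J_def)
  have sym: "inner_J v w = inner_J w v" for v w by (simp add: inner_J_coords algebra_simps)
  have d: "inner_J (f y) (dx g y) + inner_J (dx f y) (g y) = 0"
    if "smooth_on I f" "smooth_on I g" "\<And>z. z \<in> I \<Longrightarrow> inner_J (f z) (g z) = c" "y \<in> I" for f g c y
  proof -
    have "dx (\<lambda>z. inner_J (f z) (g z)) y = inner_J (f y) (dx g y) + inner_J (dx f y) (g y)"
      by (rule dx_eqI)
        (intro bounded_bilinear.has_vector_derivative[OF bounded_bilinear_inner_J] smooth_on_has_vector_derivative[OF that(1,4)] smooth_on_has_vector_derivative[OF that(2,4)])
    moreover have "dx (\<lambda>z. inner_J (f z) (g z)) y = dx (\<lambda>z. c) y" by (rule dx_cong[OF I that(4,3)])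
    ultimately show ?thesis by (simp add: dx_eqI[OF has_vector_derivative_const])
  qed
  have 2: "inner_J (u y) (dx u y) = 0" if "y \<in> I" for y
    using d[OF sm sm 0 that] sym[of "dx u y" "u y"] by simp
  show "inner_J (u x) (u x) = 0" "inner_J (u x) (dx u x) = 0" "inner_J (dx u x) (dx u x) = 1" using 0 1 2 x by auto
  show "inner_J (u x) (dx (dx u) x) = -1" using d[OF sm smooth_on_dx[OF sm] 2 x] 1[OF x] by simp
  show "inner_J (dx u x) (dx (dx u) x) = 0"
    using d[OF smooth_on_dx[OF sm] smooth_on_dx[OF sm] 1 x] sym[of "dx (dx u) x"] by simp
qed

lemma N_plus_nth [simp]:
  "N_plus v $ 1 $ 1 = 1" "N_plus v $ 1 $ 2 = v$1" "N_plus v $ 1 $ 3 = v$2" "N_plus v $ 1 $ 4 = ((v$1)\<^sup>2 + (v$2)\<^sup>2) / 2"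
  "N_plus v $ 2 $ 1 = 0" "N_plus v $ 2 $ 2 = 1" "N_plus v $ 2 $ 3 = 0" "N_plus v $ 2 $ 4 = v$1"
  "N_plus v $ 3 $ 1 = 0" "N_plus v $ 3 $ 2 = 0" "N_plus v $ 3 $ 3 = 1" "N_plus v $ 3 $ 4 = v$2"
  "N_plus v $ 4 $ 1 = 0" "N_plus v $ 4 $ 2 = 0" "N_plus v $ 4 $ 3 = 0" "N_plus v $ 4 $ 4 = 1"
  by (simp_all add: N_plus_def norm_real2)

lemma N_plus_O31: "N_plus v \<in> O31"
  by (simp add: O31_iff mat4_eq_iff forall_4 matrix_mult_4 transpose_def power2_eq_square field_simps)

lemma rotation_matrix_rot:
  assumes "rotation_matrix (A :: real^2^2)"
  obtains c s where "A = rot c s" "c\<^sup>2 + s\<^sup>2 = 1"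
proof -
  let ?a = "A$1$1" and ?b = "A$1$2" and ?c = "A$2$1" and ?d = "A$2$2"
  have "transpose A ** A = mat 1" "det A = 1"
    using assms by (auto simp: rotation_matrix_def orthogonal_matrix_def)
  then have e: "?a * ?a + ?c * ?c = 1" "?b * ?b + ?d * ?d = 1" "?a * ?d - ?b * ?c = 1"
    by (auto simp: vec_eq_iff forall_2 matrix_matrix_mult_def sum_2 transpose_def mat_def det_2)
  have "(?a - ?d) * (?a - ?d) + (?b + ?c) * (?b + ?c) = 0" using e by algebra
  then have "?d = ?a" "?b = - ?c" by (auto simp: sum_squares_eq_zero_iff)
  then show thesis
    using that[of ?a ?c] e by (simp add: rot_def vec_eq_iff forall_2 power2_eq_square)
qed

lemma G_factored_O31: "g \<in> G_factored \<Longrightarrow> g \<in> O31"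
  unfolding G_factored_def
  by (auto intro!: O31_mult N_minus_O31 N_plus_O31 elim!: rotation_matrix_rot intro: block_diag_rot_O31)

lemma G_factored_pos:
  assumes "g \<in> G_factored"
  shows "g $ 1 $ 1 > 0"
  using assms by (auto simp: G_factored_def matrix_mult_4)

text \<open>The inverse \<open>J g\<^sup>T J\<close> turns the equations \<open>g u = e\<^sub>4\<close> and \<open>g p = c e\<^sub>2\<close> into formulas for the first two
  rows of \<open>g\<close>.\<close>

lemma O31_solve_e4:
  assumes g: "g \<in> O31" and "g *v u = c *\<^sub>R e\<^sub>4"
  shows "u $ 1 = c * g $ 1 $ 4" "u $ 2 = - c * g $ 1 $ 2" "u $ 3 = - c * g $ 1 $ 3" "u $ 4 = c * g $ 1 $ 1"
proof -
  have "u = matrix_inv g *v (c *\<^sub>R e\<^sub>4)"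
    unfolding assms(2)[symmetric] by (simp add: matrix_vector_mul_assoc matrix_inv_O31(2)[OF g])
  then have "u = c *\<^sub>R ((J ** transpose g ** J) *v e\<^sub>4)" by (simp add: scaleR_matrix_vector matrix_inv_O31(1)[OF g])
  then show "u $ 1 = c * g $ 1 $ 4" "u $ 2 = - c * g $ 1 $ 2" "u $ 3 = - c * g $ 1 $ 3" "u $ 4 = c * g $ 1 $ 1"
    by (simp_all add: matrix_vector_mult_4 matrix_mult_4 axis_def transpose_def)
qed

lemma O31_solve_e2:
  assumes g: "g \<in> O31" and "g *v u = c *\<^sub>R axis 2 1"
  shows "u $ 2 = c * g $ 2 $ 2" "u $ 3 = c * g $ 2 $ 3" "u $ 4 = - c * g $ 2 $ 1"
proof -
  have "u = matrix_inv g *v (c *\<^sub>R axis 2 1)"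
    unfolding assms(2)[symmetric] by (simp add: matrix_vector_mul_assoc matrix_inv_O31(2)[OF g])
  then have "u = c *\<^sub>R ((J ** transpose g ** J) *v axis 2 1)" by (simp add: scaleR_matrix_vector matrix_inv_O31(1)[OF g])
  then show "u $ 2 = c * g $ 2 $ 2" "u $ 3 = c * g $ 2 $ 3" "u $ 4 = - c * g $ 2 $ 1"
    by (simp_all add: matrix_vector_mult_4 matrix_mult_4 axis_def transpose_def)
qed

text \<open>Write \<open>U\<close> for the transformed curve \<open>g u\<close>. The conformal normalization says that \<open>U, U', U''\<close> have the middle
  components \<open>0\<close>, \<open>(U\<^sub>3, 0)\<close> and \<open>(2 U\<^sub>3', 0)\<close>; the relations between the inner products of \<open>u, u', u''\<close> then
  force \<open>U\<^sub>3 = 1\<close> and \<open>U\<^sub>3' = 0\<close>.\<close>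

lemma frame_conditions_equivalent:
  assumes u: "cone_curve I u" and s: "arc_length I u" and x: "x \<in> I" and g: "g \<in> G_factored"
  shows "(g *v u x = e\<^sub>4 \<and> g *v dx u x = norm_J (dx u x) *\<^sub>R axis 2 1 \<and> (g *v dx (dx u) x) $ 3 = 0) \<longleftrightarrow>
    (conf_finite g ((Proj \<circ> u) x) \<and> conf_act g ((Proj \<circ> u) x) = 0 \<and>
     dx (\<lambda>y. conf_act g ((Proj \<circ> u) y)) x = axis 1 1 \<and> dx (dx (\<lambda>y. conf_act g ((Proj \<circ> u) y))) x = 0)"
    (is "?L \<longleftrightarrow> ?M")
proof -
  have sm: "smooth_on I u" and cone: "\<And>y. y \<in> I \<Longrightarrow> u y \<in> light_cone" "\<And>y. y \<in> I \<Longrightarrow> u y $ 4 > 0"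
    using u by (auto simp: cone_curve_def)
  note I = smooth_on_open[OF sm]
  have gO: "g \<in> O31" by (rule G_factored_O31[OF g])
  define U where "U = (\<lambda>y. g *v u y)"
  have U: "smooth_on I U" unfolding U_def by (rule smooth_on_bounded_linear[OF bounded_linear_mult_vec sm])
  have dU: "dx U x = g *v dx u x" "dx (dx U) x = g *v dx (dx u) x" unfolding U_def by (rule dx_mult_vec[OF sm x])+
  have act: "conf_act g ((Proj \<circ> u) y) = Proj (U y)" if "y \<in> I" for y
    unfolding U_def using conf_act_Proj(1)[OF cone[OF that]] by simp
  have fin: "conf_finite g ((Proj \<circ> u) x) \<longleftrightarrow> U x $ 4 \<noteq> 0"
    unfolding U_def using conf_act_Proj(2)[OF cone[OF x]] by simp
  define a p q where "a = U x" and "p = dx U x" and "q = dx (dx U) x"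
  have rel: "inner_J a a = 0" "inner_J a p = 0" "inner_J p p = 1" "inner_J a q = -1" "inner_J p q = 0"
    unfolding a_def p_def q_def dU unfolding U_def inner_J_O31[OF gO]
    by (rule arc_length_relations[OF u s x])+
  have nrm: "norm_J (dx u x) = 1" using s x by (simp add: arc_length_def)
  have L: "?L \<longleftrightarrow> a = e\<^sub>4 \<and> p = axis 2 1 \<and> q $ 3 = 0"
    unfolding a_def p_def q_def dU unfolding U_def by (simp add: nrm)
  have M0: "conf_act g ((Proj \<circ> u) x) = 0 \<and> U x $ 4 \<noteq> 0 \<longleftrightarrow> a $ 2 = 0 \<and> a $ 3 = 0 \<and> a $ 4 \<noteq> 0"
    unfolding act[OF x] a_def by (auto simp: Proj_def vec_eq_iff forall_2)
  have M: "?M \<longleftrightarrow> a $ 2 = 0 \<and> a $ 3 = 0 \<and> p $ 2 = a $ 4 \<and> p $ 3 = 0 \<and> q $ 2 = 2 * p $ 4 \<and> q $ 3 = 0"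
    if pos: "a $ 4 > 0"
  proof -
    define S where "S = {y \<in> I. U y $ 4 > 0}"
    have "continuous_on I (\<lambda>y. U y $ 4)"
      by (intro continuous_intros smooth_on_continuous[OF U])
    from continuous_open_preimage[OF this I, of "{0<..}"]
    have S: "open S" by (simp add: S_def vimage_def Int_def)
    have xS: "x \<in> S" using x pos by (simp add: S_def a_def)
    have US: "smooth_on S U" by (rule smooth_on_subset[OF U S]) (auto simp: S_def)
    have U4: "U y $ 4 > 0" if "y \<in> S" for y using that by (simp add: S_def)
    let ?f = "\<lambda>y. conf_act g ((Proj \<circ> u) y)" and ?h = "\<lambda>y. Proj (U y)"
    have fh: "dx ?f y = dx ?h y" if "y \<in> S" for y
      by (rule dx_cong[OF S that]) (rule act, simp add: S_def)
    have ffhh: "dx (dx ?f) x = dx (dx ?h) x" by (rule dx_cong[OF S xS]) (rule fh)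
    have *: "a $ 2 = 0 \<and> a $ 3 = 0 \<and> dx ?h x = axis 1 1 \<and> dx (dx ?h) x = 0 \<longleftrightarrow>
        a $ 2 = 0 \<and> a $ 3 = 0 \<and> p $ 2 = a $ 4 \<and> p $ 3 = 0 \<and> q $ 2 = 2 * p $ 4 \<and> q $ 3 = 0"
    proof (cases "a $ 2 = 0 \<and> a $ 3 = 0")
      case True
      then have a0: "a $ 2 = 0" "a $ 3 = 0" by auto
      note d = dx_Proj[OF US U4 xS, folded a_def p_def q_def] 
      have "dx ?h x = axis 1 1 \<longleftrightarrow> p $ 2 = a $ 4 \<and> p $ 3 = 0"
        using pos by (auto simp: vec_eq_iff forall_2 axis_def d(1,2) a0 field_simps)
      moreover have "dx (dx ?h) x = 0 \<longleftrightarrow> q $ 2 = 2 * p $ 4 \<and> q $ 3 = 0" if "p $ 2 = a $ 4" "p $ 3 = 0"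
        using pos that by (auto simp: vec_eq_iff forall_2 d(3,4) a0 field_simps)
      ultimately show ?thesis using True by blast
    qed auto
    show ?thesis
      unfolding fin fh[OF xS] ffhh using M0 * pos by (auto simp: a_def)
  qed
  show ?thesis
  proof
    assume ?L
    then have l: "a = e\<^sub>4" "p = axis 2 1" "q $ 3 = 0" using L by auto
    have a: "a $ 1 = 0" "a $ 2 = 0" "a $ 3 = 0" "a $ 4 = 1" and p: "p $ 1 = 0" "p $ 2 = 1" "p $ 3 = 0" "p $ 4 = 0"
      by (simp_all add: l axis_def)
    have "q $ 2 = 0" using rel(5) by (simp add: inner_J_coords p)
    then show ?M using M a p l(3) by simp
  next
    assume m: ?M
    then have a: "a $ 2 = 0" "a $ 3 = 0" "a $ 4 \<noteq> 0" using M0 fin by (auto simp: a_def)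
    then have a1: "a $ 1 = 0" using rel(1) by (auto simp: inner_J_coords)
    have "g *v u x = (a $ 4) *\<^sub>R e\<^sub>4"
      using a a1 by (simp add: vec_eq_iff forall_4 axis_def a_def U_def)
    from O31_solve_e4(4)[OF gO this] have "a $ 4 * g $ 1 $ 1 > 0" using cone(2)[OF x] by simp
    then have pos: "a $ 4 > 0" using G_factored_pos[OF g] by (simp add: zero_less_mult_iff)
    with m M have p: "p $ 2 = a $ 4" "p $ 3 = 0" "q $ 2 = 2 * p $ 4" "q $ 3 = 0" by auto
    have p1: "p $ 1 = 0" using rel(2) a a1 by (auto simp: inner_J_coords)
    then have "a $ 4 * a $ 4 = 1" using rel(3) p by (simp add: inner_J_coords)
    then have "a $ 4 = 1 \<or> a $ 4 = -1" by (simp only: square_eq_1_iff)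
    then have a4: "a $ 4 = 1" using pos by auto
    have "q $ 1 = 1" using rel(4) a a1 a4 by (simp add: inner_J_coords)
    then have p4: "p $ 4 = 0" using rel(5) p p1 a4 by (simp add: inner_J_coords)
    have "a = e\<^sub>4" "p = axis 2 1"
      using a a1 a4 p p1 p4 by (simp_all add: vec_eq_iff forall_4 axis_def)
    then show ?L using L p by simp
  qed
qed

lemma frame_L_eq_frame_M:
  assumes "cone_curve I u" "arc_length I u" "x \<in> I"
  shows "frame_L u x = frame_M (Proj \<circ> u) x"
  unfolding frame_L_def frame_M_def
  by (rule arg_cong[where f = The], rule ext) (use frame_conditions_equivalent[OF assms] in blast)

lemma has_Maurer_Cartan_cong:
  assumes I: "open I" and eq: "\<And>x. x \<in> I \<Longrightarrow> \<rho> x = \<sigma> x" and \<rho>: "has_Maurer_Cartan I \<rho> K"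
  shows "has_Maurer_Cartan I \<sigma> K"
  unfolding has_Maurer_Cartan_def
proof (intro ballI conjI)
  fix x assume x: "x \<in> I"
  have "\<rho> differentiable (at x)" using \<rho> x by (simp add: has_Maurer_Cartan_def)
  then show "\<sigma> differentiable (at x)"
    unfolding differentiable_def using has_derivative_transform_within_open[OF _ I x] eq by blast
  show "- (dx \<sigma> x ** matrix_inv (\<sigma> x)) = K x"
    using \<rho> x eq[OF x] dx_cong[of I x \<rho> \<sigma>, OF I x eq] unfolding has_Maurer_Cartan_def by metis
qed

text \<open>If the projection were stationary at \<open>x\<close>, then \<open>u'\<close> would be a multiple of the null vector \<open>u\<close> there,
  contradicting \<open>\<langle>u', u'\<rangle> = 1\<close>.\<close>

lemma sphere_curve_Proj:
  assumes u: "cone_curve I u" and s: "arc_length I u"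
  shows "sphere_curve I (Proj \<circ> u)"
  unfolding sphere_curve_def
proof (intro conjI ballI)
  have sm: "smooth_on I u" and pos: "\<And>y. y \<in> I \<Longrightarrow> u y $ 4 > 0" using u by (auto simp: cone_curve_def)
  show "smooth_on I (Proj \<circ> u)" unfolding comp_def by (rule smooth_on_Proj[OF sm pos])
  fix x assume x: "x \<in> I"
  show "dx (Proj \<circ> u) x \<noteq> 0"
  proof
    assume z: "dx (Proj \<circ> u) x = 0"
    let ?u = "u x" and ?p = "dx u x"
    have e: "?p $ 2 * ?u $ 4 = ?u $ 2 * ?p $ 4" "?p $ 3 * ?u $ 4 = ?u $ 3 * ?p $ 4"
      using dx_Proj(1,2)[OF sm pos x] z pos[OF x] by (auto simp: comp_def)
    note r = arc_length_relations(1-3)[OF u s x, unfolded inner_J_coords]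
    have "?u $ 4 * ?u $ 4 * (- (?p $ 1 * ?p $ 4) + ?p $ 2 * ?p $ 2 + ?p $ 3 * ?p $ 3 - ?p $ 4 * ?p $ 1) = 0"
      using e r(1,2) by algebra
    then show False using r(3) pos[OF x] by simp
  qed
qed

lemma monodromy_Proj:
  assumes u: "cone_curve UNIV u" and m: "\<And>x. u (x + 2 * pi) = \<Theta> *v u x"
  shows "conf_finite \<Theta> (Proj (u x))" "Proj (u (x + 2 * pi)) = conf_act \<Theta> (Proj (u x))"
proof -
  have c: "u y \<in> light_cone" "u y $ 4 > 0" for y using u by (auto simp: cone_curve_def)
  show "conf_finite \<Theta> (Proj (u x))"
    using conf_act_Proj(2)[OF c] c(2)[of "x + 2 * pi"] m by simp
  show "Proj (u (x + 2 * pi)) = conf_act \<Theta> (Proj (u x))"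
    using conf_act_Proj(1)[OF c] m by simp
qed

lemma identity_induced: "induced_by_projectivization (\<lambda>K. K)"
  unfolding induced_by_projectivization_def
proof (intro conjI ballI allI impI)
  show "K \<in> K_M" if "K \<in> K_L1" for K using that by (simp add: K_M_eq)
  fix I u K assume *: "open_interval I \<and> cone_curve I u \<and> arc_length I u \<and> has_Maurer_Cartan I (frame_L u) K"
  then show "sphere_curve I (Proj \<circ> u)" using sphere_curve_Proj by blast
  show "has_Maurer_Cartan I (frame_M (Proj \<circ> u)) K"
    by (rule has_Maurer_Cartan_cong[of I "frame_L u"])
      (use * frame_L_eq_frame_M in \<open>auto simp: open_interval_def\<close>)
next
  fix u \<Theta> x assume *: "cone_curve UNIV u \<and> (\<forall>x. u (x + 2 * pi) = \<Theta> *v u x)"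
  then show "conf_finite \<Theta> (Proj (u x))" "Proj (u (x + 2 * pi)) = conf_act \<Theta> (Proj (u x))"
    using monodromy_Proj[of u \<Theta> x] by auto
qed

section \<open>Curves with given invariants\<close>

text \<open>The integral operator is a contraction on bounded continuous functions of the line when the interval is
  short; functions on the interval are extended by their boundary values by means of the clamping map
  \<open>cl\<close>.\<close>

lemma linear_ode_local_solution:
  fixes A :: "real \<Rightarrow> real^'n^'n"
  assumes A: "continuous_on UNIV A"
  obtains r \<rho> where "r > 0" "\<rho> t0 = mat 1"
    "\<And>t. t \<in> {t0 - r<..<t0 + r} \<Longrightarrow> (\<rho> has_vector_derivative A t ** \<rho> t) (at t)"
proof -
  obtain C where C: "C > 0" "\<And>(X :: real^'n^'n) (Y :: real^'n^'n). norm (X ** Y) \<le> norm X * norm Y * C"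
    using bounded_bilinear.pos_bounded[OF bounded_bilinear_matrix_mult] by blast
  have "bounded (A ` {t0 - 1..t0 + 1})"
    by (intro compact_imp_bounded compact_continuous_image compact_Icc continuous_on_subset[OF A]) auto
  then have "\<exists>M>0. \<forall>y\<in>A ` {t0 - 1..t0 + 1}. norm y \<le> M" by (simp only: bounded_pos)
  then obtain M where M: "M > 0" "\<And>t. t \<in> {t0 - 1..t0 + 1} \<Longrightarrow> norm (A t) \<le> M" by blast
  \<comment> \<open>The integrals from \<open>a\<close> to \<open>t\<close> and from \<open>a\<close> to \<open>t0\<close> run over length at most \<open>2 r\<close> each, so that the
    Lipschitz constant is at most \<open>4 r M C \<le> 1 / 2\<close>.\<close>
  define r where "r = min 1 (1 / (8 * M * C))"
  have r: "r > 0" "r \<le> 1" using M C by (auto simp: r_def)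
  have rMC: "r * (M * C) \<le> 1 / 8"
  proof -
    have "r * (M * C) \<le> 1 / (8 * M * C) * (M * C)"
      using M C by (intro mult_right_mono) (auto simp: r_def)
    also have "\<dots> = 1 / 8" using M C by (simp add: field_simps)
    finally show ?thesis .
  qed
  define a b where "a = t0 - r" and "b = t0 + r"
  have ab: "a < t0" "t0 < b" "a \<le> b" using r by (auto simp: a_def b_def)
  define cl where "cl t = max a (min b t)" for t
  have cl: "cl t \<in> {a..b}" "t \<in> {a..b} \<Longrightarrow> cl t = t" for t using ab by (auto simp: cl_def)
  have cont_cl: "continuous_on UNIV cl" unfolding cl_def by (intro continuous_intros)
  define F where "F \<phi> t = mat 1 + (integral {a..t} (\<lambda>s. A s ** \<phi> s) - integral {a..t0} (\<lambda>s. A s ** \<phi> s))"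
    for \<phi> :: "real \<Rightarrow> real^'n^'n" and t
  have cA: "continuous_on S (\<lambda>s. A s ** apply_bcontfun \<phi> s)" for S and \<phi> :: "(real, real^'n^'n) bcontfun"
    by (intro bounded_bilinear.continuous_on[OF bounded_bilinear_matrix_mult] continuous_on_subset[OF A]) auto
  have int: "(\<lambda>s. A s ** apply_bcontfun \<phi> s) integrable_on {c..d}" for c d and \<phi> :: "(real, real^'n^'n) bcontfun"
    by (intro integrable_continuous_real cA)
  have cF: "continuous_on {a..b} (F (apply_bcontfun \<phi>))" for \<phi>
    unfolding F_def by (intro continuous_intros indefinite_integral_continuous_1 int)
  have bc: "(\<lambda>t. F (apply_bcontfun \<phi>) (cl t)) \<in> bcontfun" for \<phi>
    unfolding bcontfun_def
  proof (intro CollectI conjI)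
    show "continuous_on UNIV (\<lambda>t. F (apply_bcontfun \<phi>) (cl t))"
      by (rule continuous_on_compose2[OF cF cont_cl]) (use cl in auto)
    have "bounded (F (apply_bcontfun \<phi>) ` {a..b})"
      by (intro compact_imp_bounded compact_continuous_image cF compact_Icc)
    then show "bounded (range (\<lambda>t. F (apply_bcontfun \<phi>) (cl t)))"
      by (rule bounded_subset) (use cl in auto)
  qed
  define T where "T \<phi> = Bcontfun (\<lambda>t. F (apply_bcontfun \<phi>) (cl t))" for \<phi>
  have T: "apply_bcontfun (T \<phi>) t = F (apply_bcontfun \<phi>) (cl t)" for \<phi> t
    unfolding T_def by (simp add: Bcontfun_inverse bc)
  have est: "norm (integral {a..t} (\<lambda>s. A s ** apply_bcontfun \<phi> s) - integral {a..t} (\<lambda>s. A s ** apply_bcontfun \<psi> s))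
      \<le> dist \<phi> \<psi> / 4" if t: "t \<in> {a..b}" for t and \<phi> \<psi> :: "(real, real^'n^'n) bcontfun"
  proof -
    have "integral {a..t} (\<lambda>s. A s ** apply_bcontfun \<phi> s) - integral {a..t} (\<lambda>s. A s ** apply_bcontfun \<psi> s)
        = integral {a..t} (\<lambda>s. A s ** (apply_bcontfun \<phi> s - apply_bcontfun \<psi> s))"
      unfolding matrix_minus_mult by (intro integral_diff[symmetric] int)
    also have "norm \<dots> \<le> (M * dist \<phi> \<psi> * C) * (t - a)"
    proof (rule integral_bound)
      show "continuous_on {a..t} (\<lambda>s. A s ** (apply_bcontfun \<phi> s - apply_bcontfun \<psi> s))"
        unfolding matrix_minus_mult by (intro continuous_intros cA)
      fix s assume s: "s \<in> {a..t}"
      have "norm (A s ** (apply_bcontfun \<phi> s - apply_bcontfun \<psi> s)) \<le> norm (A s) * norm (apply_bcontfun \<phi> s - apply_bcontfun \<psi> s) * C"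
        by (rule C(2))
      also have "\<dots> \<le> M * dist \<phi> \<psi> * C"
        using s t r M(1) C(1) dist_bounded[of \<phi> s \<psi>]
        by (intro mult_right_mono mult_mono M(2)) (auto simp: a_def b_def dist_norm)
      finally show "norm (A s ** (apply_bcontfun \<phi> s - apply_bcontfun \<psi> s)) \<le> M * dist \<phi> \<psi> * C" .
    qed (use t in auto)
    also have "\<dots> \<le> (M * dist \<phi> \<psi> * C) * (2 * r)"
      using t M(1) C(1) by (intro mult_left_mono) (auto simp: a_def b_def)
    also have "\<dots> = 2 * (r * (M * C)) * dist \<phi> \<psi>" by (simp add: algebra_simps)
    also have "\<dots> \<le> 2 * (1 / 8) * dist \<phi> \<psi>"
      using rMC by (intro mult_right_mono) auto
    finally show ?thesis by simp
  qed
  have "dist (T \<phi>) (T \<psi>) \<le> 1 / 2 * dist \<phi> \<psi>" for \<phi> \<psi>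
  proof (rule dist_bound)
    fix t
    let ?I = "\<lambda>\<phi> t. integral {a..t} (\<lambda>s. A s ** apply_bcontfun \<phi> s)"
    have "dist (apply_bcontfun (T \<phi>) t) (apply_bcontfun (T \<psi>) t)
        = norm ((?I \<phi> (cl t) - ?I \<psi> (cl t)) - (?I \<phi> t0 - ?I \<psi> t0))"
      unfolding T F_def dist_norm by (simp add: algebra_simps)
    also have "\<dots> \<le> norm (?I \<phi> (cl t) - ?I \<psi> (cl t)) + norm (?I \<phi> t0 - ?I \<psi> t0)"
      by (rule norm_triangle_ineq4)
    also have "\<dots> \<le> dist \<phi> \<psi> / 4 + dist \<phi> \<psi> / 4"
      by (intro add_mono est cl(1)) (use ab in auto)
    finally show "dist (apply_bcontfun (T \<phi>) t) (apply_bcontfun (T \<psi>) t) \<le> 1 / 2 * dist \<phi> \<psi>" by simp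
  qed
  then obtain \<phi> where \<phi>: "T \<phi> = \<phi>" using banach_fix_type[of "1/2" T] by auto
  define \<rho> where "\<rho> = apply_bcontfun \<phi>"
  have eq: "\<rho> t = F \<rho> t" if "t \<in> {a..b}" for t
    using T[of \<phi> t] cl(2)[OF that] unfolding \<phi> \<rho>_def by simp
  show thesis
  proof (rule that[OF r(1)])
    show "\<rho> t0 = mat 1" using eq[of t0] ab by (simp add: F_def)
    fix t assume t: "t \<in> {t0 - r<..<t0 + r}"
    then have t': "t \<in> {a<..<b}" "t \<in> {a..b}" by (auto simp: a_def b_def)
    have "((\<lambda>u. integral {a..u} (\<lambda>s. A s ** \<rho> s)) has_vector_derivative A t ** \<rho> t) (at t within {a..b})"
      by (rule integral_has_vector_derivative[OF _ t'(2)]) (simp add: \<rho>_def cA)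
    then have "((\<lambda>u. integral {a..u} (\<lambda>s. A s ** \<rho> s)) has_vector_derivative A t ** \<rho> t) (at t)"
      using at_within_interior[of t "{a..b}"] t'(1) by simp
    then have "(F \<rho> has_vector_derivative 0 + (A t ** \<rho> t - 0)) (at t)"
      unfolding F_def by (intro has_vector_derivative_add has_vector_derivative_diff has_vector_derivative_const)
    then have "(F \<rho> has_vector_derivative A t ** \<rho> t) (at t)" by simp
    then show "(\<rho> has_vector_derivative A t ** \<rho> t) (at t)"
      by (rule has_vector_derivative_transform_within_open[of _ _ _ "{a<..<b}"]) (use t' eq in auto)
  qed
qed

text \<open>The matrix \<open>\<rho>\<^sup>T J \<rho>\<close> has derivative \<open>- \<rho>\<^sup>T (K\<^sup>T J + J K) \<rho> = 0\<close>.\<close>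

lemma O31_solution:
  assumes K: "\<And>t. K t \<in> o31" and \<rho>: "\<rho> t0 = mat 1"
    "\<And>t. t \<in> {t0 - r<..<t0 + r} \<Longrightarrow> (\<rho> has_vector_derivative - K t ** \<rho> t) (at t)" and r: "r > 0"
    and t: "t \<in> {t0 - r<..<t0 + r}"
  shows "\<rho> t \<in> O31"
proof -
  let ?I = "{t0 - r<..<t0 + r}"
  let ?f = "\<lambda>t. transpose (\<rho> t) ** (J ** \<rho> t)"
  have "(?f has_vector_derivative 0) (at s)" if s: "s \<in> ?I" for s
  proof -
    have tr: "((\<lambda>t. transpose (\<rho> t)) has_vector_derivative transpose (- K s ** \<rho> s)) (at s)"
      by (rule bounded_linear.has_vector_derivative[OF bounded_linear_transpose \<rho>(2)[OF s]])
    have "(?f has_vector_derivative transpose (\<rho> s) ** (J ** (- K s ** \<rho> s) + 0 ** \<rho> s)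
        + transpose (- K s ** \<rho> s) ** (J ** \<rho> s)) (at s)"
      by (intro matrix_has_vector_derivative tr \<rho>(2)[OF s] has_vector_derivative_const)
    moreover have "transpose (- K s ** \<rho> s) = - (transpose (\<rho> s) ** transpose (K s))"
      by (simp add: matrix_minus_mult matrix_transpose_mul[symmetric]) (simp add: transpose_def vec_eq_iff)
    ultimately show ?thesis
      by (simp add: matrix_minus_mult matrix_mul_assoc[symmetric] o31_transpose_J(2)[OF K])
  qed
  then obtain c where c: "\<And>s. s \<in> ?I \<Longrightarrow> ?f s = c"
    using has_vector_derivative_zero_constant[of ?I ?f]
    by (metis (no_types, lifting) convex_real_interval(8) has_vector_derivative_at_within)
  have "c = J" using c[of t0] r by (simp add: \<rho>(1) transpose_mat)
  then show ?thesis using c[OF t] by (simp add: O31_iff matrix_mul_assoc)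
qed

text \<open>An element of the Lorentz group is factored by clearing its first row and column. The last hypothesis
  says, up to the factor \<open>\<alpha>\<^sup>2\<close>, that the orthogonal middle block that remains has positive determinant.\<close>

lemma G_factoredI:
  assumes g: "g \<in> O31" and pos: "g$1$1 > 0"
    and det: "(g$1$1 * g$2$2 - g$2$1 * g$1$2) * (g$1$1 * g$3$3 - g$3$1 * g$1$3)
      - (g$1$1 * g$2$3 - g$2$1 * g$1$3) * (g$1$1 * g$3$2 - g$3$1 * g$1$2) > 0"
  shows "g \<in> G_factored"
proof -
  define \<alpha> where "\<alpha> = g$1$1"
  define v \<xi> :: "real^2" where "v = vector [g$1$2 / \<alpha>, g$1$3 / \<alpha>]" and "\<xi> = vector [g$2$1 / \<alpha>, g$3$1 / \<alpha>]"
  have \<alpha>: "\<alpha> > 0" using pos by (simp add: \<alpha>_def)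
  define h where "h = N_minus (- \<xi>) ** (g ** N_plus (- v))"
  have hO: "h \<in> O31" unfolding h_def by (intro O31_mult N_minus_O31 g N_plus_O31)
  have h0: "h$1$1 = \<alpha>" "h$1$2 = 0" "h$1$3 = 0" "h$2$1 = 0" "h$3$1 = 0"
    unfolding h_def using \<alpha> by (simp_all add: matrix_mult_4 v_def \<xi>_def \<alpha>_def[symmetric])
  have hmid: "h$2$2 = (g$1$1 * g$2$2 - g$2$1 * g$1$2) / \<alpha>" "h$2$3 = (g$1$1 * g$2$3 - g$2$1 * g$1$3) / \<alpha>"
    "h$3$2 = (g$1$1 * g$3$2 - g$3$1 * g$1$2) / \<alpha>" "h$3$3 = (g$1$1 * g$3$3 - g$3$1 * g$1$3) / \<alpha>"
    unfolding h_def using \<alpha> by (simp_all add: matrix_mult_4 v_def \<xi>_def \<alpha>_def[symmetric] field_simps)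
  have dpos: "h$2$2 * h$3$3 - h$2$3 * h$3$2 > 0"
  proof -
    have "h$2$2 * h$3$3 - h$2$3 * h$3$2 = ((g$1$1 * g$2$2 - g$2$1 * g$1$2) * (g$1$1 * g$3$3 - g$3$1 * g$1$3)
      - (g$1$1 * g$2$3 - g$2$1 * g$1$3) * (g$1$1 * g$3$2 - g$3$1 * g$1$2)) / (\<alpha> * \<alpha>)"
      unfolding hmid using \<alpha> by (simp add: divide_simps)
    then show ?thesis using det \<alpha> by simp
  qed
  have e: "(transpose h ** J ** h) $ i $ j = J $ i $ j" for i j using hO by (simp add: O31_iff)
  have e11: "h$4$1 = 0" using e[of 1 1] h0 \<alpha> by (simp add: matrix_mult_4 transpose_def)
  have e12: "h$4$2 = 0" "h$4$3 = 0" using e[of 1 2] e[of 1 3] h0 e11 \<alpha> by (simp_all add: matrix_mult_4 transpose_def)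
  have e14: "h$4$4 = 1 / \<alpha>" using e[of 1 4] h0 e11 \<alpha> by (simp add: matrix_mult_4 transpose_def field_simps)
  have orth: "h$2$2 * h$2$2 + h$3$2 * h$3$2 = 1" "h$2$3 * h$2$3 + h$3$3 * h$3$3 = 1" "h$2$2 * h$2$3 + h$3$2 * h$3$3 = 0"
    using e[of 2 2] e[of 3 3] e[of 2 3] h0 e12 by (simp_all add: matrix_mult_4 transpose_def)
  have ey: "h$2$2 * h$2$4 + h$3$2 * h$3$4 = 0" "h$2$3 * h$2$4 + h$3$3 * h$3$4 = 0"
    using e[of 2 4] e[of 3 4] h0 e12 by (simp_all add: matrix_mult_4 transpose_def)
  have "(h$2$2 * h$3$3 - h$2$3 * h$3$2) * h$2$4 = 0" "(h$2$2 * h$3$3 - h$2$3 * h$3$2) * h$3$4 = 0"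
    using ey by algebra+
  then have y: "h$2$4 = 0" "h$3$4 = 0" using dpos by auto
  have x: "h$1$4 = 0" using e[of 4 4] y e14 \<alpha> by (simp add: matrix_mult_4 transpose_def)
  define A :: "real^2^2" where "A = vector [vector [h$2$2, h$2$3], vector [h$3$2, h$3$3]]"
  have hA: "h = block_diag \<alpha> A"
    by (simp add: mat4_eq_iff forall_4 A_def h0 e11 e12 e14 x y)
  have "(h$2$2 * h$3$3 - h$2$3 * h$3$2) * (h$2$2 * h$3$3 - h$2$3 * h$3$2) = 1"
    using orth by algebra
  then have "h$2$2 * h$3$3 - h$2$3 * h$3$2 = 1 \<or> h$2$2 * h$3$3 - h$2$3 * h$3$2 = -1" by (simp only: square_eq_1_iff)
  then have "h$2$2 * h$3$3 - h$2$3 * h$3$2 = 1" using dpos by auto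
  moreover have "orthogonal_matrix A"
    unfolding orthogonal_matrix using orth
    by (simp add: vec_eq_iff forall_2 matrix_matrix_mult_def sum_2 transpose_def mat_def A_def mult.commute)
  ultimately have rot: "rotation_matrix A" by (simp add: rotation_matrix_def det_2 A_def)
  have N: "N_minus \<xi> ** N_minus (- \<xi>) = mat 1" "N_plus (- v) ** N_plus v = mat 1"
    by (simp_all add: mat4_eq_iff forall_4 matrix_mult_4 power2_eq_square field_simps)
  have "N_minus \<xi> ** h ** N_plus v = (N_minus \<xi> ** N_minus (- \<xi>)) ** g ** (N_plus (- v) ** N_plus v)"
    unfolding h_def by (simp only: matrix_mul_assoc)
  then have "g = N_minus \<xi> ** block_diag \<alpha> A ** N_plus v" unfolding N hA by simp
  then show ?thesis unfolding G_factored_def using \<alpha> rot by blast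
qed

lemma G_factored_entries:
  assumes "g = N_minus \<xi> ** block_diag \<alpha> (rot c s) ** N_plus v"
  shows "g$1$1 = \<alpha>" "g$1$2 = \<alpha> * v$1" "g$1$3 = \<alpha> * v$2" "g$2$1 = \<xi>$1 * \<alpha>"
    "g$2$2 = \<xi>$1 * g$1$2 + c" "g$2$3 = \<xi>$1 * g$1$3 - s"
    "(g *v q) $ 1 = \<alpha> * (q$1 + v$1 * q$2 + v$2 * q$3 + ((v$1)\<^sup>2 + (v$2)\<^sup>2) / 2 * q$4)"
    "(g *v q) $ 3 = \<xi>$2 * (g *v q) $ 1 + s * (q$2 + v$1 * q$4) + c * (q$3 + v$2 * q$4)"
  by (simp_all add: assms matrix_mult_4 matrix_vector_mult_4 algebra_simps)

lemma vec2_eq_iff: "(v :: real^2) = w \<longleftrightarrow> v$1 = w$1 \<and> v$2 = w$2"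
  by (simp add: vec_eq_iff forall_2)

text \<open>The first two rows of the frame are determined by the first two normalizations; what remains is the
  second component of \<open>\<xi>\<close>, which enters the third normalization with a nonzero factor, the first component
  of \<open>g q\<close>.\<close>

lemma frame_L_unique:
  assumes g: "g \<in> G_factored" "g *v u = e\<^sub>4" "g *v p = 1 *\<^sub>R axis 2 1" "(g *v q) $ 3 = 0"
    and h: "h \<in> G_factored" "h *v u = e\<^sub>4" "h *v p = 1 *\<^sub>R axis 2 1" "(h *v q) $ 3 = 0"
    and q: "(g *v q) $ 1 \<noteq> 0"
  shows "g = h"
proof -
  obtain \<xi> \<alpha> c s v where gf: "g = N_minus \<xi> ** block_diag \<alpha> (rot c s) ** N_plus v" and \<alpha>: "\<alpha> > 0"
    using g(1) unfolding G_factored_def by (blast elim: rotation_matrix_rot)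
  obtain \<xi>' \<alpha>' c' s' v' where hf: "h = N_minus \<xi>' ** block_diag \<alpha>' (rot c' s') ** N_plus v'"
    using h(1) unfolding G_factored_def by (blast elim: rotation_matrix_rot)
  note ge = G_factored_entries[OF gf] and he = G_factored_entries[OF hf]
  note gO = G_factored_O31[OF g(1)] and hO = G_factored_O31[OF h(1)]
  have g2: "g *v u = 1 *\<^sub>R e\<^sub>4" and h2: "h *v u = 1 *\<^sub>R e\<^sub>4" using g(2) h(2) by simp_all
  have rows: "g$1$1 = h$1$1" "g$1$2 = h$1$2" "g$1$3 = h$1$3" "g$2$1 = h$2$1" "g$2$2 = h$2$2" "g$2$3 = h$2$3"
    using O31_solve_e4[OF gO g2] O31_solve_e4[OF hO h2] O31_solve_e2[OF gO g(3)] O31_solve_e2[OF hO h(3)] by auto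
  have \<alpha>': "\<alpha>' = \<alpha>" using rows(1) ge he by simp
  have "v' = v" using rows(2,3) ge(2,3) he(2,3) \<alpha> \<alpha>' by (simp add: vec2_eq_iff)
  have \<xi>1: "\<xi>'$1 = \<xi>$1" using rows(4) ge(4) he(4) \<alpha> \<alpha>' by simp
  have "c' = c" "s' = s" using rows ge(5,6) he(5,6) \<xi>1 by simp_all
  have "(g *v q) $ 1 = (h *v q) $ 1" unfolding ge(7) he(7) by (simp add: \<open>\<alpha>' = \<alpha>\<close> \<open>v' = v\<close>)
  then have "\<xi>$2 * (g *v q) $ 1 = \<xi>'$2 * (g *v q) $ 1"
    using g(4) h(4) unfolding ge(8) he(8) \<open>c' = c\<close> \<open>s' = s\<close> \<open>v' = v\<close> by (simp only: add.assoc add_right_cancel)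
  then have "\<xi>' = \<xi>" using q \<xi>1 by (simp add: vec2_eq_iff)
  then show ?thesis unfolding gf hf by (simp add: \<open>c' = c\<close> \<open>s' = s\<close> \<open>v' = v\<close> \<open>\<alpha>' = \<alpha>\<close>)
qed

text \<open>Solve \<open>\<rho>' = - K \<rho>\<close> with \<open>\<rho> = 1\<close> at \<open>t0\<close> and put \<open>u = \<rho>\<^sup>-\<^sup>1 e\<^sub>4\<close>. Then \<open>\<rho>\<close> maps \<open>u, u', u''\<close> to \<open>e\<^sub>4\<close>, \<open>K e\<^sub>4 = e\<^sub>2\<close> and
  \<open>K e\<^sub>2\<close>, which are the normalizations of the frame; close to \<open>t0\<close> the matrix \<open>\<rho>\<close> can be factored, so it
  is the frame of \<open>u\<close>.\<close>

lemma curve_with_invariants: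
  assumes K: "K \<in> K_L1"
  obtains I u where "t0 \<in> I" "open_interval I" "cone_curve I u" "arc_length I u" "has_Maurer_Cartan I (frame_L u) K"
proof -
  have KL: "K \<in> K_L" and k0: "\<And>x. K x $ 1 $ 2 = 1" using K by (auto simp: K_L1_def k0_level_iff)
  have Ko: "K \<in> loops_in o31" by (rule K_L_loop[OF KL])
  have Kx: "K x \<in> o31" for x by (rule loops_inD(3)[OF Ko])
  have sK: "smooth_on UNIV K" by (rule loops_inD(1)[OF Ko])
  have "continuous_on UNIV (\<lambda>t. - K t)" by (intro continuous_intros smooth_continuous_on[OF sK])
  from linear_ode_local_solution[OF this, of t0]
  obtain r \<rho> where r: "r > 0" and \<rho>0: "\<rho> t0 = mat 1"
    and \<rho>: "\<And>t. t \<in> {t0 - r<..<t0 + r} \<Longrightarrow> (\<rho> has_vector_derivative - K t ** \<rho> t) (at t)" by metis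
  have O: "\<rho> t \<in> O31" if "t \<in> {t0 - r<..<t0 + r}" for t
    by (rule O31_solution[of K \<rho> t0 r, OF Kx \<rho>0 \<rho> r that])
  \<comment> \<open>The determinant condition for the factorization, which holds at the identity.\<close>
  define f where "f g = (g$1$1 * g$2$2 - g$2$1 * g$1$2) * (g$1$1 * g$3$3 - g$3$1 * g$1$3)
      - (g$1$1 * g$2$3 - g$2$1 * g$1$3) * (g$1$1 * g$3$2 - g$3$1 * g$1$2)" for g :: mat4
  have "isCont \<rho> t0" using \<rho>[of t0] r has_vector_derivative_continuous by auto
  then have "isCont (\<lambda>t. \<rho> t $ 1 $ 1) t0" "isCont (\<lambda>t. f (\<rho> t)) t0"
    unfolding f_def by (intro continuous_intros; assumption)+
  moreover have "\<rho> t0 $ 1 $ 1 > 0" "f (\<rho> t0) > 0" by (simp_all add: \<rho>0 f_def)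
  ultimately have "\<forall>\<^sub>F t in nhds t0. \<rho> t $ 1 $ 1 > 0" "\<forall>\<^sub>F t in nhds t0. f (\<rho> t) > 0"
    unfolding isCont_def tendsto_at_iff_tendsto_nhds tendsto_at_iff_tendsto_nhds[of "\<lambda>t. f (\<rho> t)"]
      tendsto_at_iff_tendsto_nhds[of "\<lambda>t. \<rho> t $ 1 $ 1"]
    using order_tendstoD(1) by blast+
  then have "\<forall>\<^sub>F t in nhds t0. \<rho> t $ 1 $ 1 > 0 \<and> f (\<rho> t) > 0" by (rule eventually_conj)
  then obtain d where d: "d > 0" "\<And>t. dist t t0 < d \<Longrightarrow> \<rho> t $ 1 $ 1 > 0 \<and> f (\<rho> t) > 0"
    unfolding eventually_nhds_metric by blast
  define e where "e = min r d"
  define I where "I = {t0 - e<..<t0 + e}"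
  have e: "e > 0" "e \<le> r" "e \<le> d" using r d by (auto simp: e_def)
  have I: "open I" "t0 \<in> I" "open_interval I"
    using e by (auto simp: I_def open_interval_def is_interval_convex_1)
  have Ir: "t \<in> {t0 - r<..<t0 + r}" and Id: "dist t t0 < d" if "t \<in> I" for t
    using that e by (auto simp: I_def dist_real_def)
  note \<rho> = \<rho>[OF Ir] and O = O[OF Ir]
  have G: "\<rho> t \<in> G_factored" if "t \<in> I" for t
    using G_factoredI[OF O[OF that]] d(2)[OF Id[OF that]] by (simp add: f_def)
  define W where "W t = matrix_inv (\<rho> t)" for t
  have W: "(W has_vector_derivative W t ** K t) (at t)" if t: "t \<in> I" for t
  proof -
    have "(W has_vector_derivative - (W t ** (- K t ** \<rho> t) ** W t)) (at t)"
      unfolding W_def by (rule O31_matrix_inv_derivative[OF I(1) t O \<rho>[OF t]])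
    moreover have "- (W t ** (- K t ** \<rho> t) ** W t) = W t ** K t"
      by (simp add: matrix_minus_mult W_def matrix_mul_assoc[symmetric] matrix_inv_O31(3)[OF O[OF t]])
    ultimately show ?thesis by simp
  qed
  have sW: "smooth_on I W"
  proof (rule smooth_on_bootstrap[OF I(1) W])
    show "Ck_on I (\<lambda>t. W t ** K t) k" if "Ck_on I W k" for k
    proof (rule Ck_on_bilinear[OF bounded_bilinear_matrix_mult I(1) that])
      show "Ck_on I K k" by (rule Ck_on_subset[of UNIV]) (use sK in \<open>auto simp: smooth_on_def\<close>)
    qed
  qed
  define u where "u t = W t *v e\<^sub>4" for t
  have su: "smooth_on I u"
    unfolding u_def by (rule smooth_on_bounded_linear[OF bounded_linear_mat_vec_left sW])
  have Ke4: "K t *v e\<^sub>4 = axis 2 1" and Ke2: "(K t *v axis 2 1) $ 1 = 1" "(K t *v axis 2 1) $ 3 = 0" for t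
  proof -
    obtain k1 k2 where "K t = o31_mat 0 1 0 k1 k2 0" using KL k0[of t] by (auto simp: K_L_def K_mat_o31_mat)
    then show "K t *v e\<^sub>4 = axis 2 1" "(K t *v axis 2 1) $ 1 = 1" "(K t *v axis 2 1) $ 3 = 0"
      by (simp_all add: vec_eq_iff forall_4 matrix_vector_mult_4 axis_def)
  qed
  have dv: "dx (\<lambda>t. W t *v v) t = W t *v (K t *v v)" if "t \<in> I" for t v
    unfolding matrix_vector_mul_assoc by (rule dx_bounded_linear[OF bounded_linear_mat_vec_left W[OF that]])
  have du: "dx u t = W t *v axis 2 1" if "t \<in> I" for t
    unfolding u_def dv[OF that] Ke4 ..
  have ddu: "dx (dx u) t = W t *v (K t *v axis 2 1)" if t: "t \<in> I" for t
    using dx_cong[of I t "dx u" "\<lambda>t. W t *v axis 2 1", OF I(1) t du] dv[OF t] by simp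
  have WO: "W t \<in> O31" if "t \<in> I" for t unfolding W_def by (rule O31_matrix_inv[OF O[OF that]])
  have n1: "norm_J (dx u t) = 1" if "t \<in> I" for t
    unfolding norm_J_def du[OF that] inner_J_O31[OF WO[OF that]] by (simp add: inner_J_coords axis_def)
  have cone: "u t \<in> light_cone" "u t $ 4 > 0" if t: "t \<in> I" for t
  proof -
    show "u t \<in> light_cone"
      unfolding light_cone_def u_def by (simp add: inner_J_O31[OF WO[OF t]]) (simp add: inner_J_coords axis_def)
    have "u t $ 4 = \<rho> t $ 1 $ 1"
      unfolding u_def W_def matrix_inv_O31(1)[OF O[OF t]]
      by (simp add: matrix_vector_mult_4 matrix_mult_4 axis_def transpose_def)
    then show "u t $ 4 > 0" using d(2)[OF Id[OF t]] by simp
  qed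
  have frame: "frame_L u t = \<rho> t" if t: "t \<in> I" for t
  proof -
    have \<rho>W: "\<rho> t *v (W t *v v) = v" for v
      by (simp add: matrix_vector_mul_assoc W_def matrix_inv_O31(3)[OF O[OF t]])
    have a: "\<rho> t *v u t = e\<^sub>4" unfolding u_def by (rule \<rho>W)
    have b: "\<rho> t *v dx u t = 1 *\<^sub>R axis 2 1" unfolding du[OF t] \<rho>W by simp
    have c: "(\<rho> t *v dx (dx u) t) $ 3 = 0" "(\<rho> t *v dx (dx u) t) $ 1 \<noteq> 0"
      unfolding ddu[OF t] \<rho>W by (simp_all add: Ke2)
    show ?thesis
      unfolding frame_L_def n1[OF t]
    proof (rule the_equality)
      show "\<rho> t \<in> G_factored \<and> \<rho> t *v u t = e\<^sub>4 \<and> \<rho> t *v dx u t = 1 *\<^sub>R axis 2 1 \<and> (\<rho> t *v dx (dx u) t) $ 3 = 0"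
        using G[OF t] a b c by blast
      show "g = \<rho> t" if "g \<in> G_factored \<and> g *v u t = e\<^sub>4 \<and> g *v dx u t = 1 *\<^sub>R axis 2 1 \<and> (g *v dx (dx u) t) $ 3 = 0" for g
        using frame_L_unique[OF G[OF t] a b c(1), of g] that c(2) by simp
    qed
  qed
  have mc: "has_Maurer_Cartan I \<rho> K"
    unfolding has_Maurer_Cartan_def
  proof (intro ballI conjI)
    fix t assume t: "t \<in> I"
    show "\<rho> differentiable at t"
      using \<rho>[OF t] unfolding has_vector_derivative_def differentiable_def by blast
    show "- (dx \<rho> t ** matrix_inv (\<rho> t)) = K t"
      unfolding dx_eqI[OF \<rho>[OF t]]
      by (simp add: matrix_minus_mult matrix_mul_assoc[symmetric] matrix_inv_O31(3)[OF O[OF t]])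
  qed
  show thesis
  proof (rule that[OF I(2,3)])
    show "cone_curve I u" using su cone n1 by (simp add: cone_curve_def)
    show "arc_length I u" using n1 by (simp add: arc_length_def)
    show "has_Maurer_Cartan I (frame_L u) K"
      by (rule has_Maurer_Cartan_cong[OF I(1) _ mc]) (simp add: frame)
  qed
qed

lemma induced_unique:
  assumes \<Psi>: "induced_by_projectivization \<Psi>" and K: "K \<in> K_L1"
  shows "\<Psi> K = K"
proof
  fix t
  obtain I u where t: "t \<in> I" and u: "open_interval I \<and> cone_curve I u \<and> arc_length I u \<and> has_Maurer_Cartan I (frame_L u) K"
    using curve_with_invariants[OF K, of t] by metis
  have "has_Maurer_Cartan I (frame_M (Proj \<circ> u)) (\<Psi> K)" "has_Maurer_Cartan I (frame_M (Proj \<circ> u)) K"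
    using \<Psi> identity_induced K u unfolding induced_by_projectivization_def by blast+
  then show "\<Psi> K t = K t" using t unfolding has_Maurer_Cartan_def by metis
qed

theorem theorem5p2:
  shows "(\<exists>\<Phi>. induced_by_projectivization \<Phi> \<and>
             (\<forall>\<Psi>. induced_by_projectivization \<Psi> \<longrightarrow> (\<forall>K\<in>K_L1. \<Psi> K = \<Phi> K)) \<and>
             poisson_map K_L1 bracket_L1 K_M bracket_M \<Phi> \<and>
             poisson_equivalence K_L1 bracket_L1 K_M bracket_M \<Phi>)
       \<and> partition_on K_L (k0_level ` loops_in {0<..})
       \<and> (\<forall>c\<in>loops_in {0<..}. poisson_submanifold K_L bracket_L (k0_level c))
       \<and> (\<forall>c::real. c > 0 \<longrightarrow> poisson_submanifold K_L bracket_L (k0_level (\<lambda>_. c)))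
       \<and> poisson_submanifold K_L bracket_L K_L1"
proof (intro conjI allI ballI impI)
  show "\<exists>\<Phi>. induced_by_projectivization \<Phi> \<and>
             (\<forall>\<Psi>. induced_by_projectivization \<Psi> \<longrightarrow> (\<forall>K\<in>K_L1. \<Psi> K = \<Phi> K)) \<and>
             poisson_map K_L1 bracket_L1 K_M bracket_M \<Phi> \<and>
             poisson_equivalence K_L1 bracket_L1 K_M bracket_M \<Phi>"
    using identity_induced induced_unique identity_poisson_map(1)[of "\<lambda>K. K"] identity_poisson_equivalence
    by (intro exI[of _ "\<lambda>K. K"]) auto
  show "partition_on K_L (k0_level ` loops_in {0<..})" by (rule k0_level_partition)
  show "poisson_submanifold K_L bracket_L (k0_level c)" if "c \<in> loops_in {0<..}" for c
    by (rule k0_level_poisson_submanifold[OF that])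
  show "poisson_submanifold K_L bracket_L (k0_level (\<lambda>_. c))" if "c > 0" for c :: real
    by (rule k0_level_poisson_submanifold[OF loop_const]) (use that in simp)
  show "poisson_submanifold K_L bracket_L K_L1"
    unfolding K_L1_def by (rule k0_level_poisson_submanifold[OF one_loop])
qed

end
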